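(* Assume that $H$ (equivalently its Lagrangian $L$) and $F$ satisfy the standing assumptions (L1)-(L3) and (F1)-(F3) listed in the context. Then the following hold. (1) For every $\tau\in(0,\tau_0)$ there exist a sequence $\lambda_i\to0$, a measure $m_0^\tau\in\mathcal P(\mathbb T^d)$ and a function $u_0^\tau$ such that $m_\tau^{\lambda_i}\to m_0^\tau$ weakly-$*$ and $u^{\lambda_i}_{\tau,m_\tau^{\lambda_i}}-\frac{\bar L(\tau,m_\tau^{\lambda_i})}{\lambda_i}$ converges uniformly to $u_0^\tau$, where $m_0^\tau$ is a minimizing $\tau$-holonomic measure for (MFG) and $u_0^\tau$ is a solution of the undiscounted discrete Lax-Oleinik equation $$u(y)+\tau\bar L(\tau,m_0^\tau)=\inf_{x\in\mathbb R^d}\big(u(x)+\mathcal L_{\tau,m_0^\tau}(x,y)\big),\quad\forall y\in\mathbb R^d.$$ (2) There exist a sequence $\tau_j\to0$, a measure $m_0\in\mathcal P(\mathbb T^d)$ and a function $u_0$ such that, for the pairs $(u_0^{\tau_j},m_0^{\tau_j})$ obtained in (1), $m_0^{\tau_j}\to m_0$ weakly-$*$, $u_0^{\tau_j}$ converges uniformly to $u_0$, and $(u_0,m_0)$ is a solution of the system (MFG).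
   Context: Setting. $\mathbb T^d=\mathbb R^d/\mathbb Z^d$, $\Pi:\mathbb R^d\to\mathbb T^d$ is the quotient map, $\pi:\mathbb T^d\times\mathbb R^d\to\mathbb T^d$ is the projection, and $\pi\sharp\mu$ is the push-forward. Functions on $\mathbb T^d$ are identified with $\mathbb Z^d$-periodic functions on $\mathbb R^d$. $\mathcal P(X)$ is the set of Borel probability measures on $X$; $\mathcal P(\mathbb T^d)$ carries the weak-$*$ topology, metrized by the Kantorovich-Rubinstein distance $d_1$. $H:\mathbb T^d\times\mathbb R^d\to\mathbb R$ is a Tonelli Hamiltonian: $C^2$; $\partial^2H/\partial p^2(x,p)$ positive definite everywhere; for each $K>0$ there is $C(K)\in\mathbb R$ with $H(x,p)\ge K|p|+C(K)$ for all $(x,p)$. $L(x,v)=\sup_p(\langle p,v\rangle-H(x,p))$ is its Lagrangian, which satisfies: (L1) $L\in C^2$; (L2) $\partial^2L/\partial v^2$ positive definite everywhere; (L3) for each $K>0$ there is $C(K)\in\mathbb R$ with $L(x,v)\ge K|v|+C(K)$. $F:\mathbb T^d\times\mathcal P(\mathbb T^d)\to\mathbb R$ satisfies: (F1) for each $m$, $x\mapsto F(x,m)$ is $C^2$ and there is $F_\infty>0$ with $\|F(\cdot,m)\|_\infty,\|D_xF(\cdot,m)\|_\infty\le F_\infty$ for all $m$; (F2) $F$ and $D_xF$ are continuous on $\mathbb T^d\times\mathcal P(\mathbb T^d)$; (F3) there is $\mathrm{Lip}(F)>0$ with $|F(x,m_1)-F(x,m_2)|\le\mathrm{Lip}(F)\,d_1(m_1,m_2)$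 for all $x,m_1,m_2$. For $m\in\mathcal P(\mathbb T^d)$: $H_m(x,p)=H(x,p)-F(x,m)$, $L_m(x,v)=L(x,v)+F(x,m)$. $c(m)$ is the Mañé critical value of $L_m$: the unique $k\in\mathbb R$ such that $H_m(x,Du)=k$ has a viscosity solution on $\mathbb T^d$. A solution of (MFG) is a pair $(u,m)\in C(\mathbb T^d)\times\mathcal P(\mathbb T^d)$ such that $u$ is a viscosity solution of $H(x,Du)=F(x,m)+c(m)$ on $\mathbb T^d$, $Du(x)$ exists for $m$-a.e. $x$, and $\int_{\mathbb T^d}\langle Df(x),\frac{\partial H}{\partial p}(x,Du(x))\rangle\,dm=0$ for all $f\in C^\infty(\mathbb T^d)$. Discounted discretization. For $\tau\in(0,1)$, $\lambda\in(0,1]$, $m\in\mathcal P(\mathbb T^d)$ put $\mathcal L_{\tau,m}(x,y)=\tau\big(L(x,\frac{y-x}{\tau})+F(x,m)\big)$, $x,y\in\mathbb R^d$. $u^\lambda_{\tau,m}$ denotes the unique continuous $\mathbb Z^d$-periodic solution of $u(y)=\inf_{x\in\mathbb R^d}\big((1-\tau\lambda)u(x)+\mathcal L_{\tau,m}(x,y)\big)$ for all $y\in\mathbb R^d$. A discounted calibrated configuration of $u^\lambda_{\tau,m}(x)$ is a sequence $\{x_{-k}\}_{k\ge0}\subset\mathbb R^d$ with $x_0=x$ and $u^\lambda_{\tau,m}(x_{-k})=(1-\tau\lambda)u^\lambda_{\tau,m}(x_{-k-1})+\mathcal L_{\tau,m}(x_{-k-1},x_{-k})$ for all $k\ge0$.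 $\tilde\Sigma^\tau_{L_m,\lambda}$ is the set of $([x],v)\in\mathbb T^d\times\mathbb R^d$ for which there are $x\in\mathbb R^d$ with $\Pi(x)=[x]$ and a discounted calibrated configuration $\{x_{-k}\}_{k\ge0}$ of $u^\lambda_{\tau,m}(x+\tau v)$ with $x_{-1}=x$ (so $\frac{x_0-x_{-1}}\tau=v$). For $n\in\mathbb N$, $\Psi^n_{L_m,\lambda,\tau}([x],v)$ is the set of all points $\big(\Pi(x_{-n-1}),\frac{x_{-n}-x_{-n-1}}{\tau}\big)$ obtained from such $x$ and such configurations; $\Psi^n_{L_m,\lambda,\tau}(S)$ is the union over $S$. The discrete discounted Aubry set is $\tilde{\mathcal A}^\tau_{L_m,\lambda}=\bigcap_{n\in\mathbb N}\Psi^n_{L_m,\lambda,\tau}(\tilde\Sigma^\tau_{L_m,\lambda})$. A measure $\mu\in\mathcal P(\mathbb T^d\times\mathbb R^d)$ is $\tau$-holonomic if $\int\varphi(x+\tau v)\,d\mu=\int\varphi(x)\,d\mu$ for all $\varphi\in C(\mathbb T^d)$; the set of these is $\mathcal P_\tau(\mathbb T^d\times\mathbb R^d)$. A minimizing $\tau$-holonomic $\lambda$-measure for $L_m$ is a $\tau$-holonomic $\mu$ with $\mathrm{spt}(\mu)\subset\tilde{\mathcal A}^\tau_{L_m,\lambda}$ and $\int(L_m(x,v)-\lambda u^\lambda_{\tau,m}(x))\,d\mu=0$. For every $\tau\in(0,1)$, $\lambda\in(0,1]$ there is $m\in\mathcal P(\mathbb T^d)$ for which some minimizing $\tau$-holonomic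 $\lambda$-measure $\mu$ for $L_m$ satisfies $m=\pi\sharp\mu$; for each $(\tau,\lambda)$ one such $m$ is fixed and denoted $m^\lambda_\tau$. Undiscounted discretization. For $\tau>0$ and $m\in\mathcal P(\mathbb T^d)$, $\bar L(\tau,m)$ is the unique real number such that $u(y)+\tau\bar L(\tau,m)=\inf_{x\in\mathbb R^d}(u(x)+\mathcal L_{\tau,m}(x,y))$, $y\in\mathbb R^d$, has a continuous $\mathbb Z^d$-periodic solution; one has $\bar L(\tau,m)=\min_{\mu\in\mathcal P_\tau(\mathbb T^d\times\mathbb R^d)}\int L_m\,d\mu$, and a $\mu$ attaining the minimum is called a minimizing $\tau$-holonomic measure for $L_m$. A measure $m\in\mathcal P(\mathbb T^d)$ is a minimizing $\tau$-holonomic measure for (MFG) if there is a minimizing $\tau$-holonomic measure $\mu$ for $L_m$ with $m=\pi\sharp\mu$. The constant $\tau_0\in(0,1]$ is fixed such that (as is known to be possible) there is a compact $K\subset\mathbb T^d\times\mathbb R^d$ containing the support of every minimizing $\tau$-holonomic measure for $L_m$, for all $\tau\in(0,\tau_0)$ and $m\in\mathcal P(\mathbb T^d)$, and such that for each $\tau\in(0,\tau_0)$ a minimizing $\tau$-holonomic measure for (MFG) exists. *)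

theory Defs
  imports "HOL-Probability.Probability"
begin

section \<open>The flat torus\<close>

definition int_lattice :: "(real ^ 'd) set" where
  "int_lattice = {k. \<forall>i. k $ i \<in> \<int>}"

lemma int_lattice_0: "0 \<in> int_lattice"
  by (simp add: int_lattice_def)

lemma int_lattice_add: "k \<in> int_lattice \<Longrightarrow> l \<in> int_lattice \<Longrightarrow> k + l \<in> int_lattice"
  by (simp add: int_lattice_def)

lemma int_lattice_minus: "k \<in> int_lattice \<Longrightarrow> - k \<in> int_lattice"
  by (simp add: int_lattice_def)

lemma int_lattice_diff: "k \<in> int_lattice \<Longrightarrow> l \<in> int_lattice \<Longrightarrow> k - l \<in> int_lattice"
  by (simp add: int_lattice_def)

lemma closed_int_lattice: "closed (int_lattice :: (real ^ 'd) set)"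
proof -
  have "(int_lattice :: (real ^ 'd) set) = (\<Inter>i. (\<lambda>x. x $ i) -` \<int>)"
    by (auto simp: int_lattice_def)
  moreover have "closed (\<Inter>i. (\<lambda>x :: real ^ 'd. x $ i) -` \<int>)"
    by (intro closed_INT ballI closed_vimage_vec_nth closed_Ints)
  ultimately show ?thesis
    by (simp only:)
qed

definition lattice_rel :: "real ^ 'd \<Rightarrow> real ^ 'd \<Rightarrow> bool" where
  "lattice_rel x y \<longleftrightarrow> x - y \<in> int_lattice"

lemma equivp_lattice_rel: "equivp lattice_rel"
proof (rule equivpI)
  show "reflp lattice_rel"
    by (simp add: reflp_def lattice_rel_def int_lattice_0)
  show "symp lattice_rel"
    using int_lattice_minus by (fastforce simp: symp_def lattice_rel_def)
  show "transp lattice_rel"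
    using int_lattice_add by (fastforce simp: transp_def lattice_rel_def)
qed

quotient_type 'd torus = "real ^ 'd::finite" / lattice_rel
  by (rule equivp_lattice_rel)

lift_definition tproj :: "real ^ 'd::finite \<Rightarrow> 'd torus" is "\<lambda>x. x" .

lemma tproj_eq_iff: "tproj x = tproj y \<longleftrightarrow> x - y \<in> int_lattice"
  by transfer (simp add: lattice_rel_def)

lemma tproj_surj: "\<exists>x. tproj x = X"
  by transfer (meson equivp_lattice_rel equivp_reflp)

instantiation torus :: (finite) ab_group_add
begin

lift_definition zero_torus :: "'a torus" is 0 .

lift_definition plus_torus :: "'a torus \<Rightarrow> 'a torus \<Rightarrow> 'a torus" is "(+)"
  unfolding lattice_rel_def by (metis add_diff_add int_lattice_add)

lift_definition uminus_torus :: "'a torus \<Rightarrow> 'a torus" is uminus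
  unfolding lattice_rel_def using int_lattice_minus by fastforce

lift_definition minus_torus :: "'a torus \<Rightarrow> 'a torus \<Rightarrow> 'a torus" is "(-)"
  unfolding lattice_rel_def by (metis (no_types, lifting) diff_diff_eq2 diff_add_eq diff_diff_add
      add.commute int_lattice_diff)

instance
  by standard (transfer; simp add: lattice_rel_def int_lattice_0 algebra_simps)+

end

lemma tproj_add: "tproj (x + y) = tproj x + tproj y"
  by transfer (simp add: lattice_rel_def int_lattice_0)

lemma infdist_lattice_le:
  assumes "x - y \<in> int_lattice"
  shows "infdist x int_lattice \<le> infdist y int_lattice"
proof -
  have "infdist x int_lattice \<le> dist y k" if "k \<in> int_lattice" for k
  proof -
    have "k + (x - y) \<in> int_lattice"
      using assms that by (simp add: int_lattice_add)
    then have "infdist x int_lattice \<le> dist x (k + (x - y))"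
      by (rule infdist_le)
    also have "\<dots> = dist y k"
      by (simp add: dist_norm algebra_simps)
    finally show ?thesis .
  qed
  moreover obtain k where "k \<in> int_lattice" "infdist y int_lattice = dist y k"
    using infdist_attains_inf[OF closed_int_lattice, of y] int_lattice_0 by blast
  ultimately show ?thesis
    by simp
qed

lemma infdist_lattice_cong:
  assumes "x - y \<in> int_lattice"
  shows "infdist x int_lattice = infdist y int_lattice"
  using infdist_lattice_le[OF assms] infdist_lattice_le[of y x] int_lattice_minus[OF assms]
  by simp

lemma infdist_lattice_add:
  "infdist (x + y) int_lattice \<le> infdist x int_lattice + infdist y (int_lattice :: (real ^ 'd) set)"
proof -
  obtain k where k: "k \<in> int_lattice" "infdist x int_lattice = dist x k"
    using infdist_attains_inf[OF closed_int_lattice, of x] int_lattice_0 by blast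
  obtain l where l: "l \<in> int_lattice" "infdist y int_lattice = dist y l"
    using infdist_attains_inf[OF closed_int_lattice, of y] int_lattice_0 by blast
  have "infdist (x + y) int_lattice \<le> dist (x + y) (k + l)"
    by (simp add: infdist_le int_lattice_add k l)
  also have "\<dots> \<le> dist x k + dist y l"
    by (rule dist_triangle_add)
  finally show ?thesis
    using k l by simp
qed

lemma infdist_lattice_minus:
  "infdist (- x) int_lattice = infdist x (int_lattice :: (real ^ 'd) set)"
proof -
  have le: "infdist (- x) int_lattice \<le> infdist x int_lattice" for x :: "real ^ 'd"
  proof -
    obtain k where k: "k \<in> int_lattice" "infdist x int_lattice = dist x k"
      using infdist_attains_inf[OF closed_int_lattice, of x] int_lattice_0 by blast
    have "infdist (- x) int_lattice \<le> dist (- x) (- k)"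
      by (simp add: infdist_le int_lattice_minus k)
    then show ?thesis
      using k by (simp add: dist_minus)
  qed
  show ?thesis
    using le[of x] le[of "- x"] by simp
qed

instantiation torus :: (finite) metric_space
begin

lift_definition dist_torus :: "'a torus \<Rightarrow> 'a torus \<Rightarrow> real"
  is "\<lambda>x y. infdist (x - y) int_lattice"
  unfolding lattice_rel_def
proof (rule infdist_lattice_cong)
  fix a b c d :: "real ^ 'a"
  assume "a - b \<in> int_lattice" "c - d \<in> int_lattice"
  then have "(a - b) - (c - d) \<in> int_lattice"
    by (rule int_lattice_diff)
  then show "a - c - (b - d) \<in> int_lattice"
    by (simp add: algebra_simps)
qed

definition uniformity_torus :: "('a torus \<times> 'a torus) filter" where
  "uniformity_torus = (INF e\<in>{0<..}. principal {(x, y). dist x y < e})"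

definition open_torus :: "'a torus set \<Rightarrow> bool" where
  "open_torus U \<longleftrightarrow> (\<forall>x\<in>U. eventually (\<lambda>(x', y). x' = x \<longrightarrow> y \<in> U) uniformity)"

instance
proof
  have "infdist z int_lattice = 0 \<longleftrightarrow> z \<in> int_lattice" for z :: "real ^ 'a"
    using in_closed_iff_infdist_zero[OF closed_int_lattice] int_lattice_0 by blast
  then show "dist x y = 0 \<longleftrightarrow> x = y" for x y :: "'a torus"
    by transfer (simp add: lattice_rel_def)
  show "dist x y \<le> dist x z + dist y z" for x y z :: "'a torus"
  proof transfer
    fix x y z :: "real ^ 'a"
    show "infdist (x - y) int_lattice \<le> infdist (x - z) int_lattice + infdist (y - z) int_lattice"
      using infdist_lattice_add[of "x - z" "z - y"] infdist_lattice_minus[of "y - z"] by simp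
  qed
qed (simp_all add: uniformity_torus_def open_torus_def)

end

lemma dist_tproj_le: "dist (tproj x) (tproj y) \<le> dist x y"
proof -
  have "infdist (x - y) int_lattice \<le> dist (x - y) 0"
    by (rule infdist_le) (rule int_lattice_0)
  then show ?thesis
    by transfer (simp add: dist_norm)
qed

lemma dist_tproj_attained: "\<exists>x'. tproj x' = tproj x \<and> dist (tproj x) (tproj y) = dist x' y"
proof -
  obtain k where k: "k \<in> int_lattice" "infdist (x - y) int_lattice = dist (x - y) k"
    using infdist_attains_inf[OF closed_int_lattice, of "x - y"] int_lattice_0 by blast
  have "tproj (x - k) = tproj x"
    using int_lattice_minus[OF k(1)] by (simp add: tproj_eq_iff)
  moreover have "dist (tproj x) (tproj y) = infdist (x - y) int_lattice"
    by transfer simp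
  moreover have "dist (x - y) k = dist (x - k) y"
    by (simp add: dist_norm algebra_simps)
  ultimately show ?thesis
    using k by auto
qed

lemma continuous_tproj: "continuous_on UNIV tproj"
  by (metis continuous_on_iff dist_tproj_le le_less_trans)

text \<open>The metric topology is the quotient topology.\<close>

lemma open_torus_iff: "open U \<longleftrightarrow> open (tproj -` U)"
proof
  assume "open U"
  then show "open (tproj -` U)"
    using continuous_tproj by (rule open_vimage)
next
  assume *: "open (tproj -` U)"
  show "open U"
    unfolding open_dist
  proof
    fix X assume "X \<in> U"
    obtain x where x: "tproj x = X"
      using tproj_surj by blast
    with * \<open>X \<in> U\<close> obtain e where e: "e > 0" "\<And>y. dist y x < e \<Longrightarrow> tproj y \<in> U"
      unfolding open_dist by auto
    have "Y \<in> U" if "dist Y X < e" for Y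
      by (metis that tproj_surj dist_tproj_attained e(2) x)
    with e(1) show "\<exists>e>0. \<forall>y. dist y X < e \<longrightarrow> y \<in> U"
      by blast
  qed
qed


section \<open>Differentiability\<close>

definition grad :: "('a::real_inner \<Rightarrow> real) \<Rightarrow> 'a \<Rightarrow> 'a" where
  "grad f x = (THE D. GDERIV f x :> D)"

fun C_k :: "nat \<Rightarrow> ('a::euclidean_space \<Rightarrow> real) \<Rightarrow> bool" where
  "C_k 0 f \<longleftrightarrow> continuous_on UNIV f"
| "C_k (Suc k) f \<longleftrightarrow>
     (\<exists>g. (\<forall>x. GDERIV f x :> g x) \<and> (\<forall>b\<in>Basis. C_k k (\<lambda>x. inner (g x) b)))"

text \<open>Functions on the torus are differentiated through their periodic lifts.\<close>

definition torus_gderiv :: "('d::finite torus \<Rightarrow> real) \<Rightarrow> 'd torus \<Rightarrow> real ^ 'd \<Rightarrow> bool" where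
  "torus_gderiv f X D \<longleftrightarrow> (\<forall>x. tproj x = X \<longrightarrow> (GDERIV (\<lambda>y. f (tproj y)) x :> D))"

definition torus_grad :: "('d::finite torus \<Rightarrow> real) \<Rightarrow> 'd torus \<Rightarrow> real ^ 'd" where
  "torus_grad f X = (THE D. torus_gderiv f X D)"


section \<open>Borel probability measures\<close>

definition borel_prob :: "'a::topological_space measure set" where
  "borel_prob = {m. prob_space m \<and> sets m = sets borel}"

definition weak_star :: "'a::topological_space measure topology" where
  "weak_star =
     pullback_topology borel_prob
       (\<lambda>m. \<lambda>f\<in>{f. continuous_on UNIV f}. integral\<^sup>L m f)
       (product_topology (\<lambda>_. euclideanreal) {f. continuous_on UNIV f})"

lemma topspace_weak_star: "topspace weak_star = borel_prob"
  by (auto simp: weak_star_def topspace_pullback_topology)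

lemma limitin_weak_star:
  fixes ms :: "nat \<Rightarrow> 'a::topological_space measure"
  assumes "\<And>n. ms n \<in> borel_prob"
  shows "limitin weak_star ms m sequentially \<longleftrightarrow>
    m \<in> borel_prob \<and>
    (\<forall>f :: 'a \<Rightarrow> real. continuous_on UNIV f \<longrightarrow> (\<lambda>n. integral\<^sup>L (ms n) f) \<longlonglongrightarrow> integral\<^sup>L m f)"
proof -
  let ?C = "{f :: 'a \<Rightarrow> real. continuous_on UNIV f}"
  let ?e = "\<lambda>m. \<lambda>f\<in>?C. integral\<^sup>L m f"
  let ?T = "product_topology (\<lambda>_. euclideanreal) ?C"
  have open_iff: "openin weak_star S \<longleftrightarrow> (\<exists>U. openin ?T U \<and> S = ?e -` U \<inter> borel_prob)" for S
    by (simp only: weak_star_def openin_pullback_topology)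
  have "limitin weak_star ms m sequentially \<longleftrightarrow>
      m \<in> borel_prob \<and> limitin ?T (\<lambda>n. ?e (ms n)) (?e m) sequentially"
  proof safe
    assume lim: "limitin weak_star ms m sequentially"
    then show m: "m \<in> borel_prob"
      by (simp add: limitin_def topspace_weak_star)
    show "limitin ?T (\<lambda>n. ?e (ms n)) (?e m) sequentially"
      unfolding limitin_def
    proof safe
      show "?e m \<in> topspace ?T"
        by simp
      fix U assume "openin ?T U" "?e m \<in> U"
      then have "openin weak_star (?e -` U \<inter> borel_prob)" "m \<in> ?e -` U \<inter> borel_prob"
        using open_iff m by auto
      with lim have "\<forall>\<^sub>F n in sequentially. ms n \<in> ?e -` U \<inter> borel_prob"
        unfolding limitin_def by blast
      then show "\<forall>\<^sub>F n in sequentially. ?e (ms n) \<in> U"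
        by eventually_elim simp
    qed
  next
    assume m: "m \<in> borel_prob" and lim: "limitin ?T (\<lambda>n. ?e (ms n)) (?e m) sequentially"
    show "limitin weak_star ms m sequentially"
      unfolding limitin_def
    proof safe
      show "m \<in> topspace weak_star"
        using m by (simp add: topspace_weak_star)
      fix S assume "openin weak_star S" "m \<in> S"
      then obtain U where U: "openin ?T U" "S = ?e -` U \<inter> borel_prob"
        using open_iff by blast
      with \<open>m \<in> S\<close> lim have "\<forall>\<^sub>F n in sequentially. ?e (ms n) \<in> U"
        unfolding limitin_def by blast
      then show "\<forall>\<^sub>F n in sequentially. ms n \<in> S"
        by eventually_elim (simp add: U assms)
    qed
  qed
  also have "limitin ?T (\<lambda>n. ?e (ms n)) (?e m) sequentially \<longleftrightarrow>
      (\<forall>f\<in>?C. (\<lambda>n. integral\<^sup>L (ms n) f) \<longlonglongrightarrow> integral\<^sup>L m f)"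
    by (subst limitin_componentwise) simp
  finally show ?thesis
    by simp
qed

text \<open>The Kantorovich-Rubinstein distance.\<close>

definition KR_dist :: "'a::metric_space measure \<Rightarrow> 'a measure \<Rightarrow> real" where
  "KR_dist m1 m2 =
     (SUP f\<in>{f :: 'a \<Rightarrow> real. 1-lipschitz_on UNIV f}. integral\<^sup>L m1 f - integral\<^sup>L m2 f)"

definition spt :: "'a::topological_space measure \<Rightarrow> 'a set" where
  "spt \<mu> = {z. \<forall>U. open U \<and> z \<in> U \<longrightarrow> emeasure \<mu> U > 0}"


section \<open>Hamiltonians, Lagrangians and the coupling\<close>

text \<open>The same three conditions are used for Hamiltonians and for Lagrangians.\<close>

definition tonelli :: "('d::finite torus \<Rightarrow> real ^ 'd \<Rightarrow> real) \<Rightarrow> bool" where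
  "tonelli G \<longleftrightarrow>
     C_k 2 (\<lambda>(x, p). G (tproj x) p) \<and>
     (\<forall>X p. \<exists>A. (grad (G X) has_derivative A) (at p) \<and> (\<forall>h. h \<noteq> 0 \<longrightarrow> inner (A h) h > 0)) \<and>
     (\<forall>K>0. \<exists>C. \<forall>X p. G X p \<ge> K * norm p + C)"

definition lagrangian ::
    "('d::finite torus \<Rightarrow> real ^ 'd \<Rightarrow> real) \<Rightarrow> 'd torus \<Rightarrow> real ^ 'd \<Rightarrow> real" where
  "lagrangian H X v = (SUP p. inner p v - H X p)"

definition coupling :: "('d::finite torus \<Rightarrow> 'd torus measure \<Rightarrow> real) \<Rightarrow> bool" where
  "coupling F \<longleftrightarrow>
     (\<forall>m\<in>borel_prob. C_k 2 (\<lambda>x. F (tproj x) m)) \<and>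
     (\<exists>F_inf>0. \<forall>m\<in>borel_prob. \<forall>X.
        \<bar>F X m\<bar> \<le> F_inf \<and> norm (torus_grad (\<lambda>Y. F Y m) X) \<le> F_inf) \<and>
     continuous_map (prod_topology euclidean weak_star) euclidean (\<lambda>(X, m). F X m) \<and>
     continuous_map (prod_topology euclidean weak_star) euclidean
       (\<lambda>(X, m). torus_grad (\<lambda>Y. F Y m) X) \<and>
     (\<exists>Lip>0. \<forall>X. \<forall>m1\<in>borel_prob. \<forall>m2\<in>borel_prob.
        \<bar>F X m1 - F X m2\<bar> \<le> Lip * KR_dist m1 m2)"

definition ham_at :: "('d::finite torus \<Rightarrow> real ^ 'd \<Rightarrow> real) \<Rightarrow>
    ('d torus \<Rightarrow> 'd torus measure \<Rightarrow> real) \<Rightarrow> 'd torus measure \<Rightarrow> 'd torus \<Rightarrow> real ^ 'd \<Rightarrow> real" where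
  "ham_at H F m X p = H X p - F X m"

definition lag_at :: "('d::finite torus \<Rightarrow> real ^ 'd \<Rightarrow> real) \<Rightarrow>
    ('d torus \<Rightarrow> 'd torus measure \<Rightarrow> real) \<Rightarrow> 'd torus measure \<Rightarrow> 'd torus \<Rightarrow> real ^ 'd \<Rightarrow> real" where
  "lag_at L F m X v = L X v + F X m"


section \<open>Viscosity solutions and the mean field game system\<close>

text \<open>Viscosity solutions of \<open>G(x, Du) = k\<close>.  Test functions are local, on the universal cover.\<close>

definition viscosity_solution ::
    "('d::finite torus \<Rightarrow> real ^ 'd \<Rightarrow> real) \<Rightarrow> real \<Rightarrow> ('d torus \<Rightarrow> real) \<Rightarrow> bool" where
  "viscosity_solution G k u \<longleftrightarrow>
     continuous_on UNIV u \<and>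
     (\<forall>\<phi> x. C_k 1 \<phi> \<longrightarrow>
        ((\<forall>\<^sub>F y in nhds x. u (tproj y) - \<phi> y \<le> u (tproj x) - \<phi> x) \<longrightarrow> G (tproj x) (grad \<phi> x) \<le> k) \<and>
        ((\<forall>\<^sub>F y in nhds x. u (tproj y) - \<phi> y \<ge> u (tproj x) - \<phi> x) \<longrightarrow> G (tproj x) (grad \<phi> x) \<ge> k))"

definition mane_value :: "('d::finite torus \<Rightarrow> real ^ 'd \<Rightarrow> real) \<Rightarrow> real" where
  "mane_value G = (THE k. \<exists>u. viscosity_solution G k u)"

definition MFG_solution :: "('d::finite torus \<Rightarrow> real ^ 'd \<Rightarrow> real) \<Rightarrow>
    ('d torus \<Rightarrow> 'd torus measure \<Rightarrow> real) \<Rightarrow> ('d torus \<Rightarrow> real) \<Rightarrow> 'd torus measure \<Rightarrow> bool" where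
  "MFG_solution H F u m \<longleftrightarrow>
     m \<in> borel_prob \<and>
     viscosity_solution (ham_at H F m) (mane_value (ham_at H F m)) u \<and>
     (AE X in m. \<exists>D. torus_gderiv u X D) \<and>
     (\<forall>f. (\<forall>k. C_k k (\<lambda>x. f (tproj x))) \<longrightarrow>
        has_bochner_integral m (\<lambda>X. inner (torus_grad f X) (grad (H X) (torus_grad u X))) 0)"


section \<open>Discrete Lax-Oleinik equations\<close>

text \<open>In this section and the next the argument \<open>Lm\<close> stands for the Lagrangian \<open>lag_at L F m\<close>.\<close>

definition action ::
    "real \<Rightarrow> ('d::finite torus \<Rightarrow> real ^ 'd \<Rightarrow> real) \<Rightarrow> real ^ 'd \<Rightarrow> real ^ 'd \<Rightarrow> real" where
  "action \<tau> Lm x y = \<tau> * Lm (tproj x) ((y - x) /\<^sub>R \<tau>)"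

definition discounted_solution ::
    "real \<Rightarrow> real \<Rightarrow> ('d::finite torus \<Rightarrow> real ^ 'd \<Rightarrow> real) \<Rightarrow> 'd torus \<Rightarrow> real" where
  "discounted_solution \<tau> lam Lm =
     (THE u. continuous_on UNIV u \<and>
        (\<forall>y. u (tproj y) = (INF x. (1 - \<tau> * lam) * u (tproj x) + action \<tau> Lm x y)))"

definition lax_oleinik_solution ::
    "real \<Rightarrow> ('d::finite torus \<Rightarrow> real ^ 'd \<Rightarrow> real) \<Rightarrow> real \<Rightarrow> ('d torus \<Rightarrow> real) \<Rightarrow> bool" where
  "lax_oleinik_solution \<tau> Lm k u \<longleftrightarrow>
     continuous_on UNIV u \<and>
     (\<forall>y. u (tproj y) + \<tau> * k = (INF x. u (tproj x) + action \<tau> Lm x y))"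

definition effective_const ::
    "real \<Rightarrow> ('d::finite torus \<Rightarrow> real ^ 'd \<Rightarrow> real) \<Rightarrow> real" where
  "effective_const \<tau> Lm = (THE k. \<exists>u. lax_oleinik_solution \<tau> Lm k u)"


section \<open>Holonomic measures and discounted Aubry sets\<close>

definition holonomic :: "real \<Rightarrow> ('d::finite torus \<times> (real ^ 'd)) measure set" where
  "holonomic \<tau> = {\<mu> \<in> borel_prob. \<forall>\<phi> :: 'd torus \<Rightarrow> real. continuous_on UNIV \<phi> \<longrightarrow>
     (\<integral>(X, v). \<phi> (X + tproj (\<tau> *\<^sub>R v)) \<partial>\<mu>) = (\<integral>(X, v). \<phi> X \<partial>\<mu>)}"

text \<open>A Tonelli Lagrangian is bounded below, so a non-integrable one has integral \<open>+\<infinity>\<close>; hence only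
  measures with integrable \<open>Lm\<close> compete in the minimization.\<close>

definition minimizing_holonomic :: "real \<Rightarrow> ('d::finite torus \<Rightarrow> real ^ 'd \<Rightarrow> real) \<Rightarrow>
    ('d torus \<times> (real ^ 'd)) measure \<Rightarrow> bool" where
  "minimizing_holonomic \<tau> Lm \<mu> \<longleftrightarrow>
     \<mu> \<in> holonomic \<tau> \<and> integrable \<mu> (\<lambda>(X, v). Lm X v) \<and>
     (\<forall>\<nu>\<in>holonomic \<tau>. integrable \<nu> (\<lambda>(X, v). Lm X v) \<longrightarrow>
        (\<integral>(X, v). Lm X v \<partial>\<mu>) \<le> (\<integral>(X, v). Lm X v \<partial>\<nu>))"

definition MFG_minimizing_holonomic :: "real \<Rightarrow> ('d::finite torus \<Rightarrow> real ^ 'd \<Rightarrow> real) \<Rightarrow>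
    ('d torus \<Rightarrow> 'd torus measure \<Rightarrow> real) \<Rightarrow> 'd torus measure \<Rightarrow> bool" where
  "MFG_minimizing_holonomic \<tau> L F m \<longleftrightarrow>
     m \<in> borel_prob \<and>
     (\<exists>\<mu>. minimizing_holonomic \<tau> (lag_at L F m) \<mu> \<and> m = distr \<mu> borel fst)"

text \<open>Configurations are indexed by \<open>k \<ge> 0\<close>: \<open>xs k\<close> is the point \<open>x\<^sub>-\<^sub>k\<close>.\<close>

definition calibrated :: "real \<Rightarrow> real \<Rightarrow> ('d::finite torus \<Rightarrow> real ^ 'd \<Rightarrow> real) \<Rightarrow>
    real ^ 'd \<Rightarrow> (nat \<Rightarrow> real ^ 'd) \<Rightarrow> bool" where
  "calibrated \<tau> lam Lm x xs \<longleftrightarrow>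
     xs 0 = x \<and>
     (\<forall>k. discounted_solution \<tau> lam Lm (tproj (xs k)) =
        (1 - \<tau> * lam) * discounted_solution \<tau> lam Lm (tproj (xs (Suc k)))
          + action \<tau> Lm (xs (Suc k)) (xs k))"

definition Sigma_disc :: "real \<Rightarrow> real \<Rightarrow> ('d::finite torus \<Rightarrow> real ^ 'd \<Rightarrow> real) \<Rightarrow>
    ('d torus \<times> (real ^ 'd)) set" where
  "Sigma_disc \<tau> lam Lm =
     {(X, v). \<exists>x xs. tproj x = X \<and> calibrated \<tau> lam Lm (x + \<tau> *\<^sub>R v) xs \<and> xs 1 = x}"

definition Psi_disc :: "real \<Rightarrow> real \<Rightarrow> ('d::finite torus \<Rightarrow> real ^ 'd \<Rightarrow> real) \<Rightarrow> nat \<Rightarrow>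
    ('d torus \<times> (real ^ 'd)) set \<Rightarrow> ('d torus \<times> (real ^ 'd)) set" where
  "Psi_disc \<tau> lam Lm n S =
     (\<Union>(X, v)\<in>S. {(tproj (xs (n + 1)), (xs n - xs (n + 1)) /\<^sub>R \<tau>) | x xs.
        tproj x = X \<and> calibrated \<tau> lam Lm (x + \<tau> *\<^sub>R v) xs \<and> xs 1 = x})"

definition aubry_disc :: "real \<Rightarrow> real \<Rightarrow> ('d::finite torus \<Rightarrow> real ^ 'd \<Rightarrow> real) \<Rightarrow>
    ('d torus \<times> (real ^ 'd)) set" where
  "aubry_disc \<tau> lam Lm = (\<Inter>n. Psi_disc \<tau> lam Lm n (Sigma_disc \<tau> lam Lm))"

definition minimizing_discounted :: "real \<Rightarrow> real \<Rightarrow> ('d::finite torus \<Rightarrow> real ^ 'd \<Rightarrow> real) \<Rightarrow>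
    ('d torus \<times> (real ^ 'd)) measure \<Rightarrow> bool" where
  "minimizing_discounted \<tau> lam Lm \<mu> \<longleftrightarrow>
     \<mu> \<in> holonomic \<tau> \<and> spt \<mu> \<subseteq> aubry_disc \<tau> lam Lm \<and>
     has_bochner_integral \<mu> (\<lambda>(X, v). Lm X v - lam * discounted_solution \<tau> lam Lm X) 0"


section \<open>The vanishing discount limit at a fixed time step\<close>

text \<open>Here \<open>mm\<close> is a selection of measures for the discounted problems with time step \<open>\<tau>\<close>.\<close>

definition vanishing_discount_limit :: "('d::finite torus \<Rightarrow> real ^ 'd \<Rightarrow> real) \<Rightarrow>
    ('d torus \<Rightarrow> 'd torus measure \<Rightarrow> real) \<Rightarrow> real \<Rightarrow> (real \<Rightarrow> 'd torus measure) \<Rightarrow>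
    (nat \<Rightarrow> real) \<Rightarrow> 'd torus measure \<Rightarrow> ('d torus \<Rightarrow> real) \<Rightarrow> bool" where
  "vanishing_discount_limit L F \<tau> mm lams m0 u0 \<longleftrightarrow>
     (\<forall>i. lams i \<in> {0<..1}) \<and> lams \<longlonglongrightarrow> 0 \<and>
     limitin weak_star (\<lambda>i. mm (lams i)) m0 sequentially \<and>
     uniform_limit UNIV
       (\<lambda>i X. discounted_solution \<tau> (lams i) (lag_at L F (mm (lams i))) X
          - effective_const \<tau> (lag_at L F (mm (lams i))) / lams i)
       u0 sequentially \<and>
     MFG_minimizing_holonomic \<tau> L F m0 \<and>
     lax_oleinik_solution \<tau> (lag_at L F m0) (effective_const \<tau> (lag_at L F m0)) u0"

end

theory Submission
  imports Defs "HOL-Complex_Analysis.Great_Picard"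
begin

text \<open>
  For a fixed time step, a comparison argument shows that the discounted solution differs from
  \<open>effective_const \<tau> (lag_at L F m) / lam\<close> by at most the oscillation of a Lax-Oleinik solution.
  The discounted solutions are equi-Lipschitz and the minimizing measures live on a common compact
  set, so both have limits; integrating the calibration identity identifies the limit measure as
  minimizing.

  As the time step tends to 0, Lax-Oleinik solutions are Lipschitz uniformly in the time step and in
  the measure.  Discrete curves of constant velocity give the subsolution property of the limit, and
  calibrated backward chains together with Young's inequality give the supersolution property.  Over
  the support of a minimizing holonomic measure every point lies on a calibrated chain that is
  infinite in both directions.  Perturbing the backward and the forward half touches the solution by
  affine functions from above and from below, with an error that is uniform in the time step and in
  the measure.  Hence the limit is differentiable on the projected support of the limit measure, the
  velocity there is the Legendre dual of the gradient, and holonomy becomes the continuity equation.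
\<close>

section \<open>The torus and its Borel measures\<close>

text \<open>The assumptions bound \<open>F\<close> and its space gradient uniformly in the measure,
  but not its second derivatives, so semiconcavity of the value functions cannot be quantified
  uniformly. Compactness of the set of measures gives instead one modulus of continuity for all
  these gradients, and first-order expansions with a common admissible size
  \<open>\<delta> e\<close> replace semiconcavity; being inequalities of fixed form, they survive
  the limit. At a fixed time step the torus is crossed in one step, a bound that degenerates as the
  step shrinks; cutting displacements into steps of velocity at most 1 gives the uniform bounds.
  Since (2) concerns arbitrary limits as in (1), not one construction, these bounds and the value of
  the minimal action must be recovered from the limit relations. The critical value carries a sign:
  effective constants converge to some \<open>\<kappa>\<close> along a subsequence, the limit solves
  the equation with constant \<open>- \<kappa>\<close>, and uniqueness of the critical value
  identifies it. At the support, \<open>L + F - \<kappa> \<le> inner v p\<close> and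
  \<open>H - F \<le> - \<kappa>\<close> together make Young's inequality an equality.\<close>

lemma tproj_0 [simp]: "tproj 0 = 0"
  by transfer (simp add: lattice_rel_def int_lattice_0)

lemma tproj_minus: "tproj (- x) = - tproj x"
  by (metis add_eq_0_iff tproj_0 tproj_add add.right_inverse)

lemma tproj_diff: "tproj (x - y) = tproj x - tproj y"
  by (metis tproj_add tproj_minus add_uminus_conv_diff)

lemma dist_torus_add_le: "dist (X + tproj h) X \<le> norm h"
proof -
  obtain x where x: "tproj x = X"
    using tproj_surj by blast
  have "dist (tproj (x + h)) (tproj x) \<le> dist (x + h) x"
    by (rule dist_tproj_le)
  then show ?thesis
    by (simp add: x tproj_add dist_norm)
qed

text \<open>Turns a pair of torus points into a base point and a shortest displacement, so that
  estimates for shifts by \<open>tproj h\<close> become estimates in \<open>dist\<close>.\<close>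

lemma torus_shift_obtain:
  fixes X Y :: "'d::finite torus"
  obtains h where "Y = X + tproj h" "norm h = dist X Y"
proof -
  obtain x y where xy: "tproj x = X" "tproj y = Y"
    using tproj_surj[of X] tproj_surj[of Y] by auto
  obtain y' where y': "tproj y' = tproj y" "dist (tproj y) (tproj x) = dist y' x"
    using dist_tproj_attained[of y x] by auto
  have "Y = X + tproj (y' - x)"
    using y' xy by (simp add: tproj_diff)
  moreover have "norm (y' - x) = dist X Y"
    using y'(2) xy by (simp add: dist_norm norm_minus_commute dist_commute)
  ultimately show ?thesis
    using that by blast
qed

lemma torus_lift_cbox: "\<exists>x\<in>cbox 0 (1 :: real ^ 'd::finite). tproj x = X"
proof -
  obtain y where y: "tproj y = X"
    using tproj_surj by blast
  define x where "x = (\<chi> i. frac (y $ i))"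
  have "x - y \<in> int_lattice"
    by (auto simp: int_lattice_def x_def frac_def)
  then have "tproj x = X"
    using y tproj_eq_iff by metis
  moreover have "x \<in> cbox 0 1"
    by (auto simp: mem_box_cart x_def less_imp_le[OF frac_lt_1])
  ultimately show ?thesis
    by blast
qed

lemma compact_torus: "compact (UNIV :: 'd::finite torus set)"
proof -
  have "tproj ` cbox 0 (1 :: real ^ 'd) = UNIV"
  proof (intro set_eqI iffI)
    fix X :: "'d torus"
    show "X \<in> tproj ` cbox 0 (1 :: real ^ 'd)"
      using torus_lift_cbox[of X] by (auto simp: image_iff)
  qed simp
  moreover have "compact (tproj ` cbox 0 (1 :: real ^ 'd))"
    by (intro compact_continuous_image continuous_on_subset[OF continuous_tproj]) auto
  ultimately show ?thesis
    by simp
qed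

text \<open>The saturation of \<open>U\<close> is the union of its lattice translates. Images of a
  countable base upstairs therefore form a base of the torus.\<close>

lemma open_tproj_image:
  fixes U :: "(real ^ 'd::finite) set"
  assumes "open U"
  shows "open (tproj ` U)"
proof -
  have "tproj -` tproj ` U = (\<Union>k\<in>int_lattice. (+) k ` U)" (is "?L = ?R")
  proof (intro subset_antisym subsetI)
    fix x assume "x \<in> ?L"
    then obtain y where *: "tproj x = tproj y" "y \<in> U"
      by auto
    have "x - y \<in> int_lattice"
      using * by (simp add: tproj_eq_iff)
    moreover have "x \<in> (+) (x - y) ` U"
      using * by (intro image_eqI[of _ _ y]) auto
    ultimately show "x \<in> ?R"
      by (rule UN_I)
  next
    fix x assume "x \<in> ?R"
    then obtain k y where *: "k \<in> int_lattice" "y \<in> U" "x = k + y"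
      by auto
    then have "tproj x = tproj y"
      by (simp add: tproj_eq_iff)
    then show "x \<in> ?L"
      using * by auto
  qed
  moreover have "open (\<Union>k\<in>int_lattice. (+) k ` U)"
    using assms by (intro open_UN ballI open_translation)
  ultimately show ?thesis
    by (simp add: open_torus_iff)
qed

instance torus :: (finite) second_countable_topology
proof
  obtain B :: "(real ^ 'a) set set" where B: "countable B" "topological_basis B"
    using ex_countable_basis by blast
  have "topological_basis ((`) tproj ` B)"
  proof (rule topological_basisI)
    fix U :: "'a torus set" and X assume U: "open U" "X \<in> U"
    obtain x where x: "tproj x = X"
      using tproj_surj by blast
    have *: "open (tproj -` U)" "x \<in> tproj -` U"
      using U x by (auto simp: open_torus_iff)
    obtain b where "b \<in> B" "x \<in> b" "b \<subseteq> tproj -` U"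
      using topological_basisE[OF B(2) *] .
    then show "\<exists>b'\<in>(`) tproj ` B. X \<in> b' \<and> b' \<subseteq> U"
      using x by (intro bexI[of _ "tproj ` b"]) auto
  next
    fix b' assume "b' \<in> (`) tproj ` B"
    then show "open b'"
      using B(2) by (auto intro: open_tproj_image topological_basis_open)
  qed
  then show "\<exists>B :: 'a torus set set. countable B \<and> open = generate_topology B"
    using B(1) by (meson countable_image topological_basis_imp_subbasis)
qed

instance torus :: (finite) heine_borel
proof
  fix f :: "nat \<Rightarrow> 'a torus"
  have "seq_compact (UNIV :: 'a torus set)"
    using compact_torus by (simp add: compact_eq_seq_compact_metric)
  then show "\<exists>l r. strict_mono (r :: nat \<Rightarrow> nat) \<and> (f \<circ> r) \<longlonglongrightarrow> l"
    unfolding seq_compact_def by blast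
qed

lemma continuous_torus_lift:
  fixes f :: "'d::finite torus \<Rightarrow> 'b::topological_space"
  assumes "continuous_on UNIV (\<lambda>x. f (tproj x))"
  shows "continuous_on UNIV f"
proof -
  have "open (f -` U)" if "open U" for U
    using that open_vimage[OF that assms] by (simp add: open_torus_iff vimage_def)
  then show ?thesis
    by (simp add: continuous_on_open_vimage)
qed

lemma continuous_torus_times_lift:
  fixes f :: "'d::finite torus \<Rightarrow> 'a::metric_space \<Rightarrow> 'b::metric_space"
  assumes "continuous_on UNIV (\<lambda>(x, v). f (tproj x) v)"
  shows "continuous_on UNIV (\<lambda>(X, v). f X v)"
proof -
  have "\<exists>d>0. \<forall>Y w. dist (Y, w) (X, v) < d \<longrightarrow> dist (f Y w) (f X v) < e" if "e > 0" for X v e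
  proof -
    obtain x where x: "tproj x = X"
      using tproj_surj by blast
    obtain d where d: "d > 0" "\<And>y w. dist (y, w) (x, v) < d \<Longrightarrow> dist (f (tproj y) w) (f (tproj x) v) < e"
      using assms \<open>e > 0\<close> unfolding continuous_on_iff by fastforce
    have "dist (f Y w) (f X v) < e" if "dist (Y, w) (X, v) < d" for Y w
    proof -
      obtain y' where "tproj y' = Y"
        using tproj_surj by blast
      \<comment> \<open>Among the lifts of \<open>Y\<close> the one nearest to \<open>x\<close> is
        taken: its distance to \<open>x\<close> is exactly \<open>dist Y X\<close>, so the modulus
        of the lifted function carries over unchanged.\<close>
      then obtain y where y: "tproj y = Y" "dist Y X = dist y x"
        using dist_tproj_attained[of y' x] x by auto
      then have "dist (y, w) (x, v) < d"
        using that by (simp add: dist_Pair_Pair)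
      then show ?thesis
        using d(2) y x by blast
    qed
    with d(1) show ?thesis
      by blast
  qed
  then show ?thesis
    unfolding continuous_on_iff by (auto simp: split_paired_all)
qed

section \<open>Supports of Borel probability measures\<close>

lemma spt_closed: "closed (spt \<mu>)"
proof -
  have "open (- spt \<mu>)"
  proof (subst open_subopen, safe)
    fix z assume "z \<notin> spt \<mu>"
    then obtain U where "open U" "z \<in> U" "\<not> emeasure \<mu> U > 0"
      by (auto simp: spt_def)
    then show "\<exists>T. open T \<and> z \<in> T \<and> T \<subseteq> - spt \<mu>"
      by (intro exI[of _ U]) (auto simp: spt_def)
  qed
  then show ?thesis
    by (simp add: closed_def)
qed

lemma borel_probD:
  assumes "\<mu> \<in> borel_prob"
  shows "prob_space \<mu>" "sets \<mu> = sets borel" "space \<mu> = UNIV"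
  using assms sets_eq_imp_space_eq[of \<mu> borel] by (auto simp: borel_prob_def)

text \<open>The null members of a countable base have a null union, and this union covers the
  complement of the support.\<close>

lemma AE_spt:
  fixes \<mu> :: "'a::second_countable_topology measure"
  assumes "\<mu> \<in> borel_prob"
  shows "AE z in \<mu>. z \<in> spt \<mu>"
proof -
  obtain B :: "'a set set" where B: "countable B" "topological_basis B"
    using ex_countable_basis by blast
  define N where "N = {b\<in>B. emeasure \<mu> b = 0}"
  have "b \<in> null_sets \<mu>" if "b \<in> N" for b
    using that topological_basis_open[OF B(2)] borel_probD(2)[OF assms]
    by (auto simp: N_def null_sets_def)
  then have "\<Union>N \<in> null_sets \<mu>"
    using B(1) null_sets_UN'[of N "\<lambda>b. b" \<mu>] by (auto simp: N_def)
  moreover have "- spt \<mu> \<subseteq> \<Union>N"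
  proof safe
    fix z assume "z \<notin> spt \<mu>"
    then obtain U where U: "open U" "z \<in> U" "emeasure \<mu> U = 0"
      by (auto simp: spt_def zero_less_iff_neq_zero)
    obtain b where b: "b \<in> B" "z \<in> b" "b \<subseteq> U"
      using topological_basisE[OF B(2) U(1,2)] .
    have "emeasure \<mu> b \<le> emeasure \<mu> U"
      using U b borel_probD(2)[OF assms] by (intro emeasure_mono) auto
    then show "z \<in> \<Union>N"
      using U b by (auto simp: N_def)
  qed
  ultimately show ?thesis
    using borel_probD(3)[OF assms] by (intro AE_I'[of "\<Union>N"]) auto
qed

text \<open>Upgrades an integral identity to a pointwise one: a continuous function that is positive
  at a support point is positive on a set of positive mass. Applied to the calibration defect and to
  tent functions.\<close>

lemma zero_on_spt:
  fixes g :: "'a::second_countable_topology \<Rightarrow> real"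
  assumes \<mu>: "\<mu> \<in> borel_prob" and g: "continuous_on UNIV g" "integrable \<mu> g"
    and nn: "AE z in \<mu>. 0 \<le> g z" and int: "integral\<^sup>L \<mu> g \<le> 0" and z: "z \<in> spt \<mu>"
  shows "g z \<le> 0"
proof (rule ccontr)
  assume "\<not> g z \<le> 0"
  define U where "U = g -` {0<..}"
  have "open U" "z \<in> U"
    using g(1) \<open>\<not> g z \<le> 0\<close> by (auto simp: U_def intro: open_vimage)
  then have "emeasure \<mu> U > 0"
    using z by (auto simp: spt_def)
  have "integral\<^sup>L \<mu> g = 0"
    using int integral_nonneg_AE[OF nn] by simp
  then have "AE z in \<mu>. g z = 0"
    using integral_nonneg_eq_0_iff_AE[OF g(2) nn] by simp
  then have "AE z in \<mu>. z \<notin> U"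
    by eventually_elim (simp add: U_def)
  then have "emeasure \<mu> U = 0"
    using \<open>open U\<close> borel_probD[OF \<mu>] by (subst (asm) AE_iff_measurable[of U]) auto
  with \<open>emeasure \<mu> U > 0\<close> show False
    by simp
qed

subsection \<open>Weak compactness\<close>

text \<open>At the first disagreement the sums differ by a full place value, and with digits 0 and 1
  in base 3 the whole tail can undo at most half of it. In base 2 the tail could undo all of
  it.\<close>

lemma ternary_separation:
  fixes a b :: "nat \<Rightarrow> real"
  assumes a: "\<And>n. a n \<in> {0, 1}" and b: "\<And>n. b n \<in> {0, 1}" and "a N \<noteq> b N"
  shows "(1/3) ^ N / 2 \<le> \<bar>(\<Sum>n. a n * (1/3) ^ n) - (\<Sum>n. b n * (1/3) ^ n)\<bar>"
proof -
  define M where "M = (LEAST n. a n \<noteq> b n)"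
  have M: "a M \<noteq> b M" "\<And>n. n < M \<Longrightarrow> a n = b n" "M \<le> N"
    unfolding M_def using assms(3) not_less_Least[of _ "\<lambda>n. a n \<noteq> b n"]
    by - (rule LeastI[of "\<lambda>n. a n \<noteq> b n"], assumption, blast, rule Least_le)
  define c where "c n = (a n - b n) * (1/3::real) ^ n" for n
  have geo: "summable (\<lambda>n. (1/3::real) ^ n)"
    by (simp add: summable_geometric)
  have bd: "\<bar>a n\<bar> \<le> 1" "\<bar>b n\<bar> \<le> 1" "\<bar>a n - b n\<bar> \<le> 1" for n
    using a[of n] b[of n] by auto
  have sa: "summable (\<lambda>n. a n * (1/3) ^ n)"
    by (rule summable_comparison_test'[OF geo, of 0]) (use bd in \<open>auto simp: abs_mult intro: mult_left_le_one_le\<close>)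
  have sb: "summable (\<lambda>n. b n * (1/3) ^ n)"
    by (rule summable_comparison_test'[OF geo, of 0]) (use bd in \<open>auto simp: abs_mult intro: mult_left_le_one_le\<close>)
  have c_eq: "c = (\<lambda>n. a n * (1/3) ^ n - b n * (1/3) ^ n)"
    by (auto simp: c_def algebra_simps)
  have sc: "summable c"
    unfolding c_eq by (rule summable_diff[OF sa sb])
  have diff: "(\<Sum>n. a n * (1/3) ^ n) - (\<Sum>n. b n * (1/3) ^ n) = suminf c"
    unfolding c_eq by (rule suminf_diff[OF sa sb])
  have split: "suminf c = (\<Sum>n. c (n + Suc M)) + (\<Sum>i<Suc M. c i)"
    by (rule suminf_split_initial_segment[OF sc])
  have head: "\<bar>\<Sum>i<Suc M. c i\<bar> = (1/3) ^ M"
    using M(1,2) a[of M] b[of M] by (auto simp: c_def)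
  have tail_sums: "(\<lambda>n. (1/3) ^ Suc M * (1/3::real) ^ n) sums ((1/3) ^ Suc M * (1 / (1 - 1/3)))"
    by (intro sums_mult geometric_sums) auto
  have le: "norm (c (n + Suc M)) \<le> (1/3) ^ Suc M * (1/3::real) ^ n" for n
    using bd(3)[of "n + Suc M"] by (auto simp: c_def abs_mult power_add mult.commute intro!: mult_right_le_one_le mult_left_le_one_le)
  have "norm (\<Sum>n. c (n + Suc M)) \<le> (\<Sum>n. (1/3) ^ Suc M * (1/3::real) ^ n)"
    by (rule norm_suminf_le[OF le]) (rule sums_summable[OF tail_sums])
  also have "\<dots> = (1/3) ^ M / 2"
    using sums_unique[OF tail_sums] by simp
  finally have "\<bar>suminf c\<bar> \<ge> (1/3) ^ M / 2"
    unfolding split real_norm_def using head by linarith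
  moreover have "(1/3) ^ N \<le> (1/3::real) ^ M"
    using M(3) by (intro power_decreasing) auto
  ultimately show ?thesis
    unfolding diff by linarith
qed

text \<open>Reading off a countable base in ternary digits embeds the space into the line, with an inverse
  that is uniformly continuous over compact sets; this reduces weak compactness to Helly's theorem.\<close>

lemma ternary_encoding:
  fixes K :: "'a::{metric_space, second_countable_topology} set"
  assumes "compact K"
  obtains s :: "'a \<Rightarrow> real" where "s \<in> borel_measurable borel" "\<And>z. s z \<in> {0..2}" "inj_on s K"
    "uniformly_continuous_on (s ` K) (inv_into K s)"
proof -
  obtain B :: "'a set set" where B: "countable B" "topological_basis B"
    using ex_countable_basis by blast
  have ne: "B \<noteq> {}"
  proof
    assume "B = {}"
    moreover obtain B' where "B' \<subseteq> B" "\<Union>B' = (UNIV :: 'a set)"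
      using B(2) unfolding topological_basis_def by (metis open_UNIV)
    ultimately show False
      by auto
  qed
  define A where "A n = from_nat_into B n" for n
  have open_A: "open (A n)" for n
    using topological_basis_open[OF B(2) from_nat_into[OF ne]] by (simp add: A_def)
  define s where "s z = (\<Sum>n. indicat_real (A n) z * (1/3) ^ n)" for z
  have geo: "summable (\<lambda>n. (1/3::real) ^ n)" "(\<Sum>n. (1/3::real) ^ n) = 3 / 2"
    using suminf_geometric[of "1/3::real"] by (auto intro: summable_geometric)
  have sm: "summable (\<lambda>n. indicat_real (A n) z * (1/3) ^ n)" for z
    by (rule summable_comparison_test'[OF geo(1), of 0]) (auto simp: indicator_def)
  have meas: "s \<in> borel_measurable borel"
    unfolding s_def using open_A
    by (intro borel_measurable_suminf borel_measurable_times borel_measurable_indicator) auto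
  have range: "s z \<in> {0..2}" for z
  proof -
    have "s z \<le> (\<Sum>n. (1/3::real) ^ n)"
      unfolding s_def by (rule suminf_le[OF _ sm geo(1)]) (auto simp: indicator_def)
    moreover have "0 \<le> s z"
      unfolding s_def by (rule suminf_nonneg[OF sm]) auto
    ultimately show ?thesis
      using geo(2) by simp
  qed
  have key: "\<exists>d>0. \<forall>x\<in>K. \<forall>y\<in>K. \<bar>s x - s y\<bar> < d \<longrightarrow> dist x y < e" if "e > 0" for e
  proof -
    have "\<exists>n. x \<in> A n \<and> A n \<subseteq> ball x (e / 2)" for x
    proof -
      obtain b where "b \<in> B" "x \<in> b" "b \<subseteq> ball x (e / 2)"
        using topological_basisE[OF B(2) open_ball, of x x "e / 2"] \<open>e > 0\<close> by auto
      then show ?thesis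
        using from_nat_into_surj[OF B(1)] unfolding A_def by metis
    qed
    then obtain n where n: "\<And>x. x \<in> A (n x)" "\<And>x. A (n x) \<subseteq> ball x (e / 2)"
      by metis
    have "K \<subseteq> (\<Union>x\<in>K. A (n x))"
      using n(1) by blast
    then obtain C where C: "C \<subseteq> K" "finite C" "K \<subseteq> (\<Union>x\<in>C. A (n x))"
      using compactE_image[OF assms, of K "\<lambda>x. A (n x)"] open_A by blast
    \<comment> \<open>The digits up to \<open>N\<close> decide membership in every set of the finite
      subcover; agreement in those digits puts both points into one set of radius at most
      \<open>e / 2\<close>.\<close>
    define N where "N = Max (n ` C)"
    have "dist x y < e" if "x \<in> K" "y \<in> K" "\<bar>s x - s y\<bar> < (1/3) ^ N / 2" for x y
    proof -
      obtain c where c: "c \<in> C" "x \<in> A (n c)"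
        using C(3) \<open>x \<in> K\<close> by blast
      have "n c \<le> N"
        using C(2) c(1) by (simp add: N_def)
      then have "(1/3::real) ^ N \<le> (1/3) ^ n c"
        by (intro power_decreasing) auto
      moreover have "(1/3) ^ n c / 2 \<le> \<bar>s x - s y\<bar>" if "y \<notin> A (n c)"
        unfolding s_def
        by (rule ternary_separation) (use c(2) that in \<open>auto simp: indicator_def\<close>)
      ultimately have "y \<in> A (n c)"
        using that(3) by linarith
      then have "dist c x < e / 2" "dist c y < e / 2"
        using c n(2)[of c] by auto
      then show ?thesis
        using dist_triangle_half_r[of c x e y] by simp
    qed
    then show ?thesis
      by (intro exI[of _ "(1/3) ^ N / 2"]) auto
  qed
  have inj: "inj_on s K"
  proof (rule inj_onI, rule ccontr)
    fix x y assume xy: "x \<in> K" "y \<in> K" "s x = s y" "x \<noteq> y"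
    then obtain d where "d > 0" "\<forall>x'\<in>K. \<forall>y'\<in>K. \<bar>s x' - s y'\<bar> < d \<longrightarrow> dist x' y' < dist x y"
      using key[of "dist x y"] by auto
    then show False
      using xy by fastforce
  qed
  have "uniformly_continuous_on (s ` K) (inv_into K s)"
    unfolding uniformly_continuous_on_def
  proof safe
    fix e :: real assume "e > 0"
    then obtain d where d: "d > 0" "\<forall>x\<in>K. \<forall>y\<in>K. \<bar>s x - s y\<bar> < d \<longrightarrow> dist x y < e"
      using key by blast
    then show "\<exists>d>0. \<forall>x\<in>s ` K. \<forall>x'\<in>s ` K. dist x' x < d \<longrightarrow> dist (inv_into K s x') (inv_into K s x) < e"
      by (intro exI[of _ d]) (auto simp: inv_into_f_f[OF inj] dist_real_def)
  qed
  then show ?thesis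
    using that meas range inj by blast
qed

text \<open>The images of the measures under the encoding \<open>s\<close> live on a bounded
  interval, so they are tight and Helly's theorem gives a limit law on the line. The inverse of
  \<open>s\<close>, extended to the closure of the encoded compact set, carries this law
  back.\<close>

theorem weak_compactness_on_compact:
  fixes \<mu>s :: "nat \<Rightarrow> 'a::{complete_space, second_countable_topology} measure"
  assumes \<mu>s: "\<And>n. \<mu>s n \<in> borel_prob" and K: "compact K" "\<And>n. AE z in \<mu>s n. z \<in> K"
  obtains r :: "nat \<Rightarrow> nat" and \<mu> where "strict_mono r" "\<mu> \<in> borel_prob" "AE z in \<mu>. z \<in> K"
    "\<And>f :: 'a \<Rightarrow> real. continuous_on UNIV f \<Longrightarrow>
      (\<lambda>n. integral\<^sup>L (\<mu>s (r n)) f) \<longlonglongrightarrow> integral\<^sup>L \<mu> f"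
proof -
  obtain s :: "'a \<Rightarrow> real" where s: "s \<in> borel_measurable borel" "\<And>z. s z \<in> {0..2}" "inj_on s K"
    "uniformly_continuous_on (s ` K) (inv_into K s)"
    using ternary_encoding[OF K(1)] by blast
  have meas_s [measurable]: "s \<in> borel_measurable (\<mu>s n)" for n
    using s(1) borel_probD(2)[OF \<mu>s[of n]] by (simp cong: measurable_cong_sets)
  define \<nu>s where "\<nu>s n = distr (\<mu>s n) borel s" for n
  have rd: "real_distribution (\<nu>s n)" for n
    unfolding \<nu>s_def using borel_probD(1)[OF \<mu>s[of n]]
    by (intro prob_space.real_distribution_distr meas_s)
  \<comment> \<open>Tightness is stated with intervals open on the left, so the left end must lie
    below the possible value 0 of \<open>s\<close>.\<close>
  have "measure (\<nu>s n) {-1<..2} = 1" for n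
  proof -
    interpret prob_space "\<mu>s n"
      by (rule borel_probD(1)[OF \<mu>s])
    have "s -` {-1<..2} \<inter> space (\<mu>s n) = space (\<mu>s n)"
      using s(2) by (fastforce intro: less_le_trans[of "-1" "0::real"])
    then show ?thesis
      by (simp add: \<nu>s_def measure_distr prob_space)
  qed
  then have "tight \<nu>s"
    unfolding tight_def 
  proof (intro conjI allI impI)
    fix e :: real assume "e > 0"
    then show "\<exists>a b. a < b \<and> (\<forall>n. 1 - e < measure (\<nu>s n) {a<..b})"
      using \<open>\<And>n. measure (\<nu>s n) {-1<..2} = 1\<close>
      by - (rule exI[of _ "-1"], rule exI[of _ 2], auto)
  qed (rule rd)
  then obtain r \<nu> where r: "strict_mono (r :: nat \<Rightarrow> nat)" "real_distribution \<nu>" "weak_conv_m (\<nu>s \<circ> r) \<nu>"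
    using tight_imp_convergent_subsubsequence[of \<nu>s "\<lambda>n. n"] by (auto simp: strict_mono_def o_def)
  have conv: "(\<lambda>n. \<integral>z. h (s z) \<partial>\<mu>s (r n)) \<longlonglongrightarrow> integral\<^sup>L \<nu> h"
    if "continuous_on UNIV h" "\<And>t. \<bar>h t\<bar> \<le> B" for h :: "real \<Rightarrow> real" and B
  proof -
    have m: "h \<in> borel_measurable borel"
      using that(1) by (rule borel_measurable_continuous_onI)
    have "(\<lambda>n. integral\<^sup>L ((\<nu>s \<circ> r) n) h) \<longlonglongrightarrow> integral\<^sup>L \<nu> h"
      using that rd r by (intro weak_conv_imp_integral_bdd_continuous_conv[of _ _ _ B])
        (auto simp: continuous_on_eq_continuous_at o_def)
    moreover have "integral\<^sup>L ((\<nu>s \<circ> r) n) h = (\<integral>z. h (s z) \<partial>\<mu>s (r n))" for n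
      unfolding \<nu>s_def o_def using m by (intro integral_distr) auto
    ultimately show ?thesis
      by simp
  qed
  interpret \<nu>: real_distribution \<nu>
    by (rule r(2))
  have prob: "prob_space (\<mu>s n)" for n
    by (rule borel_probD(1)[OF \<mu>s])
  have Kne: "K \<noteq> {}"
    using K(2)[of 0] prob[of 0] by (auto simp: prob_space.AE_False)
  obtain z0 where z0: "z0 \<in> K"
    using Kne by blast
  \<comment> \<open>The encoding \<open>s\<close> is only measurable, so \<open>s\<close> applied to
    \<open>K\<close> need not be closed. The uniformly continuous inverse extends to the closure and
    still takes values in \<open>K\<close>.\<close>
  define C where "C = closure (s ` K)"
  have closed_C: "closed C" and Cne: "C \<noteq> {}"
    using Kne by (auto simp: C_def)
  obtain g where g: "uniformly_continuous_on C g" "\<And>t. t \<in> s ` K \<Longrightarrow> inv_into K s t = g t"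
    using uniformly_continuous_on_extension_on_closure[OF s(4)] unfolding C_def by metis
  have gs: "g (s z) = z" if "z \<in> K" for z
    using g(2)[of "s z"] that s(3) by simp
  have cont_g: "continuous_on C g"
    using g(1) by (rule uniformly_continuous_imp_continuous)
  have "g ` C \<subseteq> closure (g ` s ` K)"
    unfolding C_def using cont_g by (intro continuous_image_closure_subset) (auto simp: C_def)
  also have "g ` s ` K \<subseteq> K"
    using gs by auto
  then have "closure (g ` s ` K) \<subseteq> K"
    using compact_imp_closed[OF K(1)] by (simp add: closure_minimal)
  finally have gK: "g t \<in> K" if "t \<in> C" for t
    using that by blast
  \<comment> \<open>Outside \<open>C\<close>, which has full measure for the limit law, the value
    \<open>z0\<close> merely keeps the map total and inside \<open>K\<close>.\<close>
  define g' where "g' t = (if t \<in> C then g t else z0)" for t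
  have C_borel: "C \<in> sets borel"
    using closed_C by simp
  have g': "g' \<in> borel_measurable borel"
    unfolding g'_def using cont_g C_borel by (intro borel_measurable_continuous_on_if) auto
  have \<nu>C: "AE t in \<nu>. t \<in> C"
  proof -
    define h where "h t = min 1 (infdist t C)" for t
    have h: "continuous_on UNIV h" "\<bar>h t\<bar> \<le> 1" "0 \<le> h t" for t
      by (auto simp: h_def infdist_nonneg intro!: continuous_intros)
    have "(\<integral>z. h (s z) \<partial>\<mu>s (r n)) = 0" for n
    proof -
      have "AE z in \<mu>s (r n). h (s z) = 0"
        using K(2)[of "r n"]
      proof eventually_elim
        case (elim z)
        then have "s z \<in> C"
          unfolding C_def by (intro closure_subset[THEN subsetD]) auto
        then show ?case
          by (simp add: h_def)
      qed
      then show ?thesis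
        by (simp add: integral_eq_zero_AE)
    qed
    then have "integral\<^sup>L \<nu> h = 0"
      using conv[OF h(1,2)] by (simp add: LIMSEQ_const_iff)
    moreover have "integrable \<nu> h"
      using h borel_measurable_continuous_onI[OF h(1)]
      by (intro \<nu>.integrable_const_bound[of _ 1]) auto
    ultimately have "AE t in \<nu>. h t = 0"
      using integral_nonneg_eq_0_iff_AE[of \<nu> h] h(3) by auto
    then show ?thesis
      by eventually_elim
        (use closed_C Cne in \<open>auto simp: h_def min_def in_closed_iff_infdist_zero split: if_splits\<close>)
  qed
  define \<mu> where "\<mu> = distr \<nu> borel g'"
  have g'_meas [measurable]: "g' \<in> measurable \<nu> borel"
    using g' by (simp cong: measurable_cong_sets)
  have \<mu>: "\<mu> \<in> borel_prob"
    unfolding \<mu>_def borel_prob_def by (auto intro: \<nu>.prob_space_distr)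
  have "g' t \<in> K" for t
    using gK z0 by (auto simp: g'_def)
  then have \<mu>K: "AE z in \<mu>. z \<in> K"
    unfolding \<mu>_def using compact_imp_closed[OF K(1)] by (subst AE_distr_iff) auto
  have lim: "(\<lambda>n. integral\<^sup>L (\<mu>s (r n)) f) \<longlonglongrightarrow> integral\<^sup>L \<mu> f" if f: "continuous_on UNIV f" for f :: "'a \<Rightarrow> real"
  proof -
    have fm: "f \<in> borel_measurable borel"
      using f by (rule borel_measurable_continuous_onI)
    have "bounded (f ` K)"
      using K(1) f by (meson compact_continuous_image compact_imp_bounded continuous_on_subset subset_UNIV)
    then obtain b where b: "\<And>z. z \<in> K \<Longrightarrow> norm (f z) \<le> b"
      by (auto simp: bounded_iff)
    then have "0 \<le> b"
      using z0 norm_ge_zero order_trans by blast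
    have "continuous_on C (\<lambda>t. f (g t))"
      using continuous_on_compose2[OF f cont_g] by auto
    \<comment> \<open>A bounded continuous extension of \<open>f\<close> composed with
      \<open>g\<close> to the whole line is a legitimate test function for weak convergence, and on
      encoded points of \<open>K\<close> it returns the value of \<open>f\<close>.\<close>
    then obtain h where h: "continuous_on UNIV h" "\<And>t. t \<in> C \<Longrightarrow> h t = f (g t)" "\<And>t. norm (h t) \<le> b"
      using Tietze[of C "\<lambda>t. f (g t)" UNIV b] closed_C \<open>0 \<le> b\<close> b gK by auto
    have "(\<integral>z. h (s z) \<partial>\<mu>s (r n)) = integral\<^sup>L (\<mu>s (r n)) f" for n
    proof (rule integral_cong_AE)
      show "AE z in \<mu>s (r n). h (s z) = f z"
        using K(2)[of "r n"]
      proof eventually_elim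
        case (elim z)
        then have "s z \<in> C"
          unfolding C_def by (intro closure_subset[THEN subsetD]) auto
        then show ?case
          using h(2) gs elim by simp
      qed
      show "f \<in> borel_measurable (\<mu>s (r n))"
        using fm borel_probD(2)[OF \<mu>s[of "r n"]] by (simp cong: measurable_cong_sets)
    qed (use borel_measurable_continuous_onI[OF h(1)] in measurable)
    moreover have "integral\<^sup>L \<mu> f = integral\<^sup>L \<nu> h"
    proof -
      have "integral\<^sup>L \<mu> f = (\<integral>t. f (g' t) \<partial>\<nu>)"
        unfolding \<mu>_def using fm by (intro integral_distr) auto
      also have "\<dots> = integral\<^sup>L \<nu> h"
      proof (rule integral_cong_AE)
        show "AE t in \<nu>. f (g' t) = h t"
          using \<nu>C by eventually_elim (simp add: h(2) g'_def)
      qed (use fm borel_measurable_continuous_onI[OF h(1)] in auto)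
      finally show ?thesis .
    qed
    ultimately show ?thesis
      using conv[OF h(1), of b] h(3) by simp
  qed
  show ?thesis
    using that[OF r(1) \<mu> \<mu>K lim] .
qed

section \<open>Uniform compactness of functions on the torus\<close>

lemma Arzela_Ascoli_torus:
  fixes u :: "nat \<Rightarrow> 'd::finite torus \<Rightarrow> real"
  assumes bound: "\<And>n X. \<bar>u n X\<bar> \<le> M"
    and equicont: "\<And>e. e > 0 \<Longrightarrow> \<exists>d>0. \<forall>n X Y. dist X Y < d \<longrightarrow> \<bar>u n X - u n Y\<bar> < e"
  obtains r v where "strict_mono (r :: nat \<Rightarrow> nat)" "continuous_on UNIV v"
    "uniform_limit UNIV (\<lambda>n. u (r n)) v sequentially"
proof -
  let ?S = "cbox 0 (1 :: real ^ 'd)"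
  have "\<exists>d. 0 < d \<and> (\<forall>n y. y \<in> ?S \<and> norm (x - y) < d \<longrightarrow> norm (u n (tproj x) - u n (tproj y)) < e)"
    if "e > 0" for x :: "real ^ 'd" and e
  proof -
    obtain d where "d > 0" "\<forall>n X Y. dist X Y < d \<longrightarrow> \<bar>u n X - u n Y\<bar> < e"
      using equicont[OF \<open>e > 0\<close>] by blast
    then show ?thesis
      by (intro exI[of _ d]) (metis dist_norm dist_tproj_le le_less_trans real_norm_def)
  qed
  then obtain g and r :: "nat \<Rightarrow> nat" where gr: "strict_mono r"
    "\<And>e. 0 < e \<Longrightarrow> \<exists>N. \<forall>n x. n \<ge> N \<and> x \<in> ?S \<longrightarrow> norm (u (r n) (tproj x) - g x) < e"
    using Arzela_Ascoli[of ?S "\<lambda>n x. u n (tproj x)" M] bound by (metis compact_cbox real_norm_def)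
  obtain l where l: "\<And>X. l X \<in> ?S" "\<And>X. tproj (l X) = X"
    using torus_lift_cbox by metis
  \<comment> \<open>The choice \<open>l\<close> of lifts need not be continuous; continuity of
    \<open>v\<close> is recovered from uniform convergence.\<close>
  define v where "v X = g (l X)" for X
  have "\<exists>N. \<forall>n\<ge>N. \<forall>X\<in>UNIV. dist (u (r n) X) (v X) < e" if "e > 0" for e
    using gr(2)[OF that] l unfolding v_def dist_norm by metis
  then have lim: "uniform_limit UNIV (\<lambda>n. u (r n)) v sequentially"
    by (simp add: uniform_limit_sequentially_iff)
  have "continuous_on UNIV (u n)" for n
    unfolding continuous_on_iff dist_real_def using equicont by (metis dist_commute)
  then have "continuous_on UNIV v"
    using uniform_limit_theorem[OF _ lim] by simp
  then show ?thesis
    using that gr(1) lim by blast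
qed

section \<open>The discrete Lax-Oleinik equation\<close>

text \<open>Cost of arriving at \<open>X\<close> with final velocity \<open>v\<close>, starting from
  the value of \<open>u\<close> one step earlier. Minimizing over velocities rather than over
  previous points keeps the competitor space the same vector space at every torus point. The factor
  \<open>\<beta>\<close> is \<open>1 - \<tau> * lam\<close> in the discounted case and 1
  otherwise.\<close>

definition step :: "real \<Rightarrow> ('d::finite torus \<Rightarrow> real ^ 'd \<Rightarrow> real) \<Rightarrow> real \<Rightarrow> ('d torus \<Rightarrow> real) \<Rightarrow>
    'd torus \<Rightarrow> real ^ 'd \<Rightarrow> real" where
  "step \<tau> Lm \<beta> u X v = \<beta> * u (X - tproj (\<tau> *\<^sub>R v)) + \<tau> * Lm (X - tproj (\<tau> *\<^sub>R v)) v"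

text \<open>The Lax-Oleinik equation with the infimum replaced by an inequality and its attainment,
  the form in which it is used along chains. It covers the discounted equation
  (\<open>c = 0\<close>) and the undiscounted one (\<open>\<beta> = 1\<close>,
  \<open>c = \<tau> * k\<close>).\<close>

definition lax_eq :: "real \<Rightarrow> ('d::finite torus \<Rightarrow> real ^ 'd \<Rightarrow> real) \<Rightarrow> real \<Rightarrow> real \<Rightarrow>
    ('d torus \<Rightarrow> real) \<Rightarrow> bool" where
  "lax_eq \<tau> Lm \<beta> c u \<longleftrightarrow> continuous_on UNIV u \<and>
     (\<forall>X v. u X + c \<le> step \<tau> Lm \<beta> u X v) \<and> (\<forall>X. \<exists>v. u X + c = step \<tau> Lm \<beta> u X v)"

lemma lax_eqD:
  assumes "lax_eq \<tau> Lm \<beta> c u"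
  shows "continuous_on UNIV u" "u X + c \<le> step \<tau> Lm \<beta> u X v" "\<exists>v. u X + c = step \<tau> Lm \<beta> u X v"
  using assms by (auto simp: lax_eq_def)

lemma lax_eq_forward:
  assumes "lax_eq \<tau> Lm \<beta> c u"
  shows "u (X + tproj (\<tau> *\<^sub>R v)) + c \<le> \<beta> * u X + \<tau> * Lm X v"
  using lax_eqD(2)[OF assms, of "X + tproj (\<tau> *\<^sub>R v)" v] by (simp add: step_def)

text \<open>With \<open>a = k / lam\<close> and \<open>\<beta> = 1 - \<tau> * lam\<close> the new
  constant is \<open>\<tau> * k\<close>: subtracting the diverging part of a discounted solution
  produces an equation that has a limit as the discount vanishes.\<close>

lemma lax_eq_shift:
  assumes "lax_eq \<tau> Lm \<beta> c u"
  shows "lax_eq \<tau> Lm \<beta> (c + (1 - \<beta>) * a) (\<lambda>X. u X - a)"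
proof -
  have *: "step \<tau> Lm \<beta> (\<lambda>X. u X - a) X v = step \<tau> Lm \<beta> u X v - \<beta> * a" for X v
    by (simp add: step_def algebra_simps)
  have **: "u X - a + (c + (1 - \<beta>) * a) = u X + c - \<beta> * a" for X
    by (simp add: algebra_simps)
  show ?thesis
    using assms unfolding lax_eq_def * ** by (auto intro!: continuous_intros)
qed

lemma range_step:
  assumes "\<tau> \<noteq> 0"
  shows "range (\<lambda>x. \<beta> * u (tproj x) + action \<tau> Lm x y) = range (step \<tau> Lm \<beta> u (tproj y))"
proof (intro subset_antisym subsetI)
  fix t assume "t \<in> range (\<lambda>x. \<beta> * u (tproj x) + action \<tau> Lm x y)"
  then obtain x where "t = \<beta> * u (tproj x) + action \<tau> Lm x y"
    by blast
  then have "t = step \<tau> Lm \<beta> u (tproj y) ((y - x) /\<^sub>R \<tau>)"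
    using assms by (simp add: step_def action_def tproj_diff)
  then show "t \<in> range (step \<tau> Lm \<beta> u (tproj y))"
    by blast
next
  fix t assume "t \<in> range (step \<tau> Lm \<beta> u (tproj y))"
  then obtain v where "t = step \<tau> Lm \<beta> u (tproj y) v"
    by blast
  then have "t = \<beta> * u (tproj (y - \<tau> *\<^sub>R v)) + action \<tau> Lm (y - \<tau> *\<^sub>R v) y"
    using assms by (simp add: step_def action_def tproj_diff)
  then show "t \<in> range (\<lambda>x. \<beta> * u (tproj x) + action \<tau> Lm x y)"
    by blast
qed

lemma torus_bounded_range:
  fixes u :: "'d::finite torus \<Rightarrow> real"
  assumes "continuous_on UNIV u"
  obtains B where "\<And>X. \<bar>u X\<bar> \<le> B" "0 \<le> B"
proof -
  have "bounded (range u)"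
    by (intro compact_imp_bounded compact_continuous_image assms compact_torus)
  then obtain B where B: "\<And>X. \<bar>u X\<bar> \<le> B"
    by (auto simp: bounded_iff)
  moreover have "0 \<le> B"
    using B[of 0] by simp
  ultimately show ?thesis
    using that by blast
qed

section \<open>Splitting displacements into short steps\<close>

lemma torus_shift_iterate:
  fixes g :: "'d::finite torus \<Rightarrow> real"
  assumes "\<And>X. g (X + tproj k) \<le> g X + c"
  shows "g (X + tproj (real n *\<^sub>R k)) \<le> g X + real n * c"
proof (induction n)
  case (Suc n)
  have "X + tproj (real (Suc n) *\<^sub>R k) = X + tproj (real n *\<^sub>R k) + tproj k"
    by (simp add: tproj_add scaleR_add_left add.assoc add.commute)
  then have "g (X + tproj (real (Suc n) *\<^sub>R k)) \<le> g (X + tproj (real n *\<^sub>R k)) + c"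
    using assms by metis
  with Suc show ?case
    by (simp add: distrib_right)
qed simp

text \<open>Each piece is covered in one time step at velocity at most 1. Taking one piece more than
  the integer part of \<open>norm h / \<tau>\<close> keeps \<open>n\<close> positive even for
  \<open>h = 0\<close>, and costs at most one extra time step.\<close>

lemma subdivision:
  fixes h :: "'a::real_normed_vector"
  assumes "\<tau> > 0"
  obtains n and k :: 'a where "h = real n *\<^sub>R k" "norm k \<le> \<tau>" "real n * norm k = norm h" "real n * \<tau> \<le> norm h + \<tau>"
proof -
  define n where "n = Suc (nat \<lfloor>norm h / \<tau>\<rfloor>)"
  have "0 \<le> norm h / \<tau>"
    using assms by simp
  then have "real n = of_int \<lfloor>norm h / \<tau>\<rfloor> + 1"
    by (simp add: n_def)
  then have n: "norm h / \<tau> \<le> real n" "real n \<le> norm h / \<tau> + 1"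
    using real_of_int_floor_add_one_ge[of "norm h / \<tau>"] of_int_floor_le[of "norm h / \<tau>"] by simp_all
  have n0: "real n > 0"
    by (simp add: n_def)
  show ?thesis
  proof (rule that[of n "h /\<^sub>R real n"])
    show "norm (h /\<^sub>R real n) \<le> \<tau>"
      using n(1) n0 assms by (simp add: field_simps)
    show "real n * \<tau> \<le> norm h + \<tau>"
      using n(2) assms by (simp add: field_simps)
  qed (use n0 in simp_all)
qed

lemma lipschitz_subdivide:
  fixes g :: "'d::finite torus \<Rightarrow> real"
  assumes "\<tau> > 0" and loc: "\<And>X h. norm h \<le> \<tau> \<Longrightarrow> g (X + tproj h) \<le> g X + C * norm h"
  shows "g (X + tproj h) \<le> g X + C * norm h"
proof -
  obtain n k where k: "h = real n *\<^sub>R k" "norm k \<le> \<tau>" "real n * norm k = norm h"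
    using subdivision[OF assms(1)] by metis
  have "g (X + tproj h) \<le> g X + real n * (C * norm k)"
    unfolding k(1) by (rule torus_shift_iterate[where g = g, OF loc[OF k(2)]])
  also have "real n * (C * norm k) = C * norm h"
    unfolding k(3)[symmetric] by simp
  finally show ?thesis .
qed

lemma torus_lipschitzI:
  fixes g :: "'d::finite torus \<Rightarrow> real"
  assumes "\<And>X h. g (X + tproj h) \<le> g X + C * norm h"
  shows "\<bar>g X - g Y\<bar> \<le> C * dist X Y"
proof -
  have le: "g Y \<le> g X + C * dist X Y" for X Y
    using assms[of X] torus_shift_obtain[of Y X] by metis
  show ?thesis
    using le[of X Y] le[of Y X] by (auto simp: dist_commute)
qed

text \<open>The bounds are explicit functions of the velocity bound so that they can be shared by all the
  Lagrangians \<open>lag_at L F m\<close>.\<close>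

locale lagr =
  fixes Lm :: "'d::finite torus \<Rightarrow> real ^ 'd \<Rightarrow> real" and CL UL :: "real \<Rightarrow> real"
  assumes cont: "continuous_on UNIV (\<lambda>(X, v). Lm X v)"
    and super: "0 < K \<Longrightarrow> K * norm v + CL K \<le> Lm X v"
    and upper: "norm v \<le> r \<Longrightarrow> Lm X v \<le> UL r"
    and lip: "norm v \<le> r \<Longrightarrow> norm w \<le> r \<Longrightarrow> \<bar>Lm X v - Lm X w\<bar> \<le> UL r * norm (v - w)"
begin

lemma lower: "CL 1 \<le> Lm X v"
  using super[of 1 v X] norm_ge_zero[of v] by linarith

text \<open>A velocity that is no worse than standing still has running cost at most
  \<open>\<Omega> + UL 0\<close>, where \<open>\<Omega>\<close> bounds the gain in
  \<open>\<beta> * u\<close> per unit of time; superlinearity with slope 1 then bounds the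
  velocity.\<close>

lemma velocity_bound:
  assumes "\<tau> > 0" "step \<tau> Lm \<beta> u X v \<le> step \<tau> Lm \<beta> u X 0" "\<And>X Y. \<beta> * (u X - u Y) \<le> \<tau> * \<Omega>"
  shows "norm v \<le> \<Omega> + UL 0 - CL 1"
proof -
  let ?Z = "X - tproj (\<tau> *\<^sub>R v)"
  have "\<beta> * u ?Z + \<tau> * Lm ?Z v \<le> \<beta> * u X + \<tau> * Lm X 0"
    using assms(2) by (simp add: step_def)
  then have "\<tau> * Lm ?Z v \<le> \<tau> * (\<Omega> + Lm X 0)"
    using assms(3)[of X ?Z] by (simp add: algebra_simps)
  then have "Lm ?Z v \<le> \<Omega> + Lm X 0"
    using \<open>\<tau> > 0\<close> by simp
  moreover have "norm v + CL 1 \<le> Lm ?Z v"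
    using super[of 1 v ?Z] by simp
  moreover have "Lm X 0 \<le> UL 0"
    using upper[of 0 0 X] by simp
  ultimately show ?thesis
    by linarith
qed

lemma continuous_step:
  assumes "continuous_on UNIV u"
  shows "continuous_on UNIV (step \<tau> Lm \<beta> u X)"
proof -
  have t: "continuous_on UNIV (\<lambda>v :: real ^ 'd. X - tproj (\<tau> *\<^sub>R v))"
  proof -
    have "continuous_on UNIV (\<lambda>v :: real ^ 'd. tproj (x - \<tau> *\<^sub>R v))" for x
      by (intro continuous_on_compose2[OF continuous_tproj] continuous_intros) auto
    then show ?thesis
      using tproj_surj[of X] by (auto simp: tproj_diff)
  qed
  have "continuous_on UNIV (\<lambda>v. Lm (X - tproj (\<tau> *\<^sub>R v)) v)"
    using continuous_on_compose2[OF cont continuous_on_Pair[OF t continuous_on_id]] by simp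
  then show ?thesis
    unfolding step_def
    by (intro continuous_intros continuous_on_compose2[OF assms t]) auto
qed

text \<open>Any velocity longer than \<open>r\<close> loses against 0 by
  \<open>velocity_bound\<close>, applied with the trivial oscillation
  \<open>2 * \<beta> * B\<close>. The minimum over the compact ball is therefore global.\<close>

lemma step_attained:
  assumes "\<tau> > 0" "0 \<le> \<beta>" "continuous_on UNIV u"
  obtains v where "\<And>w. step \<tau> Lm \<beta> u X v \<le> step \<tau> Lm \<beta> u X w"
proof -
  obtain B where B: "\<And>X. \<bar>u X\<bar> \<le> B" "0 \<le> B"
    using torus_bounded_range[OF assms(3)] by blast
  define r where "r = 2 * \<beta> * B / \<tau> + UL 0 - CL 1"
  have osc: "\<beta> * (u X - u Y) \<le> \<tau> * (2 * \<beta> * B / \<tau>)" for X Y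
  proof -
    have "u X - u Y \<le> 2 * B"
      using B(1)[of X] B(1)[of Y] by linarith
    then have "\<beta> * (u X - u Y) \<le> \<beta> * (2 * B)"
      using assms(2) by (rule mult_left_mono)
    then show ?thesis
      using assms(1) by simp
  qed
  have r0: "0 \<le> r"
    using velocity_bound[where u = u and \<beta> = \<beta>, OF assms(1) order_refl osc] by (simp add: r_def)
  obtain v where v: "v \<in> cball 0 r" "\<And>w. w \<in> cball 0 r \<Longrightarrow> step \<tau> Lm \<beta> u X v \<le> step \<tau> Lm \<beta> u X w"
    using continuous_attains_inf[of "cball 0 r" "step \<tau> Lm \<beta> u X"] r0
      continuous_on_subset[OF continuous_step[OF assms(3)]] by auto
  have "step \<tau> Lm \<beta> u X v \<le> step \<tau> Lm \<beta> u X w" for w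
  proof (cases "w \<in> cball 0 r")
    case False
    then have "\<not> step \<tau> Lm \<beta> u X w \<le> step \<tau> Lm \<beta> u X 0"
      using velocity_bound[where X = X and v = w and u = u and \<beta> = \<beta>, OF assms(1) _ osc] by (auto simp: r_def)
    then show ?thesis
      using v(2)[of 0] r0 by simp
  qed (use v in auto)
  then show ?thesis
    using that by blast
qed

lemma lax_eq_INF:
  assumes "\<tau> > 0" "0 \<le> \<beta>"
  shows "lax_eq \<tau> Lm \<beta> c u \<longleftrightarrow> continuous_on UNIV u \<and>
    (\<forall>y. u (tproj y) + c = (INF x. \<beta> * u (tproj x) + action \<tau> Lm x y))"
proof (cases "continuous_on UNIV u")
  case True
  have "(\<forall>v. u X + c \<le> step \<tau> Lm \<beta> u X v) \<and> (\<exists>v. u X + c = step \<tau> Lm \<beta> u X v) \<longleftrightarrow>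
      u X + c = (INF v. step \<tau> Lm \<beta> u X v)" for X
  proof -
    obtain v where v: "\<And>w. step \<tau> Lm \<beta> u X v \<le> step \<tau> Lm \<beta> u X w"
      using step_attained[OF assms True] by blast
    have "(INF v. step \<tau> Lm \<beta> u X v) = step \<tau> Lm \<beta> u X v"
      by (rule cInf_eq_minimum) (use v in auto)
    then show ?thesis
      using v by (metis order_antisym)
  qed
  then have "lax_eq \<tau> Lm \<beta> c u \<longleftrightarrow> (\<forall>X. u X + c = (INF v. step \<tau> Lm \<beta> u X v))"
    using True by (auto simp: lax_eq_def)
  also have "\<dots> \<longleftrightarrow> (\<forall>y. u (tproj y) + c = (INF v. step \<tau> Lm \<beta> u (tproj y) v))"
    by (metis tproj_surj)
  finally show ?thesis
    using True range_step[of \<tau> \<beta> u Lm] assms(1) by simp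
qed (simp add: lax_eq_def)

lemma lax_oleinik_iff:
  assumes "\<tau> > 0"
  shows "lax_oleinik_solution \<tau> Lm k u \<longleftrightarrow> lax_eq \<tau> Lm 1 (\<tau> * k) u"
  using lax_eq_INF[OF assms, of 1] by (simp add: lax_oleinik_solution_def)

text \<open>Maximum principle: at a maximum point of \<open>u - w\<close> the near-optimal velocity
  of \<open>w\<close> is also tried for \<open>u\<close>. For \<open>\<beta> < 1\<close> the result
  orders the functions; for \<open>\<beta> = 1\<close> the left-hand side vanishes and the result
  orders the constants.\<close>

lemma comparison:
  assumes "\<tau> > 0" "0 \<le> \<beta>" and cu: "continuous_on UNIV u" and cw: "continuous_on UNIV w"
    and sub: "\<And>X v. u X + c \<le> step \<tau> Lm \<beta> u X v"
    and sup: "\<And>X. \<exists>v. step \<tau> Lm' \<beta> w X v \<le> w X + c'"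
    and le: "\<And>X v. Lm X v \<le> Lm' X v + e"
  obtains X0 where "\<And>X. u X - w X \<le> u X0 - w X0" "(1 - \<beta>) * (u X0 - w X0) \<le> c' - c + \<tau> * e"
proof -
  have "continuous_on UNIV (\<lambda>X. u X - w X)"
    by (intro continuous_intros cu cw)
  then obtain X0 where X0: "\<And>X. u X - w X \<le> u X0 - w X0"
    using continuous_attains_sup[OF compact_torus, of "\<lambda>X. u X - w X"] by auto
  obtain v where v: "step \<tau> Lm' \<beta> w X0 v \<le> w X0 + c'"
    using sup by blast
  let ?Z = "X0 - tproj (\<tau> *\<^sub>R v)"
  have "\<tau> * Lm ?Z v \<le> \<tau> * (Lm' ?Z v + e)"
    using le assms(1) by simp
  moreover have "\<beta> * (u ?Z - w ?Z) \<le> \<beta> * (u X0 - w X0)"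
    using X0 assms(2) by (intro mult_left_mono) auto
  ultimately have "(1 - \<beta>) * (u X0 - w X0) \<le> c' - c + \<tau> * e"
    using v sub[of X0 v] by (simp add: step_def algebra_simps)
  then show ?thesis
    using that X0 by blast
qed

lemma comparison_discounted:
  assumes "\<tau> > 0" "0 \<le> \<beta>" "\<beta> < 1" and cu: "continuous_on UNIV u" and cw: "continuous_on UNIV w"
    and sub: "\<And>X v. u X + c \<le> step \<tau> Lm \<beta> u X v"
    and sup: "\<And>X. \<exists>v. step \<tau> Lm \<beta> w X v \<le> w X + c"
  shows "u X \<le> w X"
proof -
  obtain X0 where X0: "\<And>X. u X - w X \<le> u X0 - w X0" "(1 - \<beta>) * (u X0 - w X0) \<le> c - c + \<tau> * 0"
    using comparison[OF assms(1,2) cu cw sub sup, of 0] by auto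
  then have "u X0 - w X0 \<le> 0"
    using assms(3) by (simp add: mult_le_0_iff)
  then show ?thesis
    using X0(1)[of X] by linarith
qed

lemma lax_eq_unique:
  assumes "\<tau> > 0" "0 \<le> \<beta>" "\<beta> < 1" "lax_eq \<tau> Lm \<beta> c u" "lax_eq \<tau> Lm \<beta> c w"
  shows "u = w"
proof -
  have "u X \<le> w X" if "lax_eq \<tau> Lm \<beta> c u" "lax_eq \<tau> Lm \<beta> c w" for u w X
    using comparison_discounted[OF assms(1-3) lax_eqD(1)[OF that(1)] lax_eqD(1)[OF that(2)]
        lax_eqD(2)[OF that(1)]] lax_eqD(3)[OF that(2)] by (metis order_refl)
  then show ?thesis
    using assms(4,5) by (blast intro: ext order_antisym)
qed

lemma constant_le:
  assumes "\<tau> > 0" "lax_eq \<tau> Lm 1 (\<tau> * k) u" "lax_eq \<tau> Lm' 1 (\<tau> * k') w" "\<And>X v. Lm X v \<le> Lm' X v + e"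
  shows "k \<le> k' + e"
proof -
  have sup: "\<exists>v. step \<tau> Lm' 1 w X v \<le> w X + \<tau> * k'" for X
    using lax_eqD(3)[OF assms(3), of X] by (metis order_refl)
  obtain X0 where "(1 - 1) * (u X0 - w X0) \<le> \<tau> * k' - \<tau> * k + \<tau> * e"
    using comparison[OF assms(1) zero_le_one lax_eqD(1)[OF assms(2)] lax_eqD(1)[OF assms(3)]
        lax_eqD(2)[OF assms(2)] sup assms(4)] by blast
  then have "\<tau> * k \<le> \<tau> * (k' + e)"
    by (simp add: algebra_simps)
  then show ?thesis
    using assms(1) by simp
qed

text \<open>To reach \<open>X + tproj h\<close> the previous point is kept and only the last
  velocity is changed by \<open>h /\<^sub>R \<tau>\<close>, so regularity in the velocity gives
  regularity of the value. Displacements up to \<open>\<tau>\<close> change the velocity by at most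
  1, whence \<open>R + 1\<close>; longer ones are subdivided. Keeping \<open>g\<close> apart from
  \<open>u\<close> covers the Lax-Oleinik operator as well as its fixed points.\<close>

lemma value_lipschitz_gen:
  assumes "\<tau> > 0" and g: "\<And>X v. g X \<le> step \<tau> Lm \<beta> u X v" "\<And>X. \<exists>v. g X = step \<tau> Lm \<beta> u X v"
    and vel: "\<And>X v. g X = step \<tau> Lm \<beta> u X v \<Longrightarrow> norm v \<le> R"
  shows "\<bar>g X - g Y\<bar> \<le> UL (R + 1) * dist X Y"
proof (rule torus_lipschitzI, rule lipschitz_subdivide[OF assms(1)])
  fix X h assume h: "norm (h :: real ^ 'd) \<le> \<tau>"
  obtain v where v: "g X = step \<tau> Lm \<beta> u X v"
    using g(2) by blast
  have vR: "norm v \<le> R"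
    using vel[OF v] .
  define w where "w = v + h /\<^sub>R \<tau>"
  have "norm (h /\<^sub>R \<tau>) \<le> 1"
    using h assms(1) by (simp add: field_simps)
  then have wR: "norm w \<le> R + 1"
    using vR norm_triangle_ineq[of v "h /\<^sub>R \<tau>"] by (simp add: w_def)
  have Z: "X + tproj h - tproj (\<tau> *\<^sub>R w) = X - tproj (\<tau> *\<^sub>R v)"
    using assms(1) by (simp add: w_def scaleR_add_right tproj_add)
  have "g (X + tproj h) \<le> step \<tau> Lm \<beta> u (X + tproj h) w"
    by (rule g)
  also have "\<dots> = step \<tau> Lm \<beta> u X v + \<tau> * (Lm (X - tproj (\<tau> *\<^sub>R v)) w - Lm (X - tproj (\<tau> *\<^sub>R v)) v)"
    by (simp add: step_def Z algebra_simps)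
  also have "Lm (X - tproj (\<tau> *\<^sub>R v)) w - Lm (X - tproj (\<tau> *\<^sub>R v)) v \<le> UL (R + 1) * norm (w - v)"
    using lip[of w "R + 1" v "X - tproj (\<tau> *\<^sub>R v)"] vR wR by simp
  also have "norm (w - v) = norm h / \<tau>"
    using assms(1) by (simp add: w_def divide_inverse_commute)
  finally show "g (X + tproj h) \<le> g X + UL (R + 1) * norm h"
    using assms(1) v by simp
qed

lemma value_lipschitz:
  assumes "\<tau> > 0" and g: "lax_eq \<tau> Lm \<beta> c g"
    and vel: "\<And>X v. g X + c = step \<tau> Lm \<beta> g X v \<Longrightarrow> norm v \<le> R"
  shows "\<bar>g X - g Y\<bar> \<le> UL (R + 1) * dist X Y"
proof -
  have "\<bar>(g X + c) - (g Y + c)\<bar> \<le> UL (R + 1) * dist X Y"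
    by (rule value_lipschitz_gen[OF assms(1) lax_eqD(2,3)[OF g] vel])
  then show ?thesis
    by simp
qed

end

section \<open>Estimates and existence at a fixed time step\<close>

abbreviation torus_diam :: "'d::finite itself \<Rightarrow> real" where
  "torus_diam _ \<equiv> diameter (UNIV :: 'd torus set)"

lemma torus_shift_bounded:
  fixes X Y :: "'d::finite torus"
  obtains h where "Y = X + tproj h" "norm h \<le> torus_diam TYPE('d)"
proof -
  obtain h where h: "Y = X + tproj h" "norm h = dist X Y"
    using torus_shift_obtain by blast
  have "dist X Y \<le> torus_diam TYPE('d)"
    by (rule diameter_bounded_bound) (auto intro: compact_imp_bounded compact_torus)
  then show ?thesis
    using h that by simp
qed

context lagr
begin

lemma CL_le_UL: "CL 1 \<le> UL 0" "0 \<le> r \<Longrightarrow> CL 1 \<le> UL r"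
  using lower[of 0 0] upper[of 0 0 0] upper[of 0 r 0] by auto

text \<open>Any two points are joined in a single step of velocity at most the diameter divided by
  \<open>\<tau>\<close>. The bound is meant for fixed \<open>\<tau>\<close> only.\<close>

definition osc_bound :: "real \<Rightarrow> real" where
  "osc_bound \<tau> = UL (torus_diam TYPE('d) / \<tau>) - CL 1"

text \<open>The value at \<open>X\<close> is at most the cost of one step from a minimum point of
  \<open>u\<close>; the value at \<open>Y\<close> is at least the same minimum plus the least
  possible cost of a step.\<close>

lemma lax_eq_osc:
  assumes "\<tau> > 0" "0 \<le> \<beta>" "lax_eq \<tau> Lm \<beta> c u"
  shows "u X - u Y \<le> \<tau> * osc_bound \<tau>"
proof -
  obtain X0 where X0: "\<And>Z. u X0 \<le> u Z"
    using continuous_attains_inf[OF compact_torus _ lax_eqD(1)[OF assms(3)]] by auto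
  obtain h where h: "X = X0 + tproj h" "norm h \<le> torus_diam TYPE('d)"
    by (meson torus_shift_bounded)
  have "norm (h /\<^sub>R \<tau>) \<le> torus_diam TYPE('d) / \<tau>"
    using h(2) assms(1) by (simp add: divide_right_mono divide_inverse_commute[symmetric])
  then have "Lm X0 (h /\<^sub>R \<tau>) \<le> UL (torus_diam TYPE('d) / \<tau>)"
    by (rule upper)
  then have 1: "\<tau> * Lm X0 (h /\<^sub>R \<tau>) \<le> \<tau> * UL (torus_diam TYPE('d) / \<tau>)"
    using assms(1) by simp
  have 2: "u X + c \<le> \<beta> * u X0 + \<tau> * Lm X0 (h /\<^sub>R \<tau>)"
    using lax_eqD(2)[OF assms(3), of X "h /\<^sub>R \<tau>"] assms(1) h(1) by (simp add: step_def)
  obtain v where v: "u Y + c = step \<tau> Lm \<beta> u Y v"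
    using lax_eqD(3)[OF assms(3)] by blast
  have 3: "\<tau> * CL 1 \<le> \<tau> * Lm (Y - tproj (\<tau> *\<^sub>R v)) v"
    using assms(1) lower by simp
  have 4: "\<beta> * u X0 \<le> \<beta> * u (Y - tproj (\<tau> *\<^sub>R v))"
    using X0 assms(2) by (rule mult_left_mono)
  show ?thesis
    using 1 2 3 4 v by (simp add: step_def osc_bound_def algebra_simps)
qed

lemma lax_eq_velocity:
  assumes "\<tau> > 0" "0 \<le> \<beta>" "\<beta> \<le> 1" "lax_eq \<tau> Lm \<beta> c u" "u X + c = step \<tau> Lm \<beta> u X v"
  shows "norm v \<le> osc_bound \<tau> + UL 0 - CL 1"
proof (rule velocity_bound[OF assms(1)])
  show "step \<tau> Lm \<beta> u X v \<le> step \<tau> Lm \<beta> u X 0"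
    using lax_eqD(2)[OF assms(4), of X 0] assms(5) by simp
  fix X Y
  have *: "u X - u Y \<le> \<tau> * osc_bound \<tau>" "0 \<le> \<tau> * osc_bound \<tau>"
    using lax_eq_osc[OF assms(1,2,4), of X Y] lax_eq_osc[OF assms(1,2,4), of X X] by auto
  show "\<beta> * (u X - u Y) \<le> \<tau> * osc_bound \<tau>"
  proof (cases "u X - u Y \<ge> 0")
    case True
    then show ?thesis
      using * assms(2,3) mult_left_le_one_le[of "u X - u Y" \<beta>] by linarith
  next
    case False
    then show ?thesis
      using *(2) assms(2) mult_nonneg_nonpos[of \<beta> "u X - u Y"] by linarith
  qed
qed

lemma lax_eq_lipschitz:
  assumes "\<tau> > 0" "0 \<le> \<beta>" "\<beta> \<le> 1" "lax_eq \<tau> Lm \<beta> c u"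
  shows "\<bar>u X - u Y\<bar> \<le> UL (osc_bound \<tau> + UL 0 - CL 1 + 1) * dist X Y"
  by (rule value_lipschitz[OF assms(1,4) lax_eq_velocity[OF assms]])

text \<open>The upper bound comes from standing still, the lower one from the equation at a minimum
  point of \<open>u\<close>.\<close>

lemma discounted_bounds:
  assumes "\<tau> > 0" "\<tau> * lam \<le> 1" "lam > 0" "lax_eq \<tau> Lm (1 - \<tau> * lam) 0 u"
  shows "CL 1 \<le> lam * u X" "lam * u X \<le> UL 0"
proof -
  have "u X \<le> (1 - \<tau> * lam) * u X + \<tau> * Lm X 0"
    using lax_eqD(2)[OF assms(4), of X 0] by (simp add: step_def)
  then have "\<tau> * (lam * u X) \<le> \<tau> * Lm X 0"
    by (simp add: algebra_simps)
  then show "lam * u X \<le> UL 0"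
    using upper[of 0 0 X] assms(1) by simp
  obtain X0 where X0: "\<And>Z. u X0 \<le> u Z"
    using continuous_attains_inf[OF compact_torus _ lax_eqD(1)[OF assms(4)]] by auto
  obtain v where v: "u X0 + 0 = step \<tau> Lm (1 - \<tau> * lam) u X0 v"
    using lax_eqD(3)[OF assms(4)] by blast
  have "(1 - \<tau> * lam) * u X0 \<le> (1 - \<tau> * lam) * u (X0 - tproj (\<tau> *\<^sub>R v))"
    using X0 assms(2) by (intro mult_left_mono) auto
  moreover have "\<tau> * CL 1 \<le> \<tau> * Lm (X0 - tproj (\<tau> *\<^sub>R v)) v"
    using assms(1) lower by simp
  ultimately have "\<tau> * CL 1 \<le> \<tau> * (lam * u X0)"
    using v by (simp add: step_def algebra_simps)
  then have "CL 1 \<le> lam * u X0"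
    using assms(1) by simp
  also have "\<dots> \<le> lam * u X"
    using X0 assms(3) by simp
  finally show "CL 1 \<le> lam * u X" .
qed

text \<open>The Lax-Oleinik operator preserves order up to an added constant, which it multiplies by
  \<open>\<beta>\<close>; it is thus a contraction in the supremum norm. Its values are Lipschitz by
  \<open>value_lipschitz_gen\<close>, so it acts on continuous functions and Banach's theorem
  applies.\<close>

lemma lax_eq_exists_discounted:
  assumes "\<tau> > 0" "0 \<le> \<beta>" "\<beta> < 1"
  shows "\<exists>u. lax_eq \<tau> Lm \<beta> 0 u"
proof -
  define T where "T u X = (INF v. step \<tau> Lm \<beta> u X v)" for u X
  have T_le: "T u X \<le> step \<tau> Lm \<beta> u X v" and T_eq: "\<exists>v. T u X = step \<tau> Lm \<beta> u X v"
    if u: "continuous_on UNIV u" for u X v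
  proof -
    obtain w where w: "\<And>v. step \<tau> Lm \<beta> u X w \<le> step \<tau> Lm \<beta> u X v"
      using step_attained[OF assms(1,2) u] by blast
    have "T u X = step \<tau> Lm \<beta> u X w"
      unfolding T_def by (rule cInf_eq_minimum) (use w in auto)
    then show "T u X \<le> step \<tau> Lm \<beta> u X v" "\<exists>v. T u X = step \<tau> Lm \<beta> u X v"
      using w by auto
  qed
  have T_cont: "continuous_on UNIV (T u)" if u: "continuous_on UNIV u" for u
  proof -
    obtain B where B: "\<And>X. \<bar>u X\<bar> \<le> B" "0 \<le> B"
      using torus_bounded_range[OF u] by blast
    have osc: "\<beta> * (u X - u Y) \<le> \<tau> * (2 * \<beta> * B / \<tau>)" for X Y
    proof -
      have "u X - u Y \<le> 2 * B"
        using B(1)[of X] B(1)[of Y] by linarith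
      then have "\<beta> * (u X - u Y) \<le> \<beta> * (2 * B)"
        using assms(2) by (rule mult_left_mono)
      then show ?thesis
        using assms(1) by simp
    qed
    define R where "R = 2 * \<beta> * B / \<tau> + UL 0 - CL 1"
    have "\<bar>T u X - T u Y\<bar> \<le> UL (R + 1) * dist X Y" for X Y
    proof (rule value_lipschitz_gen[OF assms(1) T_le[OF u] T_eq[OF u]])
      fix X v assume "T u X = step \<tau> Lm \<beta> u X v"
      then have "step \<tau> Lm \<beta> u X v \<le> step \<tau> Lm \<beta> u X 0"
        using T_le[OF u, of X 0] by simp
      then show "norm v \<le> R"
        unfolding R_def by (rule velocity_bound[where u = u and \<beta> = \<beta>, OF assms(1) _ osc])
    qed
    then have "\<bar>UL (R + 1)\<bar>-lipschitz_on UNIV (T u)"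
      by (intro lipschitz_onI)
        (auto simp: dist_real_def intro!: order_trans[OF _ mult_right_mono[OF abs_ge_self]])
    then show ?thesis
      by (rule lipschitz_on_continuous_on)
  qed
  have T_contr: "T u X \<le> T w X + \<beta> * e"
    if *: "continuous_on UNIV u" "continuous_on UNIV w" "\<And>X. u X \<le> w X + e" for u w X e
  proof -
    obtain v where v: "T w X = step \<tau> Lm \<beta> w X v"
      using T_eq[OF *(2)] by blast
    have "T u X \<le> step \<tau> Lm \<beta> u X v"
      by (rule T_le[OF that(1)])
    also have "\<dots> \<le> step \<tau> Lm \<beta> w X v + \<beta> * e"
      using mult_left_mono[OF that(3)[of "X - tproj (\<tau> *\<^sub>R v)"] assms(2)]
      by (simp add: step_def algebra_simps)
    finally show ?thesis
      using v by simp
  qed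
  define S :: "('d torus \<Rightarrow>\<^sub>C real) \<Rightarrow> ('d torus \<Rightarrow>\<^sub>C real)" where
    "S f = Bcontfun (T (apply_bcontfun f))" for f
  have S: "apply_bcontfun (S f) = T (apply_bcontfun f)" for f
  proof -
    have c: "continuous_on UNIV (T (apply_bcontfun f))"
      by (rule T_cont) (simp add: continuous_on_apply_bcontfun)
    then have "T (apply_bcontfun f) \<in> bcontfun"
      unfolding bcontfun_def
      using compact_continuous_image[OF c compact_torus] compact_imp_bounded by auto
    then show ?thesis
      by (simp add: S_def Bcontfun_inverse)
  qed
  have "dist (S f) (S g) \<le> \<beta> * dist f g" for f g
  proof (rule dist_bound)
    fix X
    have cf: "continuous_on UNIV (apply_bcontfun f)" "continuous_on UNIV (apply_bcontfun g)"
      by (simp_all add: continuous_on_apply_bcontfun)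
    have le: "\<bar>apply_bcontfun f Y - apply_bcontfun g Y\<bar> \<le> dist f g" for Y
      using dist_bounded[of f Y g] by (simp add: dist_real_def)
    have "apply_bcontfun f Y \<le> apply_bcontfun g Y + dist f g" for Y
      using le[of Y] by linarith
    then have 1: "T (apply_bcontfun f) X \<le> T (apply_bcontfun g) X + \<beta> * dist f g"
      by (rule T_contr[OF cf])
    have "apply_bcontfun g Y \<le> apply_bcontfun f Y + dist f g" for Y
      using le[of Y] by linarith
    then have 2: "T (apply_bcontfun g) X \<le> T (apply_bcontfun f) X + \<beta> * dist f g"
      by (rule T_contr[OF cf(2,1)])
    show "dist (apply_bcontfun (S f) X) (apply_bcontfun (S g) X) \<le> \<beta> * dist f g"
      unfolding S dist_real_def using 1 2 by linarith
  qed
  then have "\<forall>f g. dist (S f) (S g) \<le> \<beta> * dist f g"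
    by simp
  from ex1_implies_ex[OF banach_fix_type[OF assms(2,3) this]] obtain f where "S f = f" ..
  then have f: "T (apply_bcontfun f) = apply_bcontfun f"
    using S[of f] by simp
  have "continuous_on UNIV (apply_bcontfun f)"
    by (simp add: continuous_on_apply_bcontfun)
  then have "lax_eq \<tau> Lm \<beta> 0 (apply_bcontfun f)"
    using T_le[of "apply_bcontfun f"] T_eq[of "apply_bcontfun f"] by (simp add: lax_eq_def f)
  then show ?thesis
    by blast
qed

lemma discounted_solution_iff:
  assumes "\<tau> > 0" "lam > 0" "\<tau> * lam \<le> 1"
  shows "lax_eq \<tau> Lm (1 - \<tau> * lam) 0 u \<longleftrightarrow> u = discounted_solution \<tau> lam Lm"
proof -
  have \<beta>: "0 \<le> 1 - \<tau> * lam" "1 - \<tau> * lam < 1"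
    using assms by auto
  have "\<exists>!u. lax_eq \<tau> Lm (1 - \<tau> * lam) 0 u"
    using lax_eq_exists_discounted[OF assms(1) \<beta>] lax_eq_unique[OF assms(1) \<beta>] by blast
  moreover have "discounted_solution \<tau> lam Lm = (THE u. lax_eq \<tau> Lm (1 - \<tau> * lam) 0 u)"
    unfolding discounted_solution_def lax_eq_INF[OF assms(1) \<beta>(1)] by simp
  ultimately show ?thesis
    by (metis the_equality)
qed

end

text \<open>Stability. The inequality passes to the limit pointwise. For attainment the optimal
  velocities of the approximations need not converge: they compete with a minimizer \<open>w\<close>
  of the limiting step, and the convergence of the Lagrangians is uniform over all
  velocities.\<close>

lemma lax_eq_limit:
  fixes Lm :: "'d::finite torus \<Rightarrow> real ^ 'd \<Rightarrow> real"
  assumes "lagr Lm CL UL" "\<tau> > 0" "0 \<le> \<beta>"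
    and eq: "\<And>n. lax_eq \<tau> (Ls n) (\<beta>s n) (cs n) (us n)"
    and lims: "\<beta>s \<longlonglongrightarrow> \<beta>" "cs \<longlonglongrightarrow> c" "uniform_limit UNIV us u sequentially"
    and Ls: "\<And>e. e > 0 \<Longrightarrow> \<forall>\<^sub>F n in sequentially. \<forall>X v. \<bar>Ls n X v - Lm X v\<bar> \<le> e"
  shows "lax_eq \<tau> Lm \<beta> c u"
proof -
  interpret lagr Lm CL UL
    by fact
  have cu: "continuous_on UNIV u"
    using uniform_limit_theorem[OF _ lims(3)] lax_eqD(1)[OF eq] by simp
  have us: "(\<lambda>n. us n X) \<longlonglongrightarrow> u X" for X
    using lims(3) by (rule tendsto_uniform_limitI) simp
  have Ls_lim: "(\<lambda>n. Ls n X v) \<longlonglongrightarrow> Lm X v" for X v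
  proof (rule tendstoI)
    fix e :: real assume "e > 0"
    then show "\<forall>\<^sub>F n in sequentially. dist (Ls n X v) (Lm X v) < e"
      using Ls[of "e / 2"] by (auto elim!: eventually_mono simp: dist_real_def dest!: spec[of _ X] spec[of _ v])
  qed
  have le: "u X + c \<le> step \<tau> Lm \<beta> u X v" for X v
  proof (rule LIMSEQ_le)
    show "(\<lambda>n. us n X + cs n) \<longlonglongrightarrow> u X + c"
      by (intro tendsto_intros us lims)
    show "(\<lambda>n. step \<tau> (Ls n) (\<beta>s n) (us n) X v) \<longlonglongrightarrow> step \<tau> Lm \<beta> u X v"
      unfolding step_def by (intro tendsto_intros us lims Ls_lim)
  qed (use lax_eqD(2)[OF eq] in auto)
  have "\<exists>v. u X + c = step \<tau> Lm \<beta> u X v" for X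
  proof -
    obtain w where w: "\<And>v. step \<tau> Lm \<beta> u X w \<le> step \<tau> Lm \<beta> u X v"
      using step_attained[OF assms(2,3) cu] by blast
    have "step \<tau> Lm \<beta> u X w \<le> u X + c"
    proof (rule field_le_epsilon)
      fix e :: real assume "e > 0"
      obtain B where B: "\<And>X. \<bar>u X\<bar> \<le> B" "0 \<le> B"
        using torus_bounded_range[OF cu] by blast
      \<comment> \<open>The Lagrangians contribute an error \<open>\<tau> * d\<close> and the
        discounted values an error \<open>d\<close>; the choice keeps their sum below
        \<open>e\<close>.\<close>
      define d where "d = e / (\<tau> + 2)"
      have d: "d > 0" "\<tau> * d + 2 * d = e"
        using \<open>e > 0\<close> assms(2)
        by (simp_all add: d_def add_divide_distrib[symmetric] distrib_right[symmetric])
      have "uniform_limit UNIV (\<lambda>n X. \<beta>s n * us n X) (\<lambda>X. \<beta> * u X) sequentially"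
        using B by (intro uniform_lim_mult lims(3))
          (auto intro!: uniform_limitI simp: bounded_iff tendsto_iff[THEN iffD1, OF lims(1), rule_format])
      then have ev: "\<forall>\<^sub>F n in sequentially. \<forall>X\<in>UNIV. dist (\<beta>s n * us n X) (\<beta> * u X) < d"
        using d(1) by (rule uniform_limitD)
      have "\<forall>\<^sub>F n in sequentially. step \<tau> Lm \<beta> u X w - (\<tau> * d + d) \<le> us n X + cs n"
        using ev Ls[OF d(1)]
      proof eventually_elim
        case (elim n)
        obtain v where v: "us n X + cs n = step \<tau> (Ls n) (\<beta>s n) (us n) X v"
          using lax_eqD(3)[OF eq] by blast
        let ?Z = "X - tproj (\<tau> *\<^sub>R v)"
        have "\<beta> * u ?Z - d \<le> \<beta>s n * us n ?Z"
          using elim(1) by (auto simp: dist_real_def abs_less_iff less_imp_le dest!: spec[of _ ?Z])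
        moreover have "\<tau> * (Lm ?Z v - d) \<le> \<tau> * Ls n ?Z v"
          using elim(2)[rule_format, of ?Z v] assms(2) by (intro mult_left_mono) auto
        ultimately show ?case
          using v w[of v] by (simp add: step_def algebra_simps)
      qed
      then have "step \<tau> Lm \<beta> u X w - (\<tau> * d + d) \<le> u X + c"
        using LIMSEQ_le_const[OF tendsto_add[OF us lims(2)]] by (auto simp: eventually_sequentially)
      then show "step \<tau> Lm \<beta> u X w \<le> u X + c + e"
        using d by linarith
    qed
    then show ?thesis
      using le[of X w] by (intro exI[of _ w]) simp
  qed
  then show ?thesis
    using cu le by (simp add: lax_eq_def)
qed

section \<open>The undiscounted equation and its constant\<close>

context lagr
begin

text \<open>Vanishing discount for a single Lagrangian: discounted solutions normalized at 0 are
  equibounded and equi-Lipschitz, while \<open>lam n * us n 0\<close> stays bounded and its limit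
  along a subsequence is the constant. The discounts are chosen so that
  \<open>\<tau> * lam n\<close> equals \<open>1 / (n + 1)\<close>.\<close>

lemma lax_eq_exists_undiscounted:
  assumes "\<tau> > 0"
  shows "\<exists>k u. lax_eq \<tau> Lm 1 (\<tau> * k) u"
proof -
  define lam where "lam n = 1 / (\<tau> * (real n + 1))" for n
  have tl: "\<tau> * lam n = inverse (real (Suc n))" for n
    using assms by (simp add: lam_def inverse_eq_divide add.commute)
  have lam: "lam n > 0" "\<tau> * lam n \<le> 1" for n
    using assms tl[of n] by (simp_all add: lam_def inverse_le_1_iff add_pos_nonneg)
  have \<beta>: "0 \<le> 1 - \<tau> * lam n" "1 - \<tau> * lam n < 1" "1 - \<tau> * lam n \<le> 1" for n
    using lam assms by (auto intro: less_imp_le)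
  obtain us where us: "\<And>n. lax_eq \<tau> Lm (1 - \<tau> * lam n) 0 (us n)"
    using lax_eq_exists_discounted[OF assms \<beta>(1,2)] by metis
  define ws where "ws n X = us n X - us n 0" for n X
  have ws: "lax_eq \<tau> Lm (1 - \<tau> * lam n) (\<tau> * (lam n * us n 0)) (ws n)" for n
    using lax_eq_shift[OF us[of n], of "us n 0"] by (simp add: ws_def[abs_def] mult.assoc)
  have wb: "\<bar>ws n X\<bar> \<le> \<tau> * osc_bound \<tau>" for n X
    using lax_eq_osc[OF assms \<beta>(1) us, of n X 0] lax_eq_osc[OF assms \<beta>(1) us, of n 0 X]
    by (simp add: ws_def abs_le_iff)
  define C where "C = \<bar>UL (osc_bound \<tau> + UL 0 - CL 1 + 1)\<bar> + 1"
  have wl: "\<bar>ws n X - ws n Y\<bar> \<le> C * dist X Y" for n X Y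
  proof -
    have "\<bar>ws n X - ws n Y\<bar> \<le> UL (osc_bound \<tau> + UL 0 - CL 1 + 1) * dist X Y"
      by (rule lax_eq_lipschitz[OF assms \<beta>(1,3) ws])
    also have "\<dots> \<le> C * dist X Y"
      by (intro mult_right_mono) (auto simp: C_def)
    finally show ?thesis .
  qed
  have eqc: "\<exists>d>0. \<forall>n X Y. dist X Y < d \<longrightarrow> \<bar>ws n X - ws n Y\<bar> < e" if "e > 0" for e
    using that wl by (intro exI[of _ "e / C"]) (auto simp: C_def field_simps intro: le_less_trans)
  obtain r v where r: "strict_mono (r :: nat \<Rightarrow> nat)" "continuous_on UNIV v"
    "uniform_limit UNIV (\<lambda>n. ws (r n)) v sequentially"
    using Arzela_Ascoli_torus[OF wb eqc] by metis
  define a where "a n = lam (r n) * us (r n) 0" for n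
  have "\<bar>a n\<bar> \<le> max \<bar>CL 1\<bar> \<bar>UL 0\<bar>" for n
    using discounted_bounds[OF assms lam(2,1) us[of "r n"], of 0] by (simp add: a_def)
  then have "bounded (range a)"
    by (auto simp: bounded_iff)
  then obtain k s where s: "strict_mono (s :: nat \<Rightarrow> nat)" "(a \<circ> s) \<longlonglongrightarrow> k"
    using bounded_imp_convergent_subsequence by blast
  have "lax_eq \<tau> Lm 1 (\<tau> * k) v"
  proof (rule lax_eq_limit[OF lagr_axioms assms, of 1])
    show "lax_eq \<tau> Lm (1 - \<tau> * lam (r (s n))) (\<tau> * (a \<circ> s) n) (ws (r (s n)))" for n
      using ws[of "r (s n)"] by (simp add: a_def)
    have "(\<lambda>n. 1 - \<tau> * lam n) \<longlonglongrightarrow> 1 - 0"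
      unfolding tl by (intro tendsto_intros LIMSEQ_inverse_real_of_nat)
    then have "((\<lambda>n. 1 - \<tau> * lam n) \<circ> (r \<circ> s)) \<longlonglongrightarrow> 1 - 0"
      by (rule LIMSEQ_subseq_LIMSEQ) (intro strict_mono_o r s)
    then show "(\<lambda>n. 1 - \<tau> * lam (r (s n))) \<longlonglongrightarrow> 1"
      by (simp add: o_def)
    show "(\<lambda>n. \<tau> * (a \<circ> s) n) \<longlonglongrightarrow> \<tau> * k"
      by (intro tendsto_intros s)
    show "uniform_limit UNIV (\<lambda>n. ws (r (s n))) v sequentially"
      by (rule filterlim_compose[OF r(3) filterlim_subseq[OF s(1)]])
  qed auto
  then show ?thesis
    by blast
qed

lemma constant_unique:
  assumes "\<tau> > 0" "lax_eq \<tau> Lm 1 (\<tau> * k) u" "lax_eq \<tau> Lm 1 (\<tau> * k') w"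
  shows "k = k'"
  using constant_le[OF assms, of 0] constant_le[OF assms(1,3,2), of 0] by simp

lemma effective_const_eqI:
  assumes "\<tau> > 0" "lax_eq \<tau> Lm 1 (\<tau> * k) u"
  shows "effective_const \<tau> Lm = k"
  unfolding effective_const_def lax_oleinik_iff[OF assms(1)]
  using assms constant_unique by blast

lemma effective_const_solution:
  assumes "\<tau> > 0"
  obtains u where "lax_eq \<tau> Lm 1 (\<tau> * effective_const \<tau> Lm) u"
  using lax_eq_exists_undiscounted[OF assms] effective_const_eqI[OF assms] by blast

text \<open>Subtracting from \<open>w\<close> its minimum and adding \<open>k / lam\<close> gives a
  supersolution of the discounted equation, and subtracting its maximum gives a subsolution, because
  the defect \<open>\<tau> * lam * (w - a)\<close> then has a sign. The error is thus an oscillation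
  of \<open>w\<close>, independent of the discount.\<close>

lemma discounted_close:
  assumes "\<tau> > 0" "lam > 0" "\<tau> * lam \<le> 1"
    and u: "lax_eq \<tau> Lm (1 - \<tau> * lam) 0 u" and w: "lax_eq \<tau> Lm 1 (\<tau> * k) w"
    and B: "\<And>X Y. w X - w Y \<le> B"
  shows "\<bar>u X - k / lam\<bar> \<le> B"
proof -
  have \<beta>: "0 \<le> 1 - \<tau> * lam" "1 - \<tau> * lam < 1"
    using assms by auto
  note cw = lax_eqD(1)[OF w]
  obtain X0 where X0: "\<And>Z. w X0 \<le> w Z"
    using continuous_attains_inf[OF compact_torus _ cw] by auto
  obtain X1 where X1: "\<And>Z. w Z \<le> w X1"
    using continuous_attains_sup[OF compact_torus _ cw] by auto
  have step_eq: "step \<tau> Lm (1 - \<tau> * lam) (\<lambda>X. w X - a + k / lam) X v =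
      step \<tau> Lm 1 w X v - \<tau> * k - a + k / lam - \<tau> * lam * (w (X - tproj (\<tau> *\<^sub>R v)) - a)" for X v a
    using assms(2) by (simp add: step_def field_simps)
  have "u X \<le> w X - w X0 + k / lam" for X
  proof (rule comparison_discounted[OF assms(1) \<beta> lax_eqD(1)[OF u] _ lax_eqD(2)[OF u]])
    show "continuous_on UNIV (\<lambda>X. w X - w X0 + k / lam)"
      by (intro continuous_intros cw)
    fix X
    obtain v where v: "w X + \<tau> * k = step \<tau> Lm 1 w X v"
      using lax_eqD(3)[OF w] by blast
    have "0 \<le> \<tau> * lam * (w (X - tproj (\<tau> *\<^sub>R v)) - w X0)"
      using X0 assms by simp
    then have "step \<tau> Lm (1 - \<tau> * lam) (\<lambda>X. w X - w X0 + k / lam) X v \<le> w X - w X0 + k / lam + 0"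
      unfolding step_eq using v by linarith
    then show "\<exists>v. step \<tau> Lm (1 - \<tau> * lam) (\<lambda>X. w X - w X0 + k / lam) X v \<le> w X - w X0 + k / lam + 0"
      by blast
  qed
  moreover have "w X - w X1 + k / lam \<le> u X" for X
  proof (rule comparison_discounted[OF assms(1) \<beta> _ lax_eqD(1)[OF u], where c = 0])
    show "continuous_on UNIV (\<lambda>X. w X - w X1 + k / lam)"
      by (intro continuous_intros cw)
    show "\<exists>v. step \<tau> Lm (1 - \<tau> * lam) u X v \<le> u X + 0" for X
      using lax_eqD(3)[OF u, of X] by (metis order_refl)
    fix X v
    have "0 \<ge> \<tau> * lam * (w (X - tproj (\<tau> *\<^sub>R v)) - w X1)"
      using X1[of "X - tproj (\<tau> *\<^sub>R v)"] assms by (simp add: mult_nonneg_nonpos)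
    then show "w X - w X1 + k / lam + 0 \<le> step \<tau> Lm (1 - \<tau> * lam) (\<lambda>X. w X - w X1 + k / lam) X v"
      unfolding step_eq using lax_eqD(2)[OF w, of X v] by linarith
  qed
  ultimately show ?thesis
    using B[of X X0] B[of X1 X] by (smt (verit))
qed

subsection \<open>Bounds uniform in the time step\<close>

lemma constant_bounds:
  assumes "\<tau> > 0" "lax_eq \<tau> Lm 1 (\<tau> * k) u"
  shows "CL 1 \<le> k" "k \<le> UL 0"
proof -
  have "\<tau> * k \<le> \<tau> * Lm 0 0"
    using lax_eqD(2)[OF assms(2), of 0 0] by (simp add: step_def)
  then show "k \<le> UL 0"
    using upper[of 0 0 0] assms(1) by simp
  obtain X0 where X0: "\<And>Z. u X0 \<le> u Z"
    using continuous_attains_inf[OF compact_torus _ lax_eqD(1)[OF assms(2)]] by auto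
  obtain v where v: "u X0 + \<tau> * k = step \<tau> Lm 1 u X0 v"
    using lax_eqD(3)[OF assms(2)] by blast
  have "\<tau> * Lm (X0 - tproj (\<tau> *\<^sub>R v)) v \<le> \<tau> * k"
    using v X0[of "X0 - tproj (\<tau> *\<^sub>R v)"] by (simp add: step_def)
  then have "Lm (X0 - tproj (\<tau> *\<^sub>R v)) v \<le> k"
    using assms(1) by simp
  then show "CL 1 \<le> k"
    using lower order_trans by blast
qed

text \<open>At velocity at most 1 each time step raises \<open>u\<close> by at most
  \<open>\<tau> * (UL 1 - CL 1)\<close>, and \<open>subdivision\<close> counts the steps. Below the
  scale \<open>\<tau>\<close> this is no Lipschitz bound, but it suffices to bound optimal
  velocities.\<close>

lemma lax_eq_large_scale:
  assumes "\<tau> > 0" "lax_eq \<tau> Lm 1 (\<tau> * k) u"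
  shows "u (X + tproj h) - u X \<le> (UL 1 - CL 1) * (norm h + \<tau>)"
proof -
  obtain n g where g: "h = real n *\<^sub>R g" "norm g \<le> \<tau>" "real n * \<tau> \<le> norm h + \<tau>"
    using subdivision[OF assms(1)] by metis
  have v: "\<tau> *\<^sub>R (g /\<^sub>R \<tau>) = g" "norm (g /\<^sub>R \<tau>) \<le> 1"
    using g(2) assms(1) by (simp_all add: field_simps)
  have "u (Z + tproj g) \<le> u Z + \<tau> * (UL 1 - CL 1)" for Z
  proof -
    have "u (Z + tproj g) + \<tau> * k \<le> u Z + \<tau> * Lm Z (g /\<^sub>R \<tau>)"
      using lax_eq_forward[OF assms(2), of Z "g /\<^sub>R \<tau>"] unfolding v(1) by simp
    moreover have "\<tau> * (Lm Z (g /\<^sub>R \<tau>) - k) \<le> \<tau> * (UL 1 - CL 1)"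
      using upper[OF v(2), of Z] constant_bounds(1)[OF assms] assms(1) by (intro mult_left_mono) auto
    ultimately show ?thesis
      unfolding right_diff_distrib by linarith
  qed
  then have "u (X + tproj h) \<le> u X + real n * (\<tau> * (UL 1 - CL 1))"
    unfolding g(1) by (rule torus_shift_iterate[where g = u])
  also have "real n * (\<tau> * (UL 1 - CL 1)) \<le> (norm h + \<tau>) * (UL 1 - CL 1)"
    unfolding mult.assoc[symmetric] using g(3) CL_le_UL(2)[of 1] by (intro mult_right_mono) auto
  finally show ?thesis
    by (simp add: mult.commute)
qed

lemma lax_eq_uniform_osc:
  assumes "\<tau> > 0" "\<tau> \<le> 1" "lax_eq \<tau> Lm 1 (\<tau> * k) u"
  shows "u X - u Y \<le> (UL 1 - CL 1) * (torus_diam TYPE('d) + 1)"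
proof -
  obtain h where h: "X = Y + tproj h" "norm h \<le> torus_diam TYPE('d)"
    by (meson torus_shift_bounded)
  have "u X - u Y \<le> (UL 1 - CL 1) * (norm h + \<tau>)"
    using lax_eq_large_scale[OF assms(1,3)] h(1) by simp
  also have "\<dots> \<le> (UL 1 - CL 1) * (torus_diam TYPE('d) + 1)"
    using CL_le_UL(2)[of 1] h(2) assms(2) by (intro mult_left_mono) auto
  finally show ?thesis .
qed

text \<open>An optimal velocity satisfies \<open>Lm - k \<le> A * norm v + A\<close> with
  \<open>A = UL 1 - CL 1\<close>. Superlinearity with slope \<open>A + 1\<close> and
  \<open>k \<le> UL 0\<close> turn this into the stated bound, in which the time step no longer
  appears.\<close>

definition speed :: real where
  "speed = UL 1 - CL 1 + UL 0 - CL (UL 1 - CL 1 + 1)"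

lemma lax_eq_speed:
  assumes "\<tau> > 0" "lax_eq \<tau> Lm 1 (\<tau> * k) u" "u X + \<tau> * k = step \<tau> Lm 1 u X v"
  shows "norm v \<le> speed"
proof -
  let ?Z = "X - tproj (\<tau> *\<^sub>R v)" and ?A = "UL 1 - CL 1"
  have "\<tau> * (Lm ?Z v - k) = u (?Z + tproj (\<tau> *\<^sub>R v)) - u ?Z"
    using assms(3) by (simp add: step_def algebra_simps)
  also have "\<dots> \<le> ?A * (norm (\<tau> *\<^sub>R v) + \<tau>)"
    by (rule lax_eq_large_scale[OF assms(1,2)])
  also have "\<dots> = \<tau> * (?A * norm v + ?A)"
    using assms(1) by (simp add: algebra_simps)
  finally have "Lm ?Z v - k \<le> ?A * norm v + ?A"
    using assms(1) by simp
  moreover have "(?A + 1) * norm v + CL (?A + 1) \<le> Lm ?Z v"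
    using CL_le_UL(2)[of 1] by (intro super) auto
  ultimately show ?thesis
    using constant_bounds(2)[OF assms(1,2)] by (simp add: speed_def algebra_simps)
qed

lemma lax_eq_uniform_lipschitz:
  assumes "\<tau> > 0" "lax_eq \<tau> Lm 1 (\<tau> * k) u"
  shows "\<bar>u X - u Y\<bar> \<le> UL (speed + 1) * dist X Y"
  by (rule value_lipschitz[OF assms lax_eq_speed[OF assms]])

end

section \<open>Regularity of the data\<close>

subsection \<open>Gradients\<close>

lemma GDERIV_unique:
  assumes "GDERIV f x :> D" "GDERIV f x :> E"
  shows "D = E"
proof -
  have "(\<lambda>h. inner h D) = (\<lambda>h. inner h E)"
    using assms unfolding gderiv_def by (rule has_derivative_unique)
  then have "inner (D - E) D = inner (D - E) E"
    by (rule fun_cong)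
  then have "inner (D - E) (D - E) = 0"
    by (simp add: inner_diff_right)
  then show ?thesis
    by simp
qed

lemma grad_eqI: "GDERIV f x :> D \<Longrightarrow> grad f x = D"
  unfolding grad_def using GDERIV_unique by (blast intro: the_equality)

lemma GDERIV_continuous:
  assumes "\<And>x. GDERIV f x :> g x"
  shows "continuous_on UNIV f"
  using assms unfolding gderiv_def
  by (intro continuous_at_imp_continuous_on) (blast intro: has_derivative_continuous)

lemma C_k_continuous: "C_k k f \<Longrightarrow> continuous_on UNIV f"
  by (cases k) (auto intro: GDERIV_continuous)

lemma C_k_gradient:
  assumes "C_k (Suc k) f"
  obtains g where "\<And>x. GDERIV f x :> g x" "continuous_on UNIV g"
proof -
  obtain g where g: "\<And>x. GDERIV f x :> g x" "\<And>b. b \<in> Basis \<Longrightarrow> C_k k (\<lambda>x. inner (g x) b)"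
    using assms by auto
  have "continuous_on UNIV (\<lambda>x. \<Sum>b\<in>Basis. inner (g x) b *\<^sub>R b)"
    by (intro continuous_on_sum continuous_on_scaleR continuous_on_const C_k_continuous[OF g(2)])
  then have "continuous_on UNIV g"
    by (simp add: euclidean_representation)
  then show ?thesis
    using that g(1) by blast
qed

lemma gradient_mean_value:
  fixes f :: "'a::euclidean_space \<Rightarrow> real"
  assumes "\<And>z. GDERIV f z :> g z" "\<And>t. t \<in> {0..1} \<Longrightarrow> norm (g (z + t *\<^sub>R k) - g z) \<le> e"
  shows "\<bar>f (z + k) - f z - inner k (g z)\<bar> \<le> e * norm k"
proof -
  let ?S = "closed_segment z (z + k)"
  have S: "norm (g x - g z) \<le> e" if x: "x \<in> ?S" for x
  proof -
    obtain t where t: "0 \<le> t" "t \<le> 1" "x = (1 - t) *\<^sub>R z + t *\<^sub>R (z + k)"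
      using x unfolding in_segment by blast
    have "x = z + t *\<^sub>R k"
      by (simp add: t(3) algebra_simps)
    then show ?thesis
      using assms(2)[of t] t by simp
  qed
  have "norm (f (z + k) - f z - inner (z + k - z) (g z)) \<le> norm (z + k - z) * e"
  proof (rule differentiable_bound_linearization[where S = ?S and f' = "\<lambda>x h. inner h (g x)"])
    show "z + t *\<^sub>R (z + k - z) \<in> ?S" if "t \<in> {0..1}" for t
      using that by (auto simp: in_segment algebra_simps intro!: exI[of _ t])
    show "(f has_derivative (\<lambda>h. inner h (g x))) (at x within ?S)" if "x \<in> ?S" for x
      using assms(1)[of x] unfolding gderiv_def by (rule has_derivative_at_withinI)
    show "onorm ((\<lambda>h. inner h (g x)) - (\<lambda>h. inner h (g z))) \<le> e" if "x \<in> ?S" for x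
    proof (rule onorm_le)
      fix h
      have "norm (((\<lambda>h. inner h (g x)) - (\<lambda>h. inner h (g z))) h) = \<bar>inner h (g x - g z)\<bar>"
        by (simp add: inner_diff_right)
      also have "\<dots> \<le> norm h * norm (g x - g z)"
        by (rule Cauchy_Schwarz_ineq2)
      also have "\<dots> \<le> e * norm h"
        using mult_right_mono[OF S[OF that] norm_ge_zero[of h]] by (simp add: mult.commute)
      finally show "norm (((\<lambda>h. inner h (g x)) - (\<lambda>h. inner h (g z))) h) \<le> e * norm h" .
    qed
  qed auto
  then show ?thesis
    by (simp add: mult.commute)
qed

lemma gradient_expansion:
  fixes f :: "'a::euclidean_space \<Rightarrow> real"
  assumes "\<And>z. GDERIV f z :> g z" "continuous_on UNIV g" "compact K" "convex K" "e > 0"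
  obtains d where "d > 0"
    "\<And>z k. z \<in> K \<Longrightarrow> z + k \<in> K \<Longrightarrow> norm k \<le> d \<Longrightarrow> \<bar>f (z + k) - f z - inner k (g z)\<bar> \<le> e * norm k"
proof -
  have "uniformly_continuous_on K g"
    using assms(2,3) by (intro compact_uniformly_continuous) (auto intro: continuous_on_subset)
  then obtain d where d: "d > 0" "\<And>x y. x \<in> K \<Longrightarrow> y \<in> K \<Longrightarrow> dist y x < d \<Longrightarrow> dist (g y) (g x) < e"
    using \<open>e > 0\<close> unfolding uniformly_continuous_on_def by metis
  have "\<bar>f (z + k) - f z - inner k (g z)\<bar> \<le> e * norm k" if "z \<in> K" "z + k \<in> K" "norm k \<le> d / 2" for z k
  proof (rule gradient_mean_value[OF assms(1)])
    fix t :: real assume t: "t \<in> {0..1}"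
    have "z + t *\<^sub>R k = (1 - t) *\<^sub>R z + t *\<^sub>R (z + k)"
      by (simp add: algebra_simps)
    also have "\<dots> \<in> K"
      using that t assms(4) by (intro convexD) auto
    finally have "z + t *\<^sub>R k \<in> K" .
    moreover have "norm (t *\<^sub>R k) \<le> norm k"
      using t by (simp add: mult_left_le_one_le)
    then have "dist (z + t *\<^sub>R k) z < d"
      using that(3) d(1) by (simp add: dist_norm)
    ultimately show "norm (g (z + t *\<^sub>R k) - g z) \<le> e"
      using d(2) \<open>z \<in> K\<close> by (simp add: dist_norm less_imp_le)
  qed
  then show ?thesis
    using that[of "d / 2"] d(1) by simp
qed

lemma torus_gderiv_tproj:
  assumes "GDERIV (\<lambda>y. f (tproj y)) x :> D"
  shows "torus_gderiv f (tproj x) D"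
  unfolding torus_gderiv_def
proof (intro allI impI)
  fix y assume y: "tproj y = tproj x"
  have "((\<lambda>z. f (tproj z)) has_derivative (\<lambda>h. inner h D)) (at (y + (x - y)))"
    using assms by (simp add: gderiv_def)
  then have "((\<lambda>z. f (tproj (z + (x - y)))) has_derivative (\<lambda>h. inner h D)) (at y)"
    by (rule has_derivative_compose[of "\<lambda>z. z + (x - y)", rotated, unfolded o_def])
      (auto intro!: derivative_eq_intros)
  moreover have "tproj (z + (x - y)) = tproj z" for z
    using y by (simp add: tproj_add tproj_diff)
  ultimately show "GDERIV (\<lambda>z. f (tproj z)) y :> D"
    by (simp add: gderiv_def)
qed

lemma torus_gderiv_unique: "torus_gderiv f X D \<Longrightarrow> torus_gderiv f X E \<Longrightarrow> D = E"
  unfolding torus_gderiv_def using tproj_surj GDERIV_unique by metis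

lemma torus_grad_eqI: "torus_gderiv f X D \<Longrightarrow> torus_grad f X = D"
  unfolding torus_grad_def using torus_gderiv_unique by (blast intro: the_equality)

lemma torus_grad_C_k:
  assumes "C_k (Suc k) (\<lambda>x. f (tproj x))"
  shows "GDERIV (\<lambda>x. f (tproj x)) x :> torus_grad f (tproj x)" "continuous_on UNIV (torus_grad f)"
proof -
  obtain g where g: "\<And>x. GDERIV (\<lambda>x. f (tproj x)) x :> g x" "continuous_on UNIV g"
    using C_k_gradient[OF assms] by blast
  have eq: "torus_grad f (tproj x) = g x" for x
    by (intro torus_grad_eqI torus_gderiv_tproj g)
  then show "GDERIV (\<lambda>x. f (tproj x)) x :> torus_grad f (tproj x)"
    using g by simp
  show "continuous_on UNIV (torus_grad f)"
    by (rule continuous_torus_lift) (simp add: eq g)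
qed

subsection \<open>Tonelli functions\<close>

lemma
  assumes "tonelli G"
  shows tonelli_continuous: "continuous_on UNIV (\<lambda>(X, p). G X p)"
    and tonelli_superlinear: "\<exists>C. \<forall>K>0. \<forall>X p. K * norm p + C K \<le> G X p"
proof -
  have "continuous_on UNIV (\<lambda>(x, p). G (tproj x) p)"
    using assms by (auto simp: tonelli_def intro: C_k_continuous)
  then show "continuous_on UNIV (\<lambda>(X, p). G X p)"
    by (rule continuous_torus_times_lift)
  have "\<forall>K. \<exists>C. K > 0 \<longrightarrow> (\<forall>X p. K * norm p + C \<le> G X p)"
    using assms by (auto simp: tonelli_def)
  then show "\<exists>C. \<forall>K>0. \<forall>X p. K * norm p + C K \<le> G X p"
    by metis
qed

lemma tonelli_gradient:
  fixes G :: "'d::finite torus \<Rightarrow> real ^ 'd \<Rightarrow> real"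
  assumes "tonelli G"
  obtains g where "\<And>z. GDERIV (\<lambda>(x, p). G (tproj x) p) z :> g z" "continuous_on UNIV g"
    "\<And>x p. GDERIV (G (tproj x)) p :> snd (g (x, p))"
proof -
  have "C_k (Suc 1) (\<lambda>(x, p). G (tproj x) p)"
    using assms by (simp add: tonelli_def numeral_2_eq_2)
  then obtain g where g: "\<And>z. GDERIV (\<lambda>(x, p). G (tproj x) p) z :> g z" "continuous_on UNIV g"
    using C_k_gradient by blast
  have "GDERIV (G (tproj x)) p :> snd (g (x, p))" for x p
  proof -
    have "((\<lambda>q. (x, q)) has_derivative (\<lambda>h. (0, h))) (at p)"
      by (auto intro!: derivative_eq_intros)
    moreover have "((\<lambda>(x, p). G (tproj x) p) has_derivative (\<lambda>h. inner h (g (x, p)))) (at (x, p))"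
      using g(1)[of "(x, p)"] by (simp add: gderiv_def)
    ultimately have "((\<lambda>q. (\<lambda>(x, p). G (tproj x) p) (x, q)) has_derivative (\<lambda>h. inner (0, h) (g (x, p)))) (at p)"
      by (rule has_derivative_compose)
    then show ?thesis
      by (simp add: gderiv_def inner_prod_def)
  qed
  then show ?thesis
    using that g by blast
qed

lemma tonelli_grad:
  assumes "tonelli G"
  shows "GDERIV (G X) p :> grad (G X) p" "continuous_on UNIV (\<lambda>(X, p). grad (G X) p)"
proof -
  obtain g where "\<And>z. GDERIV (\<lambda>(x, p). G (tproj x) p) z :> g z" and
    g: "continuous_on UNIV g" "\<And>x p. GDERIV (G (tproj x)) p :> snd (g (x, p))"
    using tonelli_gradient[OF assms] by blast
  have eq: "grad (G (tproj x)) p = snd (g (x, p))" for x p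
    by (rule grad_eqI[OF g(2)])
  show "GDERIV (G X) p :> grad (G X) p"
    using g(2) eq tproj_surj by metis
  have "continuous_on UNIV (\<lambda>(x, p). grad (G (tproj x)) p)"
    unfolding eq case_prod_beta prod.collapse by (intro continuous_intros g)
  then show "continuous_on UNIV (\<lambda>(X, p). grad (G X) p)"
    by (rule continuous_torus_times_lift)
qed

lemma tonelli_bounded:
  fixes G :: "'d::finite torus \<Rightarrow> real ^ 'd \<Rightarrow> real"
  assumes "tonelli G"
  shows "\<exists>B. \<forall>r X v. norm v \<le> r \<longrightarrow> \<bar>G X v\<bar> \<le> B r"
    and "\<exists>B. \<forall>r X v w. norm v \<le> r \<longrightarrow> norm w \<le> r \<longrightarrow> \<bar>G X v - G X w\<bar> \<le> B r * norm (v - w)"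
proof -
  have c: "compact (UNIV \<times> cball 0 r :: ('d torus \<times> (real ^ 'd)) set)" for r
    by (intro compact_Times compact_torus compact_cball)
  have bd: "\<exists>B. \<forall>X v. norm v \<le> r \<longrightarrow> norm (f X v) \<le> B"
    if "continuous_on UNIV (\<lambda>(X, v). f X v)" for r and f :: "'d torus \<Rightarrow> real ^ 'd \<Rightarrow> 'c::real_normed_vector"
  proof -
    have "bounded ((\<lambda>(X, v). f X v) ` (UNIV \<times> cball 0 r))"
      by (intro compact_imp_bounded compact_continuous_image c continuous_on_subset[OF that]) auto
    then obtain B where "\<And>X v. norm v \<le> r \<Longrightarrow> norm (f X v) \<le> B"
      by (fastforce simp: bounded_iff)
    then show ?thesis
      by blast
  qed
  have "\<forall>r. \<exists>B. \<forall>X v. norm v \<le> r \<longrightarrow> \<bar>G X v\<bar> \<le> B"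
    using bd[OF tonelli_continuous[OF assms]] by simp
  then show "\<exists>B. \<forall>r X v. norm v \<le> r \<longrightarrow> \<bar>G X v\<bar> \<le> B r"
    by metis
  have "\<exists>B. \<forall>X v w. norm v \<le> r \<longrightarrow> norm w \<le> r \<longrightarrow> \<bar>G X v - G X w\<bar> \<le> B * norm (v - w)" for r
  proof -
    obtain B where B: "\<And>X v. norm v \<le> r \<Longrightarrow> norm (grad (G X) v) \<le> B"
      using bd[OF tonelli_grad(2)[OF assms]] by blast
    have "norm (G X v - G X w) \<le> B * norm (v - w)" if "norm v \<le> r" "norm w \<le> r" for X v w
    proof (rule differentiable_bound[of "cball 0 r" "G X" "\<lambda>x h. inner h (grad (G X) x)"])
      show "(G X has_derivative (\<lambda>h. inner h (grad (G X) x))) (at x within cball 0 r)" for x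
        using tonelli_grad(1)[OF assms, of X x] unfolding gderiv_def by (rule has_derivative_at_withinI)
      show "onorm (\<lambda>h. inner h (grad (G X) x)) \<le> B" if "x \<in> cball 0 r" for x
      proof (rule onorm_le)
        fix h
        have "norm (inner h (grad (G X) x)) \<le> norm h * norm (grad (G X) x)"
          by (simp add: Cauchy_Schwarz_ineq2)
        also have "\<dots> \<le> B * norm h"
          using mult_right_mono[OF B[of x X] norm_ge_zero[of h]] that by (simp add: mult.commute)
        finally show "norm (inner h (grad (G X) x)) \<le> B * norm h" .
      qed
    qed (use that in auto)
    then show ?thesis
      by auto
  qed
  then show "\<exists>B. \<forall>r X v w. norm v \<le> r \<longrightarrow> norm w \<le> r \<longrightarrow> \<bar>G X v - G X w\<bar> \<le> B r * norm (v - w)"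
    by metis
qed

subsection \<open>The coupling\<close>

lemma weak_star_compact_torus:
  fixes ms :: "nat \<Rightarrow> 'd::finite torus measure"
  assumes "\<And>n. ms n \<in> borel_prob"
  obtains r m where "strict_mono (r :: nat \<Rightarrow> nat)" "m \<in> borel_prob" "limitin weak_star (ms \<circ> r) m sequentially"
proof -
  obtain r :: "nat \<Rightarrow> nat" and m where r: "strict_mono r" "m \<in> borel_prob" "AE z in m. z \<in> UNIV"
    "\<And>f :: 'd torus \<Rightarrow> real. continuous_on UNIV f \<Longrightarrow>
      (\<lambda>n. integral\<^sup>L (ms (r n)) f) \<longlonglongrightarrow> integral\<^sup>L m f"
    using weak_compactness_on_compact[of ms UNIV] assms compact_torus by auto
  then have "limitin weak_star (ms \<circ> r) m sequentially"
    using assms by (subst limitin_weak_star) auto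
  then show ?thesis
    using that r by blast
qed

lemma continuous_map_seq_limit:
  assumes "continuous_map (prod_topology euclidean T) euclidean (\<lambda>(X, m). f X m)"
    and "Xs \<longlonglongrightarrow> X" "limitin T ms m sequentially"
  shows "(\<lambda>n. f (Xs n) (ms n)) \<longlonglongrightarrow> f X m"
proof -
  have "limitin (prod_topology euclidean T) (\<lambda>n. (Xs n, ms n)) (X, m) sequentially"
    using assms(2,3) by (simp add: limitin_pairwise o_def)
  from continuous_map_limit[OF assms(1) this] show ?thesis
    by (simp add: o_def)
qed

lemma coupling_seq_limit:
  assumes "coupling F" "Xs \<longlonglongrightarrow> X" "limitin weak_star ms m sequentially"
  shows "(\<lambda>n. F (Xs n) (ms n)) \<longlonglongrightarrow> F X m"
    and "(\<lambda>n. torus_grad (\<lambda>Y. F Y (ms n)) (Xs n)) \<longlonglongrightarrow> torus_grad (\<lambda>Y. F Y m) X"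
  using assms by (auto simp: coupling_def intro!: continuous_map_seq_limit[OF _ assms(2,3)])

text \<open>Points violating the bound would accumulate on the compact torus, where joint continuity
  of \<open>F\<close> is contradicted.\<close>

lemma coupling_uniform_limit:
  fixes F :: "'d::finite torus \<Rightarrow> 'd torus measure \<Rightarrow> real"
  assumes F: "coupling F" and lim: "limitin weak_star ms m sequentially" and "e > 0"
  shows "\<forall>\<^sub>F n in sequentially. \<forall>X. \<bar>F X (ms n) - F X m\<bar> \<le> e"
proof (rule ccontr)
  assume "\<not> ?thesis"
  then obtain r :: "nat \<Rightarrow> nat" where r: "strict_mono r" "\<And>n. \<not> (\<forall>X. \<bar>F X (ms (r n)) - F X m\<bar> \<le> e)"
    using not_eventually_sequentiallyD by blast
  then obtain Xs where Xs: "\<And>n. \<not> \<bar>F (Xs n) (ms (r n)) - F (Xs n) m\<bar> \<le> e"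
    by metis
  obtain X s where s: "strict_mono (s :: nat \<Rightarrow> nat)" "(Xs \<circ> s) \<longlonglongrightarrow> X"
    using compact_torus unfolding compact_def by blast
  have mb: "m \<in> borel_prob"
    using lim by (simp add: limitin_def topspace_weak_star)
  have "limitin weak_star (ms \<circ> (r \<circ> s)) m sequentially"
    using lim r s by (intro limitin_subsequence strict_mono_o)
  then have "(\<lambda>n. F ((Xs \<circ> s) n) ((ms \<circ> (r \<circ> s)) n)) \<longlonglongrightarrow> F X m"
    by (rule coupling_seq_limit(1)[OF F s(2)])
  moreover have "(\<lambda>n. F ((Xs \<circ> s) n) m) \<longlonglongrightarrow> F X m"
    by (rule coupling_seq_limit(1)[OF F s(2)]) (simp add: limitin_const_iff topspace_weak_star mb)
  ultimately have "(\<lambda>n. F ((Xs \<circ> s) n) ((ms \<circ> (r \<circ> s)) n) - F ((Xs \<circ> s) n) m) \<longlonglongrightarrow> F X m - F X m"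
    by (rule tendsto_diff)
  then have "\<forall>\<^sub>F n in sequentially. \<bar>F ((Xs \<circ> s) n) ((ms \<circ> (r \<circ> s)) n) - F ((Xs \<circ> s) n) m\<bar> < e"
    using \<open>e > 0\<close> by (auto simp: tendsto_iff dist_real_def)
  then obtain n where "\<bar>F (Xs (s n)) (ms (r (s n))) - F (Xs (s n)) m\<bar> < e"
    by (auto simp: eventually_sequentially)
  then show False
    using Xs[of "s n"] by simp
qed

text \<open>One modulus for the space gradients of all measures, by sequential compactness of both
  the measures and the torus. This is where uniformity in the measure of all later first-order
  expansions originates.\<close>

lemma coupling_gradient_modulus:
  fixes F :: "'d::finite torus \<Rightarrow> 'd torus measure \<Rightarrow> real"
  assumes F: "coupling F" and "e > 0"
  obtains d where "d > 0" "\<And>m X Y. m \<in> borel_prob \<Longrightarrow> dist X Y \<le> d \<Longrightarrow>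
    norm (torus_grad (\<lambda>Z. F Z m) X - torus_grad (\<lambda>Z. F Z m) Y) \<le> e"
proof (rule ccontr)
  assume "\<not> thesis"
  then have "\<exists>m X Y. m \<in> borel_prob \<and> dist X Y \<le> inverse (real (Suc n)) \<and>
      e < norm (torus_grad (\<lambda>Z. F Z m) X - torus_grad (\<lambda>Z. F Z m) Y)" for n
    using that[of "inverse (real (Suc n))"] by (fastforce simp: not_le)
  then obtain ms Xs Ys where *: "\<And>n. ms n \<in> borel_prob" "\<And>n. dist (Xs n) (Ys n) \<le> inverse (real (Suc n))"
      "\<And>n. e < norm (torus_grad (\<lambda>Z. F Z (ms n)) (Xs n) - torus_grad (\<lambda>Z. F Z (ms n)) (Ys n))"
    by metis
  obtain r m where r: "strict_mono (r :: nat \<Rightarrow> nat)" "limitin weak_star (ms \<circ> r) m sequentially"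
    using weak_star_compact_torus[of ms] * by metis
  have "seq_compact (UNIV :: 'd torus set)"
    using compact_torus by (simp add: compact_eq_seq_compact_metric)
  then obtain X s where s: "strict_mono (s :: nat \<Rightarrow> nat)" "((Xs \<circ> r) \<circ> s) \<longlonglongrightarrow> X"
    unfolding seq_compact_def by (metis UNIV_I)
  have lim: "limitin weak_star ((ms \<circ> r) \<circ> s) m sequentially"
    using r(2) s(1) by (rule limitin_subsequence[rotated])
  have "(\<lambda>n. dist (Xs n) (Ys n)) \<longlonglongrightarrow> 0"
    using * by (intro tendsto_sandwich[OF _ _ tendsto_const LIMSEQ_inverse_real_of_nat]) auto
  then have "((\<lambda>n. dist (Xs n) (Ys n)) \<circ> (r \<circ> s)) \<longlonglongrightarrow> 0"
    using r s by (intro LIMSEQ_subseq_LIMSEQ strict_mono_o)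
  note YX = this
  have "(Ys \<circ> r \<circ> s) \<longlonglongrightarrow> X"
  proof (subst tendsto_dist_iff, rule tendsto_sandwich[OF _ _ tendsto_const])
    have "(\<lambda>n. dist ((Xs \<circ> r \<circ> s) n) X) \<longlonglongrightarrow> 0"
      using s(2) tendsto_dist_iff by blast
    from tendsto_add[OF this YX] show "(\<lambda>n. dist ((Xs \<circ> r \<circ> s) n) X + ((\<lambda>n. dist (Xs n) (Ys n)) \<circ> (r \<circ> s)) n) \<longlonglongrightarrow> 0"
      by simp
    show "\<forall>\<^sub>F n in sequentially. dist ((Ys \<circ> r \<circ> s) n) X \<le>
        dist ((Xs \<circ> r \<circ> s) n) X + ((\<lambda>n. dist (Xs n) (Ys n)) \<circ> (r \<circ> s)) n"
      by (intro always_eventually allI) (simp add: dist_commute dist_triangle)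
  qed auto
  from coupling_seq_limit(2)[OF F s(2) lim] coupling_seq_limit(2)[OF F this lim]
  have "(\<lambda>n. torus_grad (\<lambda>Z. F Z (ms (r (s n)))) (Xs (r (s n))) -
      torus_grad (\<lambda>Z. F Z (ms (r (s n)))) (Ys (r (s n)))) \<longlonglongrightarrow>
      torus_grad (\<lambda>Y. F Y m) X - torus_grad (\<lambda>Y. F Y m) X"
    unfolding o_def by (rule tendsto_diff)
  then have "(\<lambda>n. norm (torus_grad (\<lambda>Z. F Z (ms (r (s n)))) (Xs (r (s n))) -
      torus_grad (\<lambda>Z. F Z (ms (r (s n)))) (Ys (r (s n))))) \<longlonglongrightarrow> 0"
    using tendsto_norm_zero by fastforce
  then have "e \<le> 0"
    by (rule LIMSEQ_le_const) (use * less_imp_le in blast)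
  then show False
    using \<open>e > 0\<close> by simp
qed

lemma coupling_bounded:
  assumes "coupling F"
  obtains B where "B > 0" "\<And>m X. m \<in> borel_prob \<Longrightarrow> \<bar>F X m\<bar> \<le> B"
    "\<And>m X. m \<in> borel_prob \<Longrightarrow> norm (torus_grad (\<lambda>Y. F Y m) X) \<le> B"
  using assms by (auto simp: coupling_def)

lemma coupling_GDERIV:
  assumes "coupling F" "m \<in> borel_prob"
  shows "GDERIV (\<lambda>x. F (tproj x) m) x :> torus_grad (\<lambda>Y. F Y m) (tproj x)" "continuous_on UNIV (\<lambda>X. F X m)"
proof -
  have "C_k (Suc 1) (\<lambda>x. F (tproj x) m)"
    using assms by (auto simp: coupling_def numeral_2_eq_2)
  then show *: "GDERIV (\<lambda>x. F (tproj x) m) x :> torus_grad (\<lambda>Y. F Y m) (tproj x)" for x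
    by (rule torus_grad_C_k(1))
  show "continuous_on UNIV (\<lambda>X. F X m)"
    by (rule continuous_torus_lift) (rule GDERIV_continuous[OF *])
qed

text \<open>The coupling only shifts the constants of \<open>L\<close> by its uniform bound and
  cancels in velocity differences, so one pair \<open>CL\<close>, \<open>UL\<close> serves every
  measure.\<close>

lemma lag_at_lagr:
  fixes L :: "'d::finite torus \<Rightarrow> real ^ 'd \<Rightarrow> real"
  assumes L: "tonelli L" and F: "coupling F"
  obtains CL UL where "\<And>m. m \<in> borel_prob \<Longrightarrow> lagr (lag_at L F m) CL UL"
proof -
  obtain B where B: "\<And>m X. m \<in> borel_prob \<Longrightarrow> \<bar>F X m\<bar> \<le> B"
    using coupling_bounded[OF F] by metis
  obtain C where C: "\<And>K X p. K > 0 \<Longrightarrow> K * norm p + C K \<le> L X p"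
    using tonelli_superlinear[OF L] by blast
  obtain D where D: "\<And>r X v. norm v \<le> r \<Longrightarrow> \<bar>L X v\<bar> \<le> D r"
    using tonelli_bounded(1)[OF L] by blast
  obtain E where E: "\<And>r X v w. norm v \<le> r \<Longrightarrow> norm w \<le> r \<Longrightarrow> \<bar>L X v - L X w\<bar> \<le> E r * norm (v - w)"
    using tonelli_bounded(2)[OF L] by blast
  have "lagr (lag_at L F m) (\<lambda>K. C K - B) (\<lambda>r. max (D r + B) (E r))" if m: "m \<in> borel_prob" for m
  proof
    have "continuous_on UNIV (\<lambda>z :: 'd torus \<times> (real ^ 'd). F (fst z) m)"
      using continuous_on_compose2[OF coupling_GDERIV(2)[OF F m] continuous_on_fst[OF continuous_on_id]] by auto
    then show "continuous_on UNIV (\<lambda>(X, v). lag_at L F m X v)"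
      using tonelli_continuous[OF L] unfolding lag_at_def case_prod_beta by (intro continuous_intros)
    show "K * norm v + (C K - B) \<le> lag_at L F m X v" if "0 < K" for K X and v :: "real ^ 'd"
      using C[OF that, of v X] B[OF m, of X] by (simp add: lag_at_def)
    show "lag_at L F m X v \<le> max (D r + B) (E r)" if "norm v \<le> r" for r X and v :: "real ^ 'd"
      using D[OF that, of X] B[OF m, of X] by (simp add: lag_at_def)
    fix v w :: "real ^ 'd" and r X assume "norm v \<le> r" "norm w \<le> r"
    then have "\<bar>lag_at L F m X v - lag_at L F m X w\<bar> \<le> E r * norm (v - w)"
      using E by (simp add: lag_at_def)
    also have "\<dots> \<le> max (D r + B) (E r) * norm (v - w)"
      by (intro mult_right_mono) auto
    finally show "\<bar>lag_at L F m X v - lag_at L F m X w\<bar> \<le> max (D r + B) (E r) * norm (v - w)" .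
  qed
  then show ?thesis
    using that by blast
qed

section \<open>The vanishing discount limit\<close>

lemma continuous_torus_shift:
  fixes f :: "'a::topological_space \<Rightarrow> 'd::finite torus"
  assumes "continuous_on S f" "continuous_on S g"
  shows "continuous_on S (\<lambda>z. f z + tproj (g z))"
proof -
  have "continuous_on UNIV (\<lambda>(x, v :: real ^ 'd). tproj x + tproj v)"
    unfolding tproj_add[symmetric] case_prod_unfold
    by (intro continuous_on_compose2[OF continuous_tproj] continuous_intros) auto
  then have "continuous_on UNIV (\<lambda>(X :: 'd torus, v). X + tproj v)"
    by (rule continuous_torus_times_lift)
  from continuous_on_compose2[OF this continuous_on_Pair[OF assms]] show ?thesis
    by simp
qed

lemma borel_prob_measurable:
  assumes "\<mu> \<in> borel_prob" "continuous_on UNIV f"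
  shows "f \<in> borel_measurable \<mu>"
  using borel_measurable_continuous_onI[OF assms(2)] borel_probD(2)[OF assms(1)]
  by (simp cong: measurable_cong_sets)

lemma integrable_on_compact:
  fixes f :: "'a::topological_space \<Rightarrow> real"
  assumes \<mu>: "\<mu> \<in> borel_prob" and K: "compact K" "AE z in \<mu>. z \<in> K" and f: "continuous_on UNIV f"
  shows "integrable \<mu> f"
proof -
  interpret prob_space \<mu>
    by (rule borel_probD(1)[OF \<mu>])
  have "bounded (f ` K)"
    by (intro compact_imp_bounded compact_continuous_image K continuous_on_subset[OF f]) auto
  then obtain B where B: "\<And>z. z \<in> K \<Longrightarrow> norm (f z) \<le> B"
    by (auto simp: bounded_iff)
  show ?thesis
    using K(2) B by (intro integrable_const_bound[of _ B] borel_prob_measurable[OF \<mu> f]) auto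
qed

lemma distr_fst_borel_prob:
  fixes \<mu> :: "('a::topological_space \<times> 'b::topological_space) measure"
  assumes "\<mu> \<in> borel_prob"
  shows "fst \<in> measurable \<mu> borel" "distr \<mu> borel fst \<in> borel_prob"
proof -
  show m: "fst \<in> measurable \<mu> borel"
    by (intro borel_prob_measurable assms continuous_on_fst continuous_on_id)
  show "distr \<mu> borel fst \<in> borel_prob"
    unfolding borel_prob_def using prob_space.prob_space_distr[OF borel_probD(1)[OF assms] m] by simp
qed

lemma integral_distr_fst:
  fixes \<mu> :: "('a::topological_space \<times> 'b::topological_space) measure" and f :: "'a \<Rightarrow> real"
  assumes "\<mu> \<in> borel_prob" "continuous_on UNIV f"
  shows "integral\<^sup>L (distr \<mu> borel fst) f = (\<integral>z. f (fst z) \<partial>\<mu>)"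
  using distr_fst_borel_prob(1)[OF assms(1)] borel_measurable_continuous_onI[OF assms(2)]
  by (rule integral_distr)

lemma holonomicD:
  fixes \<phi> :: "'d::finite torus \<Rightarrow> real"
  assumes "\<mu> \<in> holonomic \<tau>"
  shows "\<mu> \<in> borel_prob"
    "continuous_on UNIV \<phi> \<Longrightarrow> (\<integral>z. \<phi> (fst z + tproj (\<tau> *\<^sub>R snd z)) \<partial>\<mu>) = (\<integral>z. \<phi> (fst z) \<partial>\<mu>)"
  using assms by (auto simp: holonomic_def case_prod_unfold)

lemma holonomic_limit:
  fixes \<nu> :: "('d::finite torus \<times> (real ^ 'd)) measure"
  assumes hol: "\<And>n. \<mu>s n \<in> holonomic \<tau>" and \<nu>: "\<nu> \<in> borel_prob"
    and lim: "\<And>f :: _ \<Rightarrow> real. continuous_on UNIV f \<Longrightarrow> (\<lambda>n. integral\<^sup>L (\<mu>s n) f) \<longlonglongrightarrow> integral\<^sup>L \<nu> f"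
  shows "\<nu> \<in> holonomic \<tau>"
proof -
  have "(\<integral>z. \<phi> (fst z + tproj (\<tau> *\<^sub>R snd z)) \<partial>\<nu>) = (\<integral>z. \<phi> (fst z) \<partial>\<nu>)"
    if \<phi>: "continuous_on UNIV \<phi>" for \<phi> :: "'d torus \<Rightarrow> real"
  proof (rule LIMSEQ_unique)
    show "(\<lambda>n. \<integral>z. \<phi> (fst z + tproj (\<tau> *\<^sub>R snd z)) \<partial>\<mu>s n) \<longlonglongrightarrow> (\<integral>z. \<phi> (fst z + tproj (\<tau> *\<^sub>R snd z)) \<partial>\<nu>)"
      by (rule lim)
        (intro continuous_on_compose2[OF \<phi>] continuous_torus_shift continuous_intros, auto)
    have "(\<lambda>n. \<integral>z. \<phi> (fst z) \<partial>\<mu>s n) \<longlonglongrightarrow> (\<integral>z. \<phi> (fst z) \<partial>\<nu>)"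
      by (rule lim) (intro continuous_on_compose2[OF \<phi>] continuous_intros, auto)
    then show "(\<lambda>n. \<integral>z. \<phi> (fst z + tproj (\<tau> *\<^sub>R snd z)) \<partial>\<mu>s n) \<longlonglongrightarrow> (\<integral>z. \<phi> (fst z) \<partial>\<nu>)"
      using holonomicD(2)[OF hol \<phi>] by simp
  qed
  then show ?thesis
    using \<nu> by (simp add: holonomic_def case_prod_unfold)
qed

lemma (in lagr) spt_discounted_velocity:
  assumes "\<tau> > 0" "lam > 0" "\<tau> * lam \<le> 1" "minimizing_discounted \<tau> lam Lm \<mu>" "(X, v) \<in> spt \<mu>"
  shows "norm v \<le> osc_bound \<tau> + UL 0 - CL 1"
proof -
  let ?u = "discounted_solution \<tau> lam Lm"
  \<comment> \<open>The member with index 0 of the intersection defining the Aubry set exhibits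
    \<open>(X, v)\<close> as the last step of a calibrated configuration; hence \<open>v\<close> is
    an optimal velocity at its end point.\<close>
  have "(X, v) \<in> Psi_disc \<tau> lam Lm 0 (Sigma_disc \<tau> lam Lm)"
    using assms(4,5) by (auto simp: minimizing_discounted_def aubry_disc_def)
  then obtain y xs where xs: "calibrated \<tau> lam Lm y xs" "X = tproj (xs 1)" "v = (xs 0 - xs 1) /\<^sub>R \<tau>"
    by (auto simp: Psi_disc_def)
  have u: "lax_eq \<tau> Lm (1 - \<tau> * lam) 0 ?u"
    using discounted_solution_iff[OF assms(1-3)] by blast
  have "?u (tproj (xs 0)) = (1 - \<tau> * lam) * ?u (tproj (xs 1)) + action \<tau> Lm (xs 1) (xs 0)"
    using xs(1)[unfolded calibrated_def, THEN conjunct2, THEN spec[of _ 0]] by simp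
  moreover have "tproj (xs 0) - tproj (\<tau> *\<^sub>R v) = tproj (xs 1)"
    using assms(1) by (simp add: xs(3) tproj_diff[symmetric])
  ultimately have "?u (tproj (xs 0)) + 0 = step \<tau> Lm (1 - \<tau> * lam) ?u (tproj (xs 0)) v"
    by (simp add: step_def action_def xs(3))
  moreover have "0 \<le> 1 - \<tau> * lam" "1 - \<tau> * lam \<le> 1"
    using assms by auto
  ultimately show ?thesis
    using lax_eq_velocity[OF assms(1) _ _ u] by blast
qed

locale mfg_lagrangian =
  fixes L :: "'d::finite torus \<Rightarrow> real ^ 'd \<Rightarrow> real" and F :: "'d torus \<Rightarrow> 'd torus measure \<Rightarrow> real"
    and CL UL :: "real \<Rightarrow> real"
  assumes L: "tonelli L" and F: "coupling F"
    and lagr: "\<And>m. m \<in> borel_prob \<Longrightarrow> lagr (lag_at L F m) CL UL"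
begin

lemma lag_at_uniform_limit:
  assumes "limitin weak_star ms m sequentially" "e > 0"
  shows "\<forall>\<^sub>F n in sequentially. \<forall>X v. \<bar>lag_at L F (ms n) X v - lag_at L F m X v\<bar> \<le> e"
  using coupling_uniform_limit[OF F assms] by (simp add: lag_at_def)

text \<open>Changing the Lagrangian by at most \<open>e / 2\<close> changes the constant by at most
  \<open>e / 2\<close>, by comparison in both directions.\<close>

lemma effective_const_limit:
  assumes "\<tau> > 0" and ms: "\<And>n. ms n \<in> borel_prob" and lim: "limitin weak_star ms m sequentially"
  shows "(\<lambda>n. effective_const \<tau> (lag_at L F (ms n))) \<longlonglongrightarrow> effective_const \<tau> (lag_at L F m)"
proof (rule LIMSEQ_I)
  fix e :: real assume "e > 0"
  have m: "m \<in> borel_prob"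
    using lim by (simp add: limitin_def topspace_weak_star)
  obtain u where u: "lax_eq \<tau> (lag_at L F m) 1 (\<tau> * effective_const \<tau> (lag_at L F m)) u"
    using lagr.effective_const_solution[OF lagr[OF m] assms(1)] by blast
  have "\<forall>\<^sub>F n in sequentially. norm (effective_const \<tau> (lag_at L F (ms n)) - effective_const \<tau> (lag_at L F m)) < e"
    using lag_at_uniform_limit[OF lim half_gt_zero[OF \<open>e > 0\<close>]]
  proof eventually_elim
    case (elim n)
    obtain w where w: "lax_eq \<tau> (lag_at L F (ms n)) 1 (\<tau> * effective_const \<tau> (lag_at L F (ms n))) w"
      using lagr.effective_const_solution[OF lagr[OF ms] assms(1)] by blast
    have "lag_at L F m X v \<le> lag_at L F (ms n) X v + e / 2" for X v
      using elim[rule_format, of X v] by linarith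
    moreover have "lag_at L F (ms n) X v \<le> lag_at L F m X v + e / 2" for X v
      using elim[rule_format, of X v] by linarith
    ultimately have "effective_const \<tau> (lag_at L F m) \<le> effective_const \<tau> (lag_at L F (ms n)) + e / 2"
      "effective_const \<tau> (lag_at L F (ms n)) \<le> effective_const \<tau> (lag_at L F m) + e / 2"
      by (auto intro: lagr.constant_le[OF lagr[OF m] assms(1) u w] lagr.constant_le[OF lagr[OF ms] assms(1) w u])
    then show ?case
      using \<open>e > 0\<close> unfolding real_norm_def by linarith
  qed
  then show "\<exists>N. \<forall>n\<ge>N. norm (effective_const \<tau> (lag_at L F (ms n)) - effective_const \<tau> (lag_at L F m)) < e"
    by (simp add: eventually_sequentially)
qed

text \<open>Integrate the one-step inequality of an undiscounted solution: holonomy cancels both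
  terms containing \<open>u\<close>.\<close>

lemma holonomic_action_ge:
  assumes "\<tau> > 0" "m \<in> borel_prob" and \<nu>: "\<nu> \<in> holonomic \<tau>" "integrable \<nu> (\<lambda>(X, v). lag_at L F m X v)"
  shows "effective_const \<tau> (lag_at L F m) \<le> (\<integral>(X, v). lag_at L F m X v \<partial>\<nu>)"
proof -
  interpret prob_space \<nu>
    using borel_probD(1)[OF holonomicD(1)[OF \<nu>(1)]] .
  let ?k = "effective_const \<tau> (lag_at L F m)" and ?L = "\<lambda>z. lag_at L F m (fst z) (snd z)"
  obtain u where u: "lax_eq \<tau> (lag_at L F m) 1 (\<tau> * ?k) u"
    using lagr.effective_const_solution[OF lagr[OF assms(2)] assms(1)] by blast
  note cu = lax_eqD(1)[OF u]
  obtain B where B: "\<And>X. \<bar>u X\<bar> \<le> B"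
    using torus_bounded_range[OF cu] by metis
  have i1: "integrable \<nu> (\<lambda>z. u (fst z + tproj (\<tau> *\<^sub>R snd z)))"
    using B by (intro integrable_const_bound[of _ B] borel_prob_measurable[OF holonomicD(1)[OF \<nu>(1)]]
        continuous_on_compose2[OF cu] continuous_torus_shift continuous_intros) auto
  have i2: "integrable \<nu> (\<lambda>z. u (fst z))"
    using B by (intro integrable_const_bound[of _ B] borel_prob_measurable[OF holonomicD(1)[OF \<nu>(1)]]
        continuous_on_compose2[OF cu] continuous_intros) auto
  have i3: "integrable \<nu> ?L"
    using \<nu>(2) by (simp add: case_prod_unfold)
  have "(\<integral>z. u (fst z + tproj (\<tau> *\<^sub>R snd z)) + \<tau> * ?k \<partial>\<nu>) \<le> (\<integral>z. u (fst z) + \<tau> * ?L z \<partial>\<nu>)"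
    using lax_eq_forward[OF u] i1 i2 i3 by (intro integral_mono) auto
  then have "\<tau> * ?k \<le> \<tau> * (\<integral>z. ?L z \<partial>\<nu>)"
    using i1 i2 i3 holonomicD(2)[OF \<nu>(1) cu] by (simp add: prob_space)
  then show ?thesis
    using assms(1) by (simp add: case_prod_unfold)
qed

text \<open>The function \<open>lams n * u\<close> lies within \<open>lams n * B\<close> of the
  effective constant, so the discounted minimizing condition says that the action equals this
  constant up to an error tending to 0. The limit measure thus attains the lower bound of
  \<open>holonomic_action_ge\<close>.\<close>

lemma discounted_measure_limit:
  fixes \<mu>s :: "nat \<Rightarrow> ('d torus \<times> (real ^ 'd)) measure"
  assumes \<tau>: "\<tau> \<in> {0<..<1}" and lams: "\<And>n. lams n \<in> {0<..1}" "lams \<longlonglongrightarrow> 0"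
    and ms: "\<And>n. ms n \<in> borel_prob" "limitin weak_star ms m sequentially"
    and \<mu>s: "\<And>n. minimizing_discounted \<tau> (lams n) (lag_at L F (ms n)) (\<mu>s n)"
    and K: "compact K" "\<And>n. AE z in \<mu>s n. z \<in> K"
    and \<nu>: "\<nu> \<in> borel_prob" "AE z in \<nu>. z \<in> K"
    and lim: "\<And>f :: _ \<Rightarrow> real. continuous_on UNIV f \<Longrightarrow> (\<lambda>n. integral\<^sup>L (\<mu>s n) f) \<longlonglongrightarrow> integral\<^sup>L \<nu> f"
  shows "minimizing_holonomic \<tau> (lag_at L F m) \<nu>"
    and "(\<integral>(X, v). lag_at L F m X v \<partial>\<nu>) = effective_const \<tau> (lag_at L F m)"
proof -
  have m: "m \<in> borel_prob"
    using ms(2) by (simp add: limitin_def topspace_weak_star)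
  have \<tau>0: "\<tau> > 0"
    using \<tau> by simp
  have hol_n: "\<mu>s n \<in> holonomic \<tau>" for n
    using \<mu>s by (simp add: minimizing_discounted_def)
  then have hol: "\<nu> \<in> holonomic \<tau>"
    using holonomic_limit \<nu>(1) lim by blast
  note bp = holonomicD(1)[OF hol_n]
  have cL: "continuous_on UNIV (\<lambda>(X, v). lag_at L F m X v)" if "m \<in> borel_prob" for m
    using lagr.cont[OF lagr[OF that]] .
  have int: "integrable \<nu> (\<lambda>(X, v). lag_at L F m X v)"
    by (rule integrable_on_compact[OF \<nu>(1) K(1) \<nu>(2) cL[OF m]])
  define k where "k m = effective_const \<tau> (lag_at L F m)" for m
  define B where "B = \<tau> * lagr.osc_bound TYPE('d) CL UL \<tau>"
  have "(\<lambda>n. (\<integral>(X, v). lag_at L F m X v \<partial>\<mu>s n) - k (ms n)) \<longlonglongrightarrow> 0"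
  proof (rule LIMSEQ_I)
    fix e :: real assume "e > 0"
    have "(\<lambda>n. lams n * B) \<longlonglongrightarrow> 0 * B"
      by (intro tendsto_intros lams)
    then have "\<forall>\<^sub>F n in sequentially. lams n * B < e / 2"
      using \<open>e > 0\<close> order_tendstoD(2)[of _ _ _ "e / 2"] by fastforce
    then have "\<forall>\<^sub>F n in sequentially. norm ((\<integral>(X, v). lag_at L F m X v \<partial>\<mu>s n) - k (ms n) - 0) < e"
      using lag_at_uniform_limit[OF ms(2) half_gt_zero[OF \<open>e > 0\<close>]]
    proof eventually_elim
      case (elim n)
      interpret prob_space "\<mu>s n"
        by (rule borel_probD(1)[OF bp])
      interpret lm: lagr "lag_at L F (ms n)" CL UL
        by (rule lagr[OF ms(1)])
      let ?u = "discounted_solution \<tau> (lams n) (lag_at L F (ms n))"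
      have l: "lams n > 0" "\<tau> * lams n \<le> 1"
        using lams(1)[of n] \<tau> by (auto simp: mult_le_one)
      have u: "lax_eq \<tau> (lag_at L F (ms n)) (1 - \<tau> * lams n) 0 ?u"
        using lm.discounted_solution_iff[OF \<tau>0 l] by blast
      obtain w where w: "lax_eq \<tau> (lag_at L F (ms n)) 1 (\<tau> * k (ms n)) w"
        unfolding k_def using lm.effective_const_solution[OF \<tau>0] by blast
      have "\<bar>?u X - k (ms n) / lams n\<bar> \<le> B" for X
        using lm.discounted_close[OF \<tau>0 l u w lm.lax_eq_osc[OF \<tau>0 _ w]] by (simp add: B_def)
      then have "\<bar>lams n * (?u X - k (ms n) / lams n)\<bar> \<le> lams n * B" for X
        using l(1) by (simp add: abs_mult)
      then have uk: "\<bar>lams n * ?u X - k (ms n)\<bar> \<le> lams n * B" for X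
        using l(1) by (simp add: right_diff_distrib)
      have hb: "has_bochner_integral (\<mu>s n) (\<lambda>z. lag_at L F (ms n) (fst z) (snd z) - lams n * ?u (fst z)) 0"
        using \<mu>s[of n] by (simp add: minimizing_discounted_def case_prod_unfold)
      have i: "integrable (\<mu>s n) (\<lambda>z. lag_at L F m (fst z) (snd z))"
        using integrable_on_compact[OF bp K(1,2) cL[OF m]] by (simp add: case_prod_unfold)
      \<comment> \<open>The subtracted bracket integrates to 0 by the minimizing condition;
        inserting it pairs Lagrangian with Lagrangian and constant with \<open>lams n * ?u\<close>,
        so the integrand can be estimated pointwise.\<close>
      have "(\<integral>z. lag_at L F m (fst z) (snd z) \<partial>\<mu>s n) - k (ms n) =
          (\<integral>z. lag_at L F m (fst z) (snd z) - k (ms n) -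
            (lag_at L F (ms n) (fst z) (snd z) - lams n * ?u (fst z)) \<partial>\<mu>s n)"
        using i hb by (simp add: has_bochner_integral_iff prob_space)
      moreover have "norm (\<integral>z. lag_at L F m (fst z) (snd z) - k (ms n) -
            (lag_at L F (ms n) (fst z) (snd z) - lams n * ?u (fst z)) \<partial>\<mu>s n) \<le> (\<integral>z. e / 2 + lams n * B \<partial>\<mu>s n)"
      proof (rule order_trans[OF integral_norm_bound integral_mono])
        show "integrable (\<mu>s n) (\<lambda>z. norm (lag_at L F m (fst z) (snd z) - k (ms n) -
            (lag_at L F (ms n) (fst z) (snd z) - lams n * ?u (fst z))))"
          using i hb by (intro integrable_norm) (simp add: has_bochner_integral_iff)
        show "norm (lag_at L F m (fst z) (snd z) - k (ms n) -
            (lag_at L F (ms n) (fst z) (snd z) - lams n * ?u (fst z))) \<le> e / 2 + lams n * B" for z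
          using elim(2)[rule_format, of "fst z" "snd z"] uk[of "fst z"]
          unfolding real_norm_def by linarith
      qed simp
      ultimately have "norm ((\<integral>z. lag_at L F m (fst z) (snd z) \<partial>\<mu>s n) - k (ms n)) \<le> e / 2 + lams n * B"
        by (simp add: prob_space)
      then show ?case
        using elim(1) by (simp add: case_prod_unfold)
    qed
    then show "\<exists>N. \<forall>n\<ge>N. norm ((\<integral>(X, v). lag_at L F m X v \<partial>\<mu>s n) - k (ms n) - 0) < e"
      by (simp add: eventually_sequentially)
  qed
  moreover have "(\<lambda>n. k (ms n)) \<longlonglongrightarrow> k m"
    unfolding k_def by (rule effective_const_limit[OF \<tau>0 ms])
  ultimately have "(\<lambda>n. (\<integral>(X, v). lag_at L F m X v \<partial>\<mu>s n) - k (ms n) + k (ms n)) \<longlonglongrightarrow> 0 + k m"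
    by (rule tendsto_add)
  then have "(\<lambda>n. (\<integral>(X, v). lag_at L F m X v \<partial>\<mu>s n)) \<longlonglongrightarrow> k m"
    by simp
  then show val: "(\<integral>(X, v). lag_at L F m X v \<partial>\<nu>) = effective_const \<tau> (lag_at L F m)"
    using LIMSEQ_unique[OF lim[OF cL[OF m]]] by (simp add: k_def)
  show "minimizing_holonomic \<tau> (lag_at L F m) \<nu>"
    unfolding minimizing_holonomic_def val using hol int holonomic_action_ge[OF \<tau>0 m] by blast
qed

lemma discounted_support:
  fixes \<mu> :: "('d torus \<times> (real ^ 'd)) measure"
  assumes "\<tau> \<in> {0<..<1}" "lam \<in> {0<..1}" "m \<in> borel_prob"
    "minimizing_discounted \<tau> lam (lag_at L F m) \<mu>"
  shows "AE z in \<mu>. z \<in> UNIV \<times> cball 0 (lagr.osc_bound TYPE('d) CL UL \<tau> + UL 0 - CL 1)"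
proof -
  have "\<mu> \<in> borel_prob"
    using assms(4) by (simp add: minimizing_discounted_def holonomic_def)
  from AE_spt[OF this] show ?thesis
  proof eventually_elim
    case (elim z)
    have "\<tau> * lam \<le> 1"
      using assms by (auto intro: mult_le_one)
    then show ?case
      using lagr.spt_discounted_velocity[OF lagr[OF assms(3)], of \<tau> lam \<mu> "fst z" "snd z"] assms elim
      by (simp add: mem_Times_iff)
  qed
qed

text \<open>A first subsequence makes the phase-space measures converge and fixes \<open>m0\<close>;
  a second one makes the normalized solutions converge. By \<open>lax_eq_shift\<close> the latter
  solve an equation with constant \<open>\<tau> * k n\<close>, so stability applies with discount
  factor tending to 1.\<close>

lemma vanishing_discount_exists:
  assumes \<tau>: "\<tau> \<in> {0<..<1}"
    and mm: "\<And>lam. lam \<in> {0<..1} \<Longrightarrow> mm lam \<in> borel_prob \<and>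
      (\<exists>\<mu>. minimizing_discounted \<tau> lam (lag_at L F (mm lam)) \<mu> \<and> mm lam = distr \<mu> borel fst)"
  shows "\<exists>lams m0 u0. vanishing_discount_limit L F \<tau> mm lams m0 u0"
proof -
  have \<tau>0: "\<tau> > 0"
    using \<tau> by simp
  define l where "l n = inverse (real (Suc n))" for n
  have l: "l n \<in> {0<..1}" "l n > 0" "\<tau> * l n \<le> 1" for n
    using \<tau> by (auto simp: l_def inverse_le_1_iff intro!: mult_le_one)
  have l0: "l \<longlonglongrightarrow> 0"
    unfolding l_def by (rule LIMSEQ_inverse_real_of_nat)
  define ms where "ms n = mm (l n)" for n
  obtain \<mu>s where \<mu>s: "\<And>n. minimizing_discounted \<tau> (l n) (lag_at L F (ms n)) (\<mu>s n)"
      "\<And>n. ms n = distr (\<mu>s n) borel fst"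
    using mm[OF l(1)] unfolding ms_def by metis
  have ms: "ms n \<in> borel_prob" for n
    using mm[OF l(1)] by (simp add: ms_def)
  have bp: "\<mu>s n \<in> borel_prob" for n
    using \<mu>s(1)[of n] by (simp add: minimizing_discounted_def holonomic_def)
  define K :: "('d torus \<times> (real ^ 'd)) set" where
    "K = UNIV \<times> cball 0 (lagr.osc_bound TYPE('d) CL UL \<tau> + UL 0 - CL 1)"
  have K: "compact K" "AE z in \<mu>s n. z \<in> K" for n
    using discounted_support[OF \<tau> l(1) ms \<mu>s(1), of n]
    by (auto simp: K_def intro!: compact_Times compact_torus)
  obtain r \<nu> where r: "strict_mono (r :: nat \<Rightarrow> nat)" and \<nu>: "\<nu> \<in> borel_prob" "AE z in \<nu>. z \<in> K"
    and lim: "\<And>f :: _ \<Rightarrow> real. continuous_on UNIV f \<Longrightarrow> (\<lambda>n. integral\<^sup>L (\<mu>s (r n)) f) \<longlonglongrightarrow> integral\<^sup>L \<nu> f"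
    by (rule weak_compactness_on_compact[where \<mu>s = \<mu>s, OF bp K]) (rule that, auto)
  define m0 where "m0 = distr \<nu> borel fst"
  have m0: "m0 \<in> borel_prob"
    unfolding m0_def by (rule distr_fst_borel_prob(2)[OF \<nu>(1)])
  have mlim: "limitin weak_star (\<lambda>n. ms (r n)) m0 sequentially"
  proof (subst limitin_weak_star[OF ms], intro conjI m0 allI impI)
    fix f :: "'d torus \<Rightarrow> real" assume f: "continuous_on UNIV f"
    have "(\<lambda>n. \<integral>z. f (fst z) \<partial>\<mu>s (r n)) \<longlonglongrightarrow> (\<integral>z. f (fst z) \<partial>\<nu>)"
      by (rule lim) (intro continuous_on_compose2[OF f] continuous_intros, auto)
    then show "(\<lambda>n. integral\<^sup>L (ms (r n)) f) \<longlonglongrightarrow> integral\<^sup>L m0 f"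
      using integral_distr_fst[OF bp f] integral_distr_fst[OF \<nu>(1) f] by (simp add: \<mu>s(2) m0_def)
  qed
  have lr0: "(\<lambda>n. l (r n)) \<longlonglongrightarrow> 0"
    using LIMSEQ_subseq_LIMSEQ[OF l0 r] by (simp add: o_def)
  have min: "minimizing_holonomic \<tau> (lag_at L F m0) \<nu>"
    by (rule discounted_measure_limit(1)[OF \<tau> l(1) lr0 ms mlim \<mu>s(1) K(1) K(2) \<nu> lim])
  define k where "k n = effective_const \<tau> (lag_at L F (ms n))" for n
  define u where "u n = discounted_solution \<tau> (l n) (lag_at L F (ms n))" for n
  define v where "v n X = u n X - k n / l n" for n X
  have \<beta>: "0 \<le> 1 - \<tau> * l n" "1 - \<tau> * l n \<le> 1" for n
    using l[of n] \<tau>0 by (auto intro: less_imp_le)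
  have u: "lax_eq \<tau> (lag_at L F (ms n)) (1 - \<tau> * l n) 0 (u n)" for n
    unfolding u_def using lagr.discounted_solution_iff[OF lagr[OF ms] \<tau>0 l(2,3)] by blast
  have v: "lax_eq \<tau> (lag_at L F (ms n)) (1 - \<tau> * l n) (\<tau> * k n) (v n)" for n
    using lax_eq_shift[OF u[of n], of "k n / l n"] l(2)[of n] by (simp add: v_def[abs_def])
  have vb: "\<bar>v n X\<bar> \<le> \<tau> * lagr.osc_bound TYPE('d) CL UL \<tau>" for n X
  proof -
    interpret lm: lagr "lag_at L F (ms n)" CL UL
      by (rule lagr[OF ms])
    obtain w where w: "lax_eq \<tau> (lag_at L F (ms n)) 1 (\<tau> * k n) w"
      unfolding k_def using lm.effective_const_solution[OF \<tau>0] by blast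
    show ?thesis
      unfolding v_def by (rule lm.discounted_close[OF \<tau>0 l(2,3) u w lm.lax_eq_osc[OF \<tau>0 _ w]]) simp
  qed
  define C where "C = \<bar>UL (lagr.osc_bound TYPE('d) CL UL \<tau> + UL 0 - CL 1 + 1)\<bar> + 1"
  have vl: "\<bar>v n X - v n Y\<bar> \<le> C * dist X Y" for n X Y
  proof -
    have "\<bar>v n X - v n Y\<bar> \<le> UL (lagr.osc_bound TYPE('d) CL UL \<tau> + UL 0 - CL 1 + 1) * dist X Y"
      by (rule lagr.lax_eq_lipschitz[OF lagr[OF ms] \<tau>0 \<beta> v])
    also have "\<dots> \<le> C * dist X Y"
      by (intro mult_right_mono) (auto simp: C_def)
    finally show ?thesis .
  qed
  have "\<exists>d>0. \<forall>n X Y. dist X Y < d \<longrightarrow> \<bar>v (r n) X - v (r n) Y\<bar> < e" if "e > 0" for e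
    using that vl by (intro exI[of _ "e / C"]) (auto simp: C_def field_simps intro: le_less_trans)
  then obtain s u0 where s: "strict_mono (s :: nat \<Rightarrow> nat)" "continuous_on UNIV u0"
    "uniform_limit UNIV (\<lambda>n. v (r (s n))) u0 sequentially"
    using Arzela_Ascoli_torus[of "\<lambda>n. v (r n)"] vb by metis
  have mlim': "limitin weak_star (\<lambda>n. ms (r (s n))) m0 sequentially"
    using limitin_subsequence[OF s(1) mlim] by (simp add: o_def)
  have ls0: "(\<lambda>n. l (r (s n))) \<longlonglongrightarrow> 0"
    using LIMSEQ_subseq_LIMSEQ[OF lr0 s(1)] by (simp add: o_def)
  have "lax_eq \<tau> (lag_at L F m0) 1 (\<tau> * effective_const \<tau> (lag_at L F m0)) u0"
  proof (rule lax_eq_limit[OF lagr[OF m0] \<tau>0])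
    show "(\<lambda>n. 1 - \<tau> * l (r (s n))) \<longlonglongrightarrow> 1"
      using tendsto_diff[OF tendsto_const tendsto_mult_left[OF ls0], of 1 \<tau>] by simp
    show "(\<lambda>n. \<tau> * k (r (s n))) \<longlonglongrightarrow> \<tau> * effective_const \<tau> (lag_at L F m0)"
      unfolding k_def by (intro tendsto_intros effective_const_limit[OF \<tau>0 ms mlim'])
    show "\<forall>\<^sub>F n in sequentially. \<forall>X v. \<bar>lag_at L F (ms (r (s n))) X v - lag_at L F m0 X v\<bar> \<le> e" if "e > 0" for e
      by (rule lag_at_uniform_limit[OF mlim' that])
  qed (use v s in auto)
  then have "lax_oleinik_solution \<tau> (lag_at L F m0) (effective_const \<tau> (lag_at L F m0)) u0"
    using lagr.lax_oleinik_iff[OF lagr[OF m0] \<tau>0] by blast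
  moreover have "MFG_minimizing_holonomic \<tau> L F m0"
    unfolding MFG_minimizing_holonomic_def using m0 min m0_def by blast
  moreover have "v = (\<lambda>n X. discounted_solution \<tau> (l n) (lag_at L F (mm (l n))) X
      - effective_const \<tau> (lag_at L F (mm (l n))) / l n)"
    by (simp add: fun_eq_iff v_def u_def k_def ms_def)
  ultimately have "vanishing_discount_limit L F \<tau> mm (\<lambda>n. l (r (s n))) m0 u0"
    unfolding vanishing_discount_limit_def
    using l(1) ls0 mlim' s(3) by (auto simp: ms_def)
  then show ?thesis
    by blast
qed

end

section \<open>Duality, viscosity solutions and gradients\<close>

subsection \<open>Convex duality\<close>

text \<open>Positive definiteness of the second derivative makes the derivative
  \<open>\<psi>\<close> along the segment nondecreasing; the mean value theorem then puts the graph
  above its tangent plane.\<close>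

lemma tonelli_tangent:
  assumes "tonelli G"
  shows "G X p + inner (q - p) (grad (G X) p) \<le> G X q"
proof -
  define \<phi> where "\<phi> t = G X (p + t *\<^sub>R (q - p))" for t :: real
  define \<psi> where "\<psi> t = inner (q - p) (grad (G X) (p + t *\<^sub>R (q - p)))" for t :: real
  have line: "((\<lambda>t :: real. p + t *\<^sub>R (q - p)) has_derivative (\<lambda>s. s *\<^sub>R (q - p))) (at t)" for t
    by (auto intro!: derivative_eq_intros)
  have d\<phi>: "DERIV \<phi> t :> \<psi> t" for t
  proof -
    have "(\<phi> has_derivative (\<lambda>s. inner (s *\<^sub>R (q - p)) (grad (G X) (p + t *\<^sub>R (q - p))))) (at t)"
      unfolding \<phi>_def
      using has_derivative_compose[OF line] tonelli_grad(1)[OF assms] unfolding gderiv_def by blast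
    then show ?thesis
      unfolding has_field_derivative_def \<psi>_def by (simp add: mult_commute_abs)
  qed
  have "\<exists>D. DERIV \<psi> t :> D \<and> 0 \<le> D" for t
  proof -
    obtain A where A: "(grad (G X) has_derivative A) (at (p + t *\<^sub>R (q - p)))" "\<And>h. h \<noteq> 0 \<Longrightarrow> inner (A h) h > 0"
      using assms unfolding tonelli_def by blast
    interpret A: bounded_linear A
      using A(1) by (rule has_derivative_bounded_linear)
    have "((\<lambda>t. grad (G X) (p + t *\<^sub>R (q - p))) has_derivative (\<lambda>s. A (s *\<^sub>R (q - p)))) (at t)"
      using has_derivative_compose[OF line A(1)] .
    then have "(\<psi> has_derivative (\<lambda>s. inner (q - p) (A (s *\<^sub>R (q - p))))) (at t)"
      unfolding \<psi>_def by (rule has_derivative_inner_right)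
    then have "DERIV \<psi> t :> inner (q - p) (A (q - p))"
      unfolding has_field_derivative_def by (simp add: A.scaleR mult_commute_abs)
    moreover have "0 \<le> inner (q - p) (A (q - p))"
      using A(2)[of "q - p"] by (cases "q - p = 0") (auto simp: inner_commute)
    ultimately show ?thesis
      by blast
  qed
  then have mono: "\<psi> 0 \<le> \<psi> t" if "0 \<le> t" for t
    using DERIV_nonneg_imp_nondecreasing[OF that] by blast
  obtain t where t: "0 < t" "t < 1" "\<phi> 1 - \<phi> 0 = (1 - 0) * \<psi> t"
    using MVT2[of 0 1 \<phi> \<psi>] d\<phi> by auto
  then show ?thesis
    using mono[of t] by (simp add: \<phi>_def \<psi>_def)
qed

lemma lagrangian_young:
  assumes "tonelli H"
  shows "inner p v \<le> lagrangian H X v + H X p"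
proof -
  obtain C where C: "\<And>K X p. K > 0 \<Longrightarrow> K * norm p + C K \<le> H X p"
    using tonelli_superlinear[OF assms] by blast
  \<comment> \<open>The supremum defining the Lagrangian is informative only for a bounded set; the
    slope \<open>norm v + 1\<close> beats the linear term.\<close>
  have "bdd_above (range (\<lambda>p. inner p v - H X p))"
  proof (rule bdd_aboveI2)
    fix p
    have "(norm v + 1) * norm p + C (norm v + 1) \<le> H X p"
      by (rule C) (simp add: add_nonneg_pos)
    moreover have "inner p v \<le> norm p * norm v"
      by (rule norm_cauchy_schwarz)
    moreover have "(norm v + 1) * norm p = norm p * norm v + norm p"
      by (simp add: algebra_simps)
    ultimately show "inner p v - H X p \<le> - C (norm v + 1)"
      using norm_ge_zero[of p] by linarith
  qed
  then have "inner p v - H X p \<le> lagrangian H X v"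
    unfolding lagrangian_def by (intro cSUP_upper) auto
  then show ?thesis
    by simp
qed

lemma lagrangian_attained:
  assumes "tonelli H"
  shows "lagrangian H X (grad (H X) p) + H X p = inner p (grad (H X) p)"
proof -
  have "lagrangian H X (grad (H X) p) \<le> inner p (grad (H X) p) - H X p"
    unfolding lagrangian_def
    using tonelli_tangent[OF assms, of X p] by (intro cSUP_least) (auto simp: inner_diff_left algebra_simps)
  then show ?thesis
    using lagrangian_young[OF assms, of p "grad (H X) p" X] by simp
qed

text \<open>Equality in Young's inequality makes \<open>p\<close> a minimum point of
  \<open>H X q - inner q v\<close> in \<open>q\<close>, where the gradient vanishes.\<close>

lemma lagrangian_equality:
  assumes "tonelli H" "lagrangian H X v + H X p \<le> inner p v"
  shows "v = grad (H X) p"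
proof -
  have "((\<lambda>q. H X q - inner q v) has_derivative (\<lambda>h. inner h (grad (H X) p) - inner h v)) (at p)"
    using tonelli_grad(1)[OF assms(1), of X p] unfolding gderiv_def by (auto intro!: derivative_eq_intros)
  moreover have "\<forall>\<^sub>F q in at p. H X p - inner p v \<le> H X q - inner q v"
  proof (intro always_eventually allI)
    fix q
    show "H X p - inner p v \<le> H X q - inner q v"
      using assms(2) lagrangian_young[OF assms(1), of q v X] by linarith
  qed
  ultimately have "(\<lambda>h. inner h (grad (H X) p) - inner h v) = (\<lambda>h. 0)"
    by (rule has_derivative_local_min)
  then have "inner (grad (H X) p - v) (grad (H X) p) - inner (grad (H X) p - v) v = 0"
    by (rule fun_cong)
  then have "inner (grad (H X) p - v) (grad (H X) p - v) = 0"
    by (simp add: inner_diff_right)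
  then show ?thesis
    by simp
qed

subsection \<open>Uniqueness of the critical value\<close>

lemma quadratic_C_k:
  fixes y :: "'a::euclidean_space"
  shows "GDERIV (\<lambda>x. c * (norm (x - y))\<^sup>2) x :> (2 * c) *\<^sub>R (x - y)" "C_k 1 (\<lambda>x. c * (norm (x - y))\<^sup>2)"
proof -
  have "((\<lambda>x. c * inner (x - y) (x - y)) has_derivative (\<lambda>h. inner h ((2 * c) *\<^sub>R (x - y)))) (at x)" for x
    by (auto intro!: derivative_eq_intros simp: inner_commute algebra_simps)
  then show *: "GDERIV (\<lambda>x. c * (norm (x - y))\<^sup>2) x :> (2 * c) *\<^sub>R (x - y)" for x
    by (simp add: gderiv_def power2_norm_eq_inner)
  show "C_k 1 (\<lambda>x. c * (norm (x - y))\<^sup>2)"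
    unfolding One_nat_def C_k.simps
    by (intro exI[of _ "\<lambda>x. (2 * c) *\<^sub>R (x - y)"] conjI allI ballI * continuous_intros)
qed

text \<open>Doubling of variables; no Lipschitz estimate is needed, because the coercivity of \<open>G\<close> bounds
  the gradients of the penalization.\<close>

lemma viscosity_constant_le:
  fixes G :: "'d::finite torus \<Rightarrow> real ^ 'd \<Rightarrow> real"
  assumes cG: "continuous_on UNIV (\<lambda>(X, p). G X p)" and coer: "\<And>X p. norm p + C \<le> G X p"
    and u1: "viscosity_solution G k1 u1" and u2: "viscosity_solution G k2 u2"
  shows "k2 \<le> k1"
proof (rule field_le_epsilon)
  fix e :: real assume "e > 0"
  have c1: "continuous_on UNIV u1" and c2: "continuous_on UNIV u2"
    using u1 u2 by (auto simp: viscosity_solution_def)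
  obtain B where B: "\<And>X. \<bar>u2 X\<bar> \<le> B" "0 \<le> B"
    using torus_bounded_range[OF c2] by blast
  have "uniformly_continuous_on (UNIV \<times> cball 0 (k1 - C)) (\<lambda>(X, p). G X p)"
    by (intro compact_uniformly_continuous continuous_on_subset[OF cG] compact_Times compact_torus compact_cball) auto
  then obtain d where d: "d > 0" and dG: "\<And>z z'. z \<in> UNIV \<times> cball 0 (k1 - C) \<Longrightarrow> z' \<in> UNIV \<times> cball 0 (k1 - C) \<Longrightarrow>
      dist z' z < d \<Longrightarrow> dist (case z' of (X, p) \<Rightarrow> G X p) (case z of (X, p) \<Rightarrow> G X p) < e"
    using \<open>e > 0\<close> unfolding uniformly_continuous_on_def by metis
  \<comment> \<open>With this weight a maximizer satisfies
    \<open>c * (norm h)\<^sup>2 \<le> 2 * B < c * d\<^sup>2\<close>, so its two points are closer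
    than the modulus \<open>d\<close> of \<open>G\<close>.\<close>
  define c where "c = (2 * B + 1) / d\<^sup>2"
  have c: "c > 0" "2 * B < c * d\<^sup>2"
    using B(2) d by (auto simp: c_def)
  define r where "r = sqrt (2 * B / c)"
  have r: "0 \<le> r" "c * r\<^sup>2 = 2 * B"
    using B(2) c(1) by (auto simp: r_def)
  \<comment> \<open>The second point is encoded by its displacement \<open>h\<close> from the first:
    the penalty is then a smooth function of a vector, unlike the squared torus distance.\<close>
  define \<Phi> where "\<Phi> z = u1 (fst z) - u2 (fst z + tproj (snd z)) - c * (norm (snd z))\<^sup>2" for z
  have "continuous_on (UNIV \<times> cball 0 r) \<Phi>"
    unfolding \<Phi>_def
    by (intro continuous_intros continuous_on_compose2[OF c1] continuous_on_compose2[OF c2] continuous_torus_shift) auto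
  moreover have "compact (UNIV \<times> cball 0 r :: ('d torus \<times> (real ^ 'd)) set)"
    by (intro compact_Times compact_torus compact_cball)
  ultimately obtain z where z: "z \<in> UNIV \<times> cball 0 r" "\<And>w. w \<in> UNIV \<times> cball 0 r \<Longrightarrow> \<Phi> w \<le> \<Phi> z"
    using continuous_attains_sup[of "UNIV \<times> cball 0 r :: ('d torus \<times> (real ^ 'd)) set" \<Phi>] r(1) by auto
  have max: "\<Phi> (Y, h) \<le> \<Phi> z" for Y h
  proof (cases "h \<in> cball 0 r")
    case False
    then have "r\<^sup>2 \<le> (norm h)\<^sup>2"
      using r(1) by (intro power_mono) auto
    then have "2 * B \<le> c * (norm h)\<^sup>2"
      using r(2) c(1) by (metis mult_left_mono less_imp_le)
    then have "\<Phi> (Y, h) \<le> \<Phi> (Y, 0)"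
      using B(1)[of Y] B(1)[of "Y + tproj h"] by (simp add: \<Phi>_def abs_le_iff)
    also have "\<dots> \<le> \<Phi> z"
      using z(2) r(1) by simp
    finally show ?thesis .
  qed (use z(2) in auto)
  obtain X h where zXh: "z = (X, h)"
    by (cases z) auto
  obtain x where x: "tproj x = X"
    using tproj_surj by blast
  \<comment> \<open>The common gradient of the two quadratic test functions, touching
    \<open>u1\<close> from above and \<open>u2\<close> from below.\<close>
  define p where "p = (- (2 * c)) *\<^sub>R h"
  have "G (tproj x) (grad (\<lambda>x'. c * (norm (x' - (x + h)))\<^sup>2) x) \<le> k1"
  proof -
    have "u1 (tproj y) - c * (norm (y - (x + h)))\<^sup>2 \<le> u1 (tproj x) - c * (norm (x - (x + h)))\<^sup>2" for y
      using max[of "tproj y" "x + h - y"] x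
      by (simp add: zXh \<Phi>_def tproj_add tproj_diff norm_minus_commute)
    then show ?thesis
      using u1 quadratic_C_k(2) unfolding viscosity_solution_def by (blast intro: always_eventually)
  qed
  then have G1: "G X p \<le> k1"
    using grad_eqI[OF quadratic_C_k(1)[of c "x + h" x]] x by (simp add: p_def)
  have "G (tproj (x + h)) (grad (\<lambda>y'. (- c) * (norm (y' - x))\<^sup>2) (x + h)) \<ge> k2"
  proof -
    have "u2 (tproj y) - (- c) * (norm (y - x))\<^sup>2 \<ge> u2 (tproj (x + h)) - (- c) * (norm (x + h - x))\<^sup>2" for y
      using max[of X "y - x"] x by (simp add: zXh \<Phi>_def tproj_add tproj_diff)
    then show ?thesis
      using u2 quadratic_C_k(2) unfolding viscosity_solution_def by (blast intro: always_eventually)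
  qed
  then have G2: "k2 \<le> G (X + tproj h) p"
    using grad_eqI[OF quadratic_C_k(1)[of "- c" x "x + h"]] x by (simp add: p_def tproj_add)
  have p: "norm p \<le> k1 - C"
    using G1 coer[of p X] by linarith
  have "\<Phi> (X, 0) \<le> \<Phi> (X, h)"
    using max zXh by simp
  then have "c * (norm h)\<^sup>2 \<le> 2 * B"
    using B(1)[of X] B(1)[of "X + tproj h"] by (simp add: \<Phi>_def abs_le_iff)
  then have "c * (norm h)\<^sup>2 < c * d\<^sup>2"
    using c(2) by linarith
  then have "(norm h)\<^sup>2 < d\<^sup>2"
    using c(1) by simp
  then have "norm h < d"
    using d by (meson less_imp_le power_less_imp_less_base)
  then have "dist (X + tproj h, p) (X, p) < d"
    using dist_torus_add_le[of X h] by (simp add: dist_Pair_Pair)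
  then have "dist (G (X + tproj h) p) (G X p) < e"
    using dG[of "(X, p)" "(X + tproj h, p)"] p by simp
  then show "k2 \<le> k1 + e"
    using G1 G2 by (simp add: dist_real_def abs_less_iff)
qed

lemma mane_value_eqI:
  fixes G :: "'d::finite torus \<Rightarrow> real ^ 'd \<Rightarrow> real"
  assumes "continuous_on UNIV (\<lambda>(X, p). G X p)" "\<And>X p. norm p + C \<le> G X p" "viscosity_solution G k u"
  shows "mane_value G = k"
  unfolding mane_value_def
  using viscosity_constant_le[OF assms(1,2)] assms(3) by (blast intro: order_antisym)

subsection \<open>First-order expansions\<close>

lemma torus_expansion:
  fixes f :: "'d::finite torus \<Rightarrow> real"
  assumes "\<And>x. GDERIV (\<lambda>x. f (tproj x)) x :> Df (tproj x)"
    and "\<And>X Y. dist X Y \<le> d \<Longrightarrow> norm (Df X - Df Y) \<le> e" and "norm h \<le> d"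
  shows "\<bar>f (X + tproj h) - f X - inner h (Df X)\<bar> \<le> e * norm h"
proof -
  obtain x where x: "tproj x = X"
    using tproj_surj by blast
  have "\<bar>f (tproj (x + h)) - f (tproj x) - inner h (Df (tproj x))\<bar> \<le> e * norm h"
  proof (rule gradient_mean_value[where f = "\<lambda>x. f (tproj x)" and g = "\<lambda>x. Df (tproj x)", OF assms(1)])
    fix t :: real assume t: "t \<in> {0..1}"
    have "dist (tproj (x + t *\<^sub>R h)) (tproj x) \<le> norm (t *\<^sub>R h)"
      using dist_tproj_le[of "x + t *\<^sub>R h" x] by (simp add: dist_norm)
    also have "\<dots> \<le> d"
      using t assms(3) mult_left_le_one_le[of "norm h" t] by simp
    finally show "norm (Df (tproj (x + t *\<^sub>R h)) - Df (tproj x)) \<le> e"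
      by (rule assms(2))
  qed
  then show ?thesis
    by (simp add: x tproj_add)
qed

lemma torus_C_k_expansion:
  fixes f :: "'d::finite torus \<Rightarrow> real"
  assumes "C_k (Suc k) (\<lambda>x. f (tproj x))" "e > 0"
  obtains d where "d > 0" "\<And>X h. norm h \<le> d \<Longrightarrow> \<bar>f (X + tproj h) - f X - inner h (torus_grad f X)\<bar> \<le> e * norm h"
proof -
  have "uniformly_continuous_on UNIV (torus_grad f)"
    using torus_grad_C_k(2)[OF assms(1)] compact_torus by (rule compact_uniformly_continuous)
  then obtain d where d: "d > 0" "\<And>X Y. dist Y X < d \<Longrightarrow> dist (torus_grad f Y) (torus_grad f X) < e"
    using assms(2) unfolding uniformly_continuous_on_def by (metis UNIV_I)
  have "\<bar>f (X + tproj h) - f X - inner h (torus_grad f X)\<bar> \<le> e * norm h" if "norm h \<le> d / 2" for X h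
    using torus_grad_C_k(1)[OF assms(1)]
  proof (rule torus_expansion[where d = "d / 2"])
    show "norm (torus_grad f X - torus_grad f Y) \<le> e" if "dist X Y \<le> d / 2" for X Y
      using d(2)[of X Y] d(1) that by (simp add: dist_norm)
  qed (rule that)
  then show ?thesis
    using that[of "d / 2"] d(1) by simp
qed

text \<open>The part from \<open>L\<close> is uniform because its gradient is uniformly continuous
  on a compact box of lifts, the part from \<open>F\<close> because of the common modulus of its
  gradients. The lifts chosen by \<open>l\<close> may be discontinuous, since the coefficients
  \<open>gx\<close> and \<open>gv\<close> are only required to be bounded.\<close>

lemma (in mfg_lagrangian) lag_at_expansion:
  obtains \<Lambda> gx gv \<delta> where
    "\<And>m X v. m \<in> borel_prob \<Longrightarrow> norm v \<le> R \<Longrightarrow> norm (gx m X v :: real ^ 'd) \<le> \<Lambda>"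
    "\<And>m X v. m \<in> borel_prob \<Longrightarrow> norm v \<le> R \<Longrightarrow> norm (gv m X v :: real ^ 'd) \<le> \<Lambda>"
    "\<And>e. e > 0 \<Longrightarrow> \<delta> e > 0"
    "\<And>e m X v h w. e > 0 \<Longrightarrow> m \<in> borel_prob \<Longrightarrow> norm v \<le> R \<Longrightarrow> norm h \<le> \<delta> e \<Longrightarrow> norm w \<le> \<delta> e \<Longrightarrow>
      \<bar>lag_at L F m (X + tproj h) (v + w) - lag_at L F m X v - inner h (gx m X v) - inner w (gv m X v)\<bar>
        \<le> e * (norm h + norm w)"
proof -
  obtain g where g: "\<And>z. GDERIV (\<lambda>(x, p). L (tproj x) p) z :> g z" "continuous_on UNIV g"
    using tonelli_gradient[OF L] by metis
  obtain l where l: "\<And>X. l X \<in> cbox 0 (1 :: real ^ 'd)" "\<And>X :: 'd torus. tproj (l X) = X"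
    using torus_lift_cbox by metis
  obtain D where D: "\<And>x. x \<in> cbox 0 (1 :: real ^ 'd) \<Longrightarrow> norm x \<le> D"
    using bounded_cbox[of 0 "1 :: real ^ 'd"] by (auto simp: bounded_iff)
  define K where "K = cball (0 :: real ^ 'd) (D + 1) \<times> cball (0 :: real ^ 'd) (R + 1)"
  have K: "compact K" "convex K"
    by (auto simp: K_def intro!: compact_Times convex_Times)
  obtain B where B: "\<And>m X. m \<in> borel_prob \<Longrightarrow> norm (torus_grad (\<lambda>Y. F Y m) X) \<le> B" "0 < B"
    using coupling_bounded[OF F] by metis
  have "bounded (g ` K)"
    by (intro compact_imp_bounded compact_continuous_image K continuous_on_subset[OF g(2)]) auto
  then obtain E where E: "\<And>z. z \<in> K \<Longrightarrow> norm (g z) \<le> E"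
    by (auto simp: bounded_iff)
  have lK: "(l X, v) \<in> K" if "norm v \<le> R" for X v
    using D[OF l(1)[of X]] that by (auto simp: K_def mem_Times_iff)
  have "\<exists>d. d > 0 \<and> (\<forall>m X v h w. m \<in> borel_prob \<longrightarrow> norm v \<le> R \<longrightarrow> norm h \<le> d \<longrightarrow> norm w \<le> d \<longrightarrow>
      \<bar>lag_at L F m (X + tproj h) (v + w) - lag_at L F m X v -
        inner h (fst (g (l X, v)) + torus_grad (\<lambda>Y. F Y m) X) - inner w (snd (g (l X, v)))\<bar>
        \<le> e * (norm h + norm w))" if e: "e > 0" for e
  proof -
    have e2: "e / 2 > 0"
      using e by simp
    obtain d1 where d1: "d1 > 0" "\<And>z k. z \<in> K \<Longrightarrow> z + k \<in> K \<Longrightarrow> norm k \<le> d1 \<Longrightarrow>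
        \<bar>(\<lambda>(x, p). L (tproj x) p) (z + k) - (\<lambda>(x, p). L (tproj x) p) z - inner k (g z)\<bar> \<le> e / 2 * norm k"
      using gradient_expansion[OF g K e2] by blast
    obtain d2 where d2: "d2 > 0" "\<And>m X Y. m \<in> borel_prob \<Longrightarrow> dist X Y \<le> d2 \<Longrightarrow>
        norm (torus_grad (\<lambda>Z. F Z m) X - torus_grad (\<lambda>Z. F Z m) Y) \<le> e / 2"
      using coupling_gradient_modulus[OF F e2] by blast
    \<comment> \<open>\<open>d1 / 2\<close> makes the pair norm of \<open>(h, w)\<close> at most
      \<open>d1\<close>, the bound 1 keeps the perturbed point in the enlarged box \<open>K\<close>,
      and \<open>d2\<close> controls the gradient of the coupling.\<close>
    define d where "d = min (min (d1 / 2) 1) d2"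
    have d: "d > 0" "2 * d \<le> d1" "d \<le> 1" "d \<le> d2"
      using d1 d2 by (auto simp: d_def)
    have "\<bar>lag_at L F m (X + tproj h) (v + w) - lag_at L F m X v -
        inner h (fst (g (l X, v)) + torus_grad (\<lambda>Y. F Y m) X) - inner w (snd (g (l X, v)))\<bar> \<le> e * (norm h + norm w)"
      if *: "m \<in> borel_prob" "norm v \<le> R" "norm h \<le> d" "norm w \<le> d" for m X v h w
    proof -
      have nhw: "norm (h, w) \<le> norm h + norm w"
        by (rule norm_Pair_le)
      have "norm (l X + h) \<le> D + 1"
        using norm_triangle_ineq[of "l X" h] D[OF l(1)[of X]] *(3) d(3) by linarith
      moreover have "norm (v + w) \<le> R + 1"
        using norm_triangle_ineq[of v w] *(2,4) d(3) by linarith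
      ultimately have mem: "(l X, v) + (h, w) \<in> K"
        by (simp add: K_def)
      have "norm (h, w) \<le> d1"
        using nhw *(3,4) d(2) by linarith
      from d1(2)[OF lK[OF *(2)] mem this]
      have "\<bar>L (tproj (l X + h)) (v + w) - L (tproj (l X)) v - inner (h, w) (g (l X, v))\<bar> \<le> e / 2 * norm (h, w)"
        by simp
      also have "\<dots> \<le> e / 2 * (norm h + norm w)"
        using nhw e2 by (intro mult_left_mono) auto
      finally have 1: "\<bar>L (X + tproj h) (v + w) - L X v - (inner h (fst (g (l X, v))) + inner w (snd (g (l X, v))))\<bar>
          \<le> e / 2 * (norm h + norm w)"
        by (simp add: tproj_add l(2) inner_prod_def)
      have 2: "\<bar>F (X + tproj h) m - F X m - inner h (torus_grad (\<lambda>Y. F Y m) X)\<bar> \<le> e / 2 * norm h"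
        using *(3) d(4)
        by (intro torus_expansion[where f = "\<lambda>X. F X m" and d = d2, OF coupling_GDERIV(1)[OF F *(1)] d2(2)[OF *(1)]]) auto
      have 3: "e / 2 * (norm h + norm w) + e / 2 * norm h \<le> e * (norm h + norm w)"
        using mult_nonneg_nonneg[OF less_imp_le[OF e] norm_ge_zero[of w]] by (simp add: algebra_simps add_divide_distrib)
      show ?thesis
        using 1 2 3 unfolding lag_at_def inner_add_right by linarith
    qed
    then show ?thesis
      using d(1) by blast
  qed
  then obtain \<delta> where \<delta>: "\<And>e. e > 0 \<Longrightarrow> \<delta> e > 0" "\<And>e m X v h w. e > 0 \<Longrightarrow> m \<in> borel_prob \<Longrightarrow> norm v \<le> R \<Longrightarrow>
      norm h \<le> \<delta> e \<Longrightarrow> norm w \<le> \<delta> e \<Longrightarrow> \<bar>lag_at L F m (X + tproj h) (v + w) - lag_at L F m X v -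
        inner h (fst (g (l X, v)) + torus_grad (\<lambda>Y. F Y m) X) - inner w (snd (g (l X, v)))\<bar>
        \<le> e * (norm h + norm w)"
    by metis
  show ?thesis
  proof (rule that[of "\<lambda>m X v. fst (g (l X, v)) + torus_grad (\<lambda>Y. F Y m) X" "E + B" "\<lambda>m X v. snd (g (l X, v))" \<delta>])
    show "norm (fst (g (l X, v)) + torus_grad (\<lambda>Y. F Y m) X) \<le> E + B" if "m \<in> borel_prob" "norm v \<le> R" for m X v
      using E[OF lK[OF that(2)], of X] B(1)[OF that(1), of X] norm_fst_le[of "fst (g (l X, v))" "snd (g (l X, v))"]
        norm_triangle_ineq[of "fst (g (l X, v))" "torus_grad (\<lambda>Y. F Y m) X"] by (simp del: norm_triangle_ineq)
    show "norm (snd (g (l X, v))) \<le> E + B" if "norm v \<le> R" for X v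
      using E[OF lK[OF that], of X] B(2) norm_snd_le[of "snd (g (l X, v))" "fst (g (l X, v))"] by simp
  qed (use \<delta> in auto)
qed

subsection \<open>Measurability of the gradient\<close>

lemma torus_gderiv_iff:
  "torus_gderiv u X p \<longleftrightarrow>
    (\<forall>e>0. \<exists>d>0. \<forall>h. norm h < d \<longrightarrow> \<bar>u (X + tproj h) - u X - inner h p\<bar> \<le> e * norm h)"
proof -
  obtain x where x: "tproj x = X"
    using tproj_surj by blast
  have "torus_gderiv u X p \<longleftrightarrow> (GDERIV (\<lambda>y. u (tproj y)) x :> p)"
    using torus_gderiv_tproj[of u x p] x by (auto simp: torus_gderiv_def)
  also have "\<dots> \<longleftrightarrow> (\<forall>e>0. \<exists>d>0. \<forall>y. norm (y - x) < d \<longrightarrow>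
      norm (u (tproj y) - u (tproj x) - inner (y - x) p) \<le> e * norm (y - x))"
    unfolding gderiv_def has_derivative_at_alt using bounded_linear_inner_left by blast
  also have "\<dots> \<longleftrightarrow> (\<forall>e>0. \<exists>d>0. \<forall>h. norm h < d \<longrightarrow>
      norm (u (tproj (x + h)) - u (tproj x) - inner h p) \<le> e * norm h)"
    by (smt (verit) add_diff_cancel_left' diff_add_cancel add.commute)
  finally show ?thesis
    by (simp add: tproj_add x)
qed

text \<open>Differentiability at \<open>X\<close> means that for every tolerance some vector of a
  countable dense set is an approximate gradient on some ball. For fixed tolerance, ball and vector
  this is a closed condition, as \<open>u\<close> is continuous. Conversely, approximate gradients
  for shrinking tolerances are bounded, and a limit point is the gradient.\<close>

lemma torus_gderiv_borel:
  fixes u :: "'d::finite torus \<Rightarrow> real"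
  assumes u: "continuous_on UNIV u"
  shows "{X. \<exists>p. torus_gderiv u X p} \<in> sets borel"
proof -
  obtain Q :: "(real ^ 'd) set" where Q: "countable Q" "\<And>U. open U \<Longrightarrow> U \<noteq> {} \<Longrightarrow> \<exists>q\<in>Q. q \<in> U"
    by (rule countable_dense_setE) blast
  define E where "E n k q = (\<Inter>h\<in>{h. norm h < inverse (real (Suc k))}.
      {X. \<bar>u (X + tproj h) - u X - inner h q\<bar> \<le> inverse (real (Suc n)) * norm h})" for n k and q :: "real ^ 'd"
  have "closed (E n k q)" for n k q
    unfolding E_def
    by (intro closed_INT ballI closed_Collect_le continuous_intros u continuous_on_compose2[OF u] continuous_torus_shift) auto
  then have "(\<Union>q\<in>Q. E n k q) \<in> sets borel" for n k
    using Q(1) by (intro sets.countable_UN') auto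
  then have "(\<Union>k. \<Union>q\<in>Q. E n k q) \<in> sets borel" for n
    by (intro sets.countable_UN) auto
  then have "(\<Inter>n. \<Union>k. \<Union>q\<in>Q. E n k q) \<in> sets borel"
    by (intro sets.countable_INT) auto
  moreover have "{X. \<exists>p. torus_gderiv u X p} = (\<Inter>n. \<Union>k. \<Union>q\<in>Q. E n k q)"
  proof (intro subset_antisym subsetI)
    fix X assume "X \<in> {X. \<exists>p. torus_gderiv u X p}"
    then obtain p where p: "torus_gderiv u X p"
      by blast
    show "X \<in> (\<Inter>n. \<Union>k. \<Union>q\<in>Q. E n k q)"
    proof
      fix n
      define e where "e = inverse (real (Suc n)) / 2"
      have e: "e > 0" "e + e = inverse (real (Suc n))"
        by (auto simp: e_def)
      obtain d where d: "d > 0" "\<And>h. norm h < d \<Longrightarrow> \<bar>u (X + tproj h) - u X - inner h p\<bar> \<le> e * norm h"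
        using p e(1) unfolding torus_gderiv_iff by blast
      obtain k where k: "inverse (real (Suc k)) < d"
        using reals_Archimedean[OF d(1)] by blast
      obtain q where q: "q \<in> Q" "q \<in> ball p e"
        using Q(2)[of "ball p e"] e(1) by auto
      have "\<bar>u (X + tproj h) - u X - inner h q\<bar> \<le> inverse (real (Suc n)) * norm h"
        if "norm h < inverse (real (Suc k))" for h
      proof -
        have "\<bar>inner h (p - q)\<bar> \<le> norm h * norm (p - q)"
          by (rule Cauchy_Schwarz_ineq2)
        also have "\<dots> \<le> norm h * e"
          using q(2) by (intro mult_left_mono) (auto simp: dist_norm)
        finally have "\<bar>inner h p - inner h q\<bar> \<le> e * norm h"
          by (simp add: inner_diff_right mult.commute)
        moreover have "\<bar>u (X + tproj h) - u X - inner h p\<bar> \<le> e * norm h"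
          using d(2) that k by simp
        ultimately show ?thesis
          unfolding e(2)[symmetric] distrib_right by linarith
      qed
      then show "X \<in> (\<Union>k. \<Union>q\<in>Q. E n k q)"
        using q(1) by (auto simp: E_def)
    qed
  next
    fix X assume "X \<in> (\<Inter>n. \<Union>k. \<Union>q\<in>Q. E n k q)"
    then have "\<forall>n. \<exists>k q. X \<in> E n k q"
      by blast
    then obtain k q where kq: "\<And>n. X \<in> E n (k n) (q n)"
      by metis
    have le: "\<bar>u (X + tproj h) - u X - inner h (q n)\<bar> \<le> inverse (real (Suc n)) * norm h"
      if "norm h < inverse (real (Suc (k n)))" for n h
      using kq[of n] that by (auto simp: E_def)
    have near: "norm (q n - q m) \<le> inverse (real (Suc n)) + inverse (real (Suc m))" for n m
    proof (cases "q n = q m")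
      case False
      define t where "t = min (inverse (real (Suc (k n)))) (inverse (real (Suc (k m))))"
      have t: "t > 0" "t \<le> inverse (real (Suc (k n)))" "t \<le> inverse (real (Suc (k m)))"
        unfolding t_def by (auto simp del: of_nat_Suc)
      \<comment> \<open>Both expansions are tested at a vector in the direction
        \<open>q n - q m\<close>, scaled to length \<open>t / 2\<close> and hence admissible for
        both.\<close>
      define s where "s = t / (2 * norm (q n - q m))"
      define h where "h = s *\<^sub>R (q n - q m)"
      have s: "s > 0"
        using False t(1) by (auto simp: s_def)
      have "norm h = t / 2"
        using False s t(1) by (simp add: h_def s_def)
      then have h: "norm h < inverse (real (Suc (k n)))" "norm h < inverse (real (Suc (k m)))" "norm h > 0"
        using t by (linarith+)
      have sub: "x - y \<le> a + b" if "\<bar>U - x\<bar> \<le> a" "\<bar>U - y\<bar> \<le> b" for U x y a b :: real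
        using that by linarith
      have "inner h (q n - q m) \<le> (inverse (real (Suc n)) + inverse (real (Suc m))) * norm h"
        unfolding inner_diff_right distrib_right by (rule sub[OF le[OF h(1)] le[OF h(2)]])
      moreover have "inner h (q n - q m) = norm (q n - q m) * norm h"
        using s by (simp add: h_def power2_norm_eq_inner[symmetric] power2_eq_square)
      ultimately have "norm (q n - q m) * norm h \<le> (inverse (real (Suc n)) + inverse (real (Suc m))) * norm h"
        by simp
      then show ?thesis
        using h(3) by (rule mult_right_le_imp_le)
    qed auto
    have "norm (q n) \<le> norm (q 0) + 2" for n
    proof -
      have "inverse (real (Suc n)) \<le> 1"
        by (simp add: inverse_le_1_iff)
      then show ?thesis
        using near[of n 0] norm_triangle_ineq2[of "q n" "q 0"] by simp
    qed
    then have "bounded (range q)"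
      by (auto simp: bounded_iff)
    then obtain p r where r: "strict_mono (r :: nat \<Rightarrow> nat)" "(q \<circ> r) \<longlonglongrightarrow> p"
      using bounded_imp_convergent_subsequence by blast
    have "torus_gderiv u X p"
      unfolding torus_gderiv_iff
    proof (intro allI impI)
      fix e :: real assume "e > 0"
      have "(\<lambda>n. inverse (real (Suc (r n)))) \<longlonglongrightarrow> 0"
        using LIMSEQ_subseq_LIMSEQ[OF LIMSEQ_inverse_real_of_nat r(1)] by (simp add: o_def)
      then have "\<forall>\<^sub>F n in sequentially. inverse (real (Suc (r n))) < e / 2"
        using \<open>e > 0\<close> by (intro order_tendstoD(2)) auto
      moreover have "\<forall>\<^sub>F n in sequentially. dist ((q \<circ> r) n) p < e / 2"
        by (rule tendstoD[OF r(2)]) (use \<open>e > 0\<close> in simp)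
      ultimately have "\<forall>\<^sub>F n in sequentially. inverse (real (Suc (r n))) < e / 2 \<and> norm (q (r n) - p) < e / 2"
        by eventually_elim (simp add: dist_norm)
      then obtain n where n: "inverse (real (Suc (r n))) < e / 2" "norm (q (r n) - p) < e / 2"
        by (auto simp: eventually_sequentially)
      have "\<bar>u (X + tproj h) - u X - inner h p\<bar> \<le> e * norm h" if "norm h < inverse (real (Suc (k (r n))))" for h
      proof -
        have "\<bar>inner h (q (r n) - p)\<bar> \<le> norm h * norm (q (r n) - p)"
          by (rule Cauchy_Schwarz_ineq2)
        also have "\<dots> \<le> norm h * (e / 2)"
          using n(2) by (intro mult_left_mono) auto
        finally have 1: "\<bar>inner h (q (r n)) - inner h p\<bar> \<le> norm h * (e / 2)"
          by (simp add: inner_diff_right)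
        have "\<bar>u (X + tproj h) - u X - inner h (q (r n))\<bar> \<le> inverse (real (Suc (r n))) * norm h"
          by (rule le[OF that])
        also have "\<dots> \<le> norm h * (e / 2)"
          using mult_left_mono[OF less_imp_le[OF n(1)] norm_ge_zero[of h]] by (simp add: mult.commute)
        finally have 2: "\<bar>u (X + tproj h) - u X - inner h (q (r n))\<bar> \<le> norm h * (e / 2)" .
        have 3: "norm h * (e / 2) + norm h * (e / 2) = e * norm h"
          by (simp add: algebra_simps)
        show ?thesis
          using 1 2 3 by linarith
      qed
      then show "\<exists>d>0. \<forall>h. norm h < d \<longrightarrow> \<bar>u (X + tproj h) - u X - inner h p\<bar> \<le> e * norm h"
        by (intro exI[of _ "inverse (real (Suc (k (r n))))"]) auto
    qed
    then show "X \<in> {X. \<exists>p. torus_gderiv u X p}"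
      by blast
  qed
  ultimately show ?thesis
    by simp
qed

lemma torus_grad_measurable:
  fixes u :: "'d::finite torus \<Rightarrow> real"
  assumes u: "continuous_on UNIV u"
  shows "torus_grad u \<in> borel_measurable borel"
proof -
  define D where "D = {X. \<exists>p. torus_gderiv u X p}"
  \<comment> \<open>Where no gradient exists, the description defining \<open>torus_grad\<close> is
    that of an unsatisfiable predicate, hence the same constant at all such points.\<close>
  define c :: "real ^ 'd" where "c = (THE p. False)"
  define s where "s n = inverse (real (Suc n))" for n
  define f where "f n X = (if X \<in> D then \<Sum>b\<in>Basis. ((u (X + tproj (s n *\<^sub>R b)) - u X) / s n) *\<^sub>R b else c)" for n X
  have "f n \<in> borel_measurable borel" for n
    unfolding f_def
  proof (rule measurable_If_set)
    show "(\<lambda>X. \<Sum>b\<in>Basis. ((u (X + tproj (s n *\<^sub>R b)) - u X) / s n) *\<^sub>R b) \<in> borel_measurable borel"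
      by (intro borel_measurable_continuous_onI continuous_intros u continuous_on_compose2[OF u] continuous_torus_shift)
        (auto simp: s_def)
    show "D \<inter> space borel \<in> sets borel"
      using torus_gderiv_borel[OF u] by (simp add: D_def)
  qed simp
  moreover have "(\<lambda>n. f n X) \<longlonglongrightarrow> torus_grad u X" for X
  proof (cases "X \<in> D")
    case True
    then obtain p where p: "torus_gderiv u X p"
      by (auto simp: D_def)
    have "(\<lambda>n. (u (X + tproj (s n *\<^sub>R b)) - u X) / s n) \<longlonglongrightarrow> inner b p" if "b \<in> Basis" for b
    proof (rule LIMSEQ_I)
      fix e :: real assume "e > 0"
      obtain d where d: "d > 0" "\<And>h. norm h < d \<Longrightarrow> \<bar>u (X + tproj h) - u X - inner h p\<bar> \<le> e / 2 * norm h"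
        using p half_gt_zero[OF \<open>e > 0\<close>] unfolding torus_gderiv_iff by blast
      have "\<forall>\<^sub>F n in sequentially. s n < d"
        unfolding s_def using order_tendstoD(2)[OF LIMSEQ_inverse_real_of_nat d(1)] .
      then have "\<forall>\<^sub>F n in sequentially. norm ((u (X + tproj (s n *\<^sub>R b)) - u X) / s n - inner b p) < e"
      proof eventually_elim
        case (elim n)
        have s: "s n > 0"
          by (simp add: s_def)
        have "\<bar>u (X + tproj (s n *\<^sub>R b)) - u X - inner (s n *\<^sub>R b) p\<bar> \<le> e / 2 * norm (s n *\<^sub>R b)"
          using d(2)[of "s n *\<^sub>R b"] elim s \<open>b \<in> Basis\<close> by simp
        then have "\<bar>u (X + tproj (s n *\<^sub>R b)) - u X - s n * inner b p\<bar> \<le> e / 2 * s n"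
          using s \<open>b \<in> Basis\<close> by simp
        then have "\<bar>(u (X + tproj (s n *\<^sub>R b)) - u X - s n * inner b p) / s n\<bar> \<le> e / 2"
          using s by (simp add: abs_divide pos_divide_le_eq)
        moreover have "(u (X + tproj (s n *\<^sub>R b)) - u X - s n * inner b p) / s n =
            (u (X + tproj (s n *\<^sub>R b)) - u X) / s n - inner b p"
          using s by (simp add: diff_divide_distrib)
        ultimately show ?case
          using \<open>e > 0\<close> by simp
      qed
      then show "\<exists>N. \<forall>n\<ge>N. norm ((u (X + tproj (s n *\<^sub>R b)) - u X) / s n - inner b p) < e"
        by (simp add: eventually_sequentially)
    qed
    then have "(\<lambda>n. \<Sum>b\<in>Basis. ((u (X + tproj (s n *\<^sub>R b)) - u X) / s n) *\<^sub>R b) \<longlonglongrightarrow> (\<Sum>b\<in>Basis. inner b p *\<^sub>R b)"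
      by (intro tendsto_intros) auto
    then show ?thesis
      using True torus_grad_eqI[OF p] euclidean_representation[of p]
      by (simp add: f_def inner_commute[of p])
  next
    case False
    then have "torus_grad u X = c"
      by (simp add: D_def torus_grad_def c_def)
    then show ?thesis
      using False by (simp add: f_def)
  qed
  ultimately show ?thesis
    by (rule borel_measurable_LIMSEQ_metric)
qed

section \<open>Calibrated chains\<close>

subsection \<open>Supports of holonomic measures\<close>

text \<open>A tent function around a support point of the limit has positive limit integral, so
  eventually the supports of the approximations meet every given ball; nearest support points
  converge.\<close>

lemma spt_approximation:
  fixes \<mu> :: "'a::{heine_borel, second_countable_topology} measure"
  assumes \<mu>s: "\<And>n. \<mu>s n \<in> borel_prob" and \<mu>: "\<mu> \<in> borel_prob"
    and K: "compact K" "\<And>n. AE z in \<mu>s n. z \<in> K" "AE z in \<mu>. z \<in> K"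
    and lim: "\<And>f :: 'a \<Rightarrow> real. continuous_on UNIV f \<Longrightarrow> (\<lambda>n. integral\<^sup>L (\<mu>s n) f) \<longlonglongrightarrow> integral\<^sup>L \<mu> f"
    and z: "z \<in> spt \<mu>"
  obtains zs where "\<And>n. zs n \<in> spt (\<mu>s n)" "zs \<longlonglongrightarrow> z"
proof -
  have "spt (\<mu>s n) \<noteq> {}" for n
    using AE_spt[OF \<mu>s[of n]] prob_space.AE_False[OF borel_probD(1)[OF \<mu>s[of n]]] by auto
  then have "\<forall>n. \<exists>w\<in>spt (\<mu>s n). infdist z (spt (\<mu>s n)) = dist z w"
    using infdist_attains_inf[OF spt_closed] by blast
  then obtain zs where zs: "\<And>n. zs n \<in> spt (\<mu>s n)" "\<And>n. infdist z (spt (\<mu>s n)) = dist z (zs n)"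
    by metis
  have "zs \<longlonglongrightarrow> z"
  proof (rule tendstoI)
    fix e :: real assume "e > 0"
    define \<phi> where "\<phi> w = max 0 (e - dist z w)" for w
    have c: "continuous_on UNIV \<phi>"
      unfolding \<phi>_def by (intro continuous_intros)
    have "\<not> integral\<^sup>L \<mu> \<phi> \<le> 0"
    proof
      assume "integral\<^sup>L \<mu> \<phi> \<le> 0"
      then have "\<phi> z \<le> 0"
        by (intro zero_on_spt[OF \<mu> c integrable_on_compact[OF \<mu> K(1,3) c] _ _ z]) (auto simp: \<phi>_def)
      then show False
        using \<open>e > 0\<close> by (simp add: \<phi>_def)
    qed
    then have "\<forall>\<^sub>F n in sequentially. integral\<^sup>L (\<mu>s n) \<phi> > 0"
      using order_tendstoD(1)[OF lim[OF c]] by simp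
    then show "\<forall>\<^sub>F n in sequentially. dist (zs n) z < e"
    proof eventually_elim
      case (elim n)
      have "\<exists>w\<in>spt (\<mu>s n). \<phi> w \<noteq> 0"
      proof (rule ccontr)
        assume "\<not> ?thesis"
        then have "AE w in \<mu>s n. \<phi> w = 0"
          using AE_spt[OF \<mu>s[of n]] by (auto elim: eventually_mono)
        then have "integral\<^sup>L (\<mu>s n) \<phi> = 0"
          by (rule integral_eq_zero_AE)
        with elim show False
          by simp
      qed
      then obtain w where w: "w \<in> spt (\<mu>s n)" "dist z w < e"
        by (auto simp: \<phi>_def max_def split: if_splits)
      then show ?case
        using infdist_le[OF w(1), of z] zs(2)[of n] by (simp add: dist_commute)
    qed
  qed
  then show ?thesis
    using that zs(1) by blast
qed

text \<open>Holonomy says that starting points and end points of steps have the same law. If the end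
  point avoided the projected support, which is closed, a tent function there would have integral 0
  for one law and a positive one for the other.\<close>

lemma holonomic_successor:
  fixes \<mu> :: "('d::finite torus \<times> (real ^ 'd)) measure"
  assumes hol: "\<mu> \<in> holonomic \<tau>" and comp: "compact (spt \<mu>)" and z: "(X, v) \<in> spt \<mu>"
  shows "\<exists>w. (X + tproj (\<tau> *\<^sub>R v), w) \<in> spt \<mu>"
proof (rule ccontr)
  assume *: "\<nexists>w. (X + tproj (\<tau> *\<^sub>R v), w) \<in> spt \<mu>"
  note \<mu> = holonomicD(1)[OF hol]
  let ?Y = "X + tproj (\<tau> *\<^sub>R v)"
  have "closed (fst ` spt \<mu>)"
    by (intro compact_imp_closed compact_continuous_image comp continuous_intros)
  moreover have "?Y \<in> - fst ` spt \<mu>"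
    using * by force
  ultimately obtain r where r: "r > 0" "ball ?Y r \<subseteq> - fst ` spt \<mu>"
    unfolding closed_def by (meson open_contains_ball)
  define \<phi> where "\<phi> Z = max 0 (r - dist ?Y Z)" for Z
  have c: "continuous_on UNIV \<phi>"
    unfolding \<phi>_def by (intro continuous_intros)
  have "AE z in \<mu>. \<phi> (fst z) = 0"
    using AE_spt[OF \<mu>]
  proof eventually_elim
    case (elim z)
    then have "fst z \<notin> ball ?Y r"
      using r(2) by blast
    then show ?case
      by (simp add: \<phi>_def)
  qed
  then have "(\<integral>z. \<phi> (fst z) \<partial>\<mu>) = 0"
    by (rule integral_eq_zero_AE)
  then have int0: "(\<integral>z. \<phi> (fst z + tproj (\<tau> *\<^sub>R snd z)) \<partial>\<mu>) \<le> 0"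
    using holonomicD(2)[OF hol c] by simp
  have c': "continuous_on UNIV (\<lambda>z. \<phi> (fst z + tproj (\<tau> *\<^sub>R snd z)))"
    by (intro continuous_on_compose2[OF c] continuous_torus_shift continuous_intros) auto
  have "\<phi> (fst (X, v) + tproj (\<tau> *\<^sub>R snd (X, v))) \<le> 0"
    by (rule zero_on_spt[OF \<mu> c' integrable_on_compact[OF \<mu> comp AE_spt[OF \<mu>] c'] _ int0 z]) (simp add: \<phi>_def)
  then show False
    using r(1) by (simp add: \<phi>_def)
qed

section \<open>Chains and their linear perturbations\<close>

lemma lax_chain_le:
  assumes "lax_eq \<tau> Lm 1 (\<tau> * k) u" "\<And>i. i < N \<Longrightarrow> Y (Suc i) = Y i + tproj (\<tau> *\<^sub>R v i)"
  shows "u (Y N) \<le> u (Y 0) + (\<Sum>i<N. \<tau> * (Lm (Y i) (v i) - k))"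
  using assms(2)
proof (induction N)
  case (Suc N)
  then show ?case
    using lax_eq_forward[OF assms(1), of "Y N" "v N"] by (simp add: algebra_simps)
qed simp

lemma lax_chain_eq:
  fixes u :: "'a \<Rightarrow> real"
  assumes "\<And>i. i < N \<Longrightarrow> u (Y (Suc i)) + \<tau> * k = u (Y i) + \<tau> * Lm (Y i) (v i)"
  shows "u (Y N) = u (Y 0) + (\<Sum>i<N. \<tau> * (Lm (Y i) (v i) - k))"
  using assms
proof (induction N)
  case (Suc N)
  have "u (Y N) = u (Y 0) + (\<Sum>i<N. \<tau> * (Lm (Y i) (v i) - k))"
    using Suc by simp
  moreover have "u (Y (Suc N)) + \<tau> * k = u (Y N) + \<tau> * Lm (Y N) (v N)"
    using Suc.prems by simp
  moreover have "\<tau> * (Lm (Y N) (v N) - k) = \<tau> * Lm (Y N) (v N) - \<tau> * k"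
    by (rule right_diff_distrib)
  ultimately show ?case
    unfolding sum.lessThan_Suc by linarith
qed simp

text \<open>The recursion for \<open>a\<close> is exactly what makes shifting points by
  \<open>a i *\<^sub>R h\<close> and velocities by \<open>b *\<^sub>R h\<close> produce a chain
  again. The perturbed chain satisfies the inequality, the original one the equality; their
  difference is the claim.\<close>

lemma perturbed_chain:
  assumes u: "lax_eq \<tau> Lm 1 (\<tau> * k) u" and Y: "\<And>i. i < N \<Longrightarrow> Y (Suc i) = Y i + tproj (\<tau> *\<^sub>R v i)"
    and cal: "\<And>i. i < N \<Longrightarrow> u (Y (Suc i)) + \<tau> * k = u (Y i) + \<tau> * Lm (Y i) (v i)"
    and a: "\<And>i. a (Suc i) = a i + \<tau> * b"
  shows "u (Y N + tproj (a N *\<^sub>R h)) - u (Y N) \<le> u (Y 0 + tproj (a 0 *\<^sub>R h)) - u (Y 0) +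
    (\<Sum>i<N. \<tau> * (Lm (Y i + tproj (a i *\<^sub>R h)) (v i + b *\<^sub>R h) - Lm (Y i) (v i)))"
proof -
  have "u (Y N + tproj (a N *\<^sub>R h)) \<le> u (Y 0 + tproj (a 0 *\<^sub>R h)) +
      (\<Sum>i<N. \<tau> * (Lm (Y i + tproj (a i *\<^sub>R h)) (v i + b *\<^sub>R h) - k))"
  proof (rule lax_chain_le[OF u, where Y = "\<lambda>i. Y i + tproj (a i *\<^sub>R h)"])
    show "Y (Suc i) + tproj (a (Suc i) *\<^sub>R h) = Y i + tproj (a i *\<^sub>R h) + tproj (\<tau> *\<^sub>R (v i + b *\<^sub>R h))"
      if "i < N" for i
      using Y[OF that] by (simp add: a tproj_add scaleR_add_right scaleR_add_left algebra_simps)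
  qed
  moreover have "u (Y N) = u (Y 0) + (\<Sum>i<N. \<tau> * (Lm (Y i) (v i) - k))"
    using cal by (rule lax_chain_eq)
  moreover have "(\<Sum>i<N. \<tau> * (Lm (Y i + tproj (a i *\<^sub>R h)) (v i + b *\<^sub>R h) - k)) -
      (\<Sum>i<N. \<tau> * (Lm (Y i) (v i) - k)) =
      (\<Sum>i<N. \<tau> * (Lm (Y i + tproj (a i *\<^sub>R h)) (v i + b *\<^sub>R h) - Lm (Y i) (v i)))"
    unfolding sum_subtractf[symmetric] by (simp add: algebra_simps)
  ultimately show ?thesis
    by linarith
qed

lemma chain_displacement:
  assumes "\<And>i. i < N \<Longrightarrow> Y (Suc i) = Y i + tproj (\<tau> *\<^sub>R v i)"
  shows "Y N = Y 0 + tproj (\<Sum>i<N. \<tau> *\<^sub>R v i)"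
  using assms by (induction N) (simp_all add: tproj_add add.assoc)

lemma chain_dist:
  assumes "\<And>i. i < N \<Longrightarrow> Y (Suc i) = Y i + tproj (\<tau> *\<^sub>R v i)" "\<And>i. i < N \<Longrightarrow> norm (v i) \<le> R"
    and "0 \<le> \<tau>" "0 \<le> R" "i \<le> N"
  shows "dist (Y i) (Y N) \<le> real N * \<tau> * R"
  using assms(1,2,5)
proof (induction N)
  case (Suc N)
  show ?case
  proof (cases "i = Suc N")
    case False
    then have "dist (Y i) (Y N) \<le> real N * \<tau> * R"
      using Suc by simp
    moreover have "dist (Y N) (Y (Suc N)) \<le> norm (\<tau> *\<^sub>R v N)"
      using Suc.prems(1)[of N] dist_torus_add_le[of "Y N" "\<tau> *\<^sub>R v N"] by (simp add: dist_commute)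
    moreover have "norm (\<tau> *\<^sub>R v N) \<le> \<tau> * R"
      using Suc.prems(2)[of N] assms(3) by (simp add: mult_left_mono)
    ultimately show ?thesis
      using dist_triangle[of "Y i" "Y (Suc N)" "Y N"] by (simp add: algebra_simps)
  qed (use assms(3,4) in simp)
qed simp

section \<open>Calibration for a fixed Lagrangian\<close>

context lagr
begin

lemma calibrated_predecessor:
  assumes "\<tau> > 0" "lax_eq \<tau> Lm 1 (\<tau> * k) u"
  obtains Z v where "X = Z + tproj (\<tau> *\<^sub>R v)" "u X + \<tau> * k = u Z + \<tau> * Lm Z v" "norm v \<le> speed"
proof -
  obtain v where v: "u X + \<tau> * k = step \<tau> Lm 1 u X v"
    using lax_eqD(3)[OF assms(2)] by blast
  show ?thesis
    by (rule that[of "X - tproj (\<tau> *\<^sub>R v)" v])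
      (use v lax_eq_speed[OF assms v] in \<open>simp_all add: step_def\<close>)
qed

lemma speed_nonneg:
  assumes "\<tau> > 0" "lax_eq \<tau> Lm 1 (\<tau> * k) u"
  shows "0 \<le> speed"
  using calibrated_predecessor[OF assms, of 0] norm_ge_zero order_trans by metis

lemma backward_chain:
  assumes "\<tau> > 0" "lax_eq \<tau> Lm 1 (\<tau> * k) u"
  shows "\<exists>Y v. Y N = X \<and> (\<forall>i<N. Y (Suc i) = Y i + tproj (\<tau> *\<^sub>R v i) \<and>
    u (Y (Suc i)) + \<tau> * k = u (Y i) + \<tau> * Lm (Y i) (v i) \<and> norm (v i) \<le> speed)"
proof (induction N arbitrary: X)
  case 0
  then show ?case
    by (intro exI[of _ "\<lambda>_. X"]) simp
next
  case (Suc N)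
  obtain Z w where w: "X = Z + tproj (\<tau> *\<^sub>R w)" "u X + \<tau> * k = u Z + \<tau> * Lm Z w" "norm w \<le> speed"
    using calibrated_predecessor[OF assms] by blast
  obtain Y v where Yv: "Y N = Z" "\<forall>i<N. Y (Suc i) = Y i + tproj (\<tau> *\<^sub>R v i) \<and>
    u (Y (Suc i)) + \<tau> * k = u (Y i) + \<tau> * Lm (Y i) (v i) \<and> norm (v i) \<le> speed"
    using Suc[of Z] by blast
  show ?case
    by (rule exI[of _ "Y(Suc N := X)"], rule exI[of _ "v(N := w)"]) (use w Yv in \<open>auto simp: less_Suc_eq\<close>)
qed

text \<open>The calibration defect \<open>g\<close> is continuous and nonnegative, and holonomy
  reduces its integral to \<open>\<tau>\<close> times action minus \<open>k\<close>, which is not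
  positive. It therefore vanishes on the support, and a calibrated step has bounded
  velocity.\<close>

lemma calibrated_on_spt:
  fixes \<mu> :: "('d torus \<times> (real ^ 'd)) measure"
  assumes "\<tau> > 0" and u: "lax_eq \<tau> Lm 1 (\<tau> * k) u" and hol: "\<mu> \<in> holonomic \<tau>"
    and int: "integrable \<mu> (\<lambda>(X, v). Lm X v)" and val: "(\<integral>(X, v). Lm X v \<partial>\<mu>) \<le> k"
    and z: "(X, v) \<in> spt \<mu>"
  shows "u (X + tproj (\<tau> *\<^sub>R v)) + \<tau> * k = u X + \<tau> * Lm X v" "norm v \<le> speed"
proof -
  note \<mu> = holonomicD(1)[OF hol]
  interpret prob_space \<mu>
    by (rule borel_probD(1)[OF \<mu>])
  note cu = lax_eqD(1)[OF u]
  obtain B where B: "\<And>X. \<bar>u X\<bar> \<le> B"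
    using torus_bounded_range[OF cu] by metis
  have c1: "continuous_on UNIV (\<lambda>z :: 'd torus \<times> (real ^ 'd). u (fst z + tproj (\<tau> *\<^sub>R snd z)))"
    by (intro continuous_on_compose2[OF cu] continuous_torus_shift continuous_intros) auto
  have c2: "continuous_on UNIV (\<lambda>z :: 'd torus \<times> (real ^ 'd). u (fst z))"
    by (intro continuous_on_compose2[OF cu] continuous_intros) auto
  have c3: "continuous_on UNIV (\<lambda>z. Lm (fst z) (snd z))"
    using cont by (simp add: case_prod_unfold)
  have i1: "integrable \<mu> (\<lambda>z. u (fst z + tproj (\<tau> *\<^sub>R snd z)))" and i2: "integrable \<mu> (\<lambda>z. u (fst z))"
    using B by (auto intro!: integrable_const_bound[of _ B] borel_prob_measurable[OF \<mu>] c1 c2)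
  have i3: "integrable \<mu> (\<lambda>z. Lm (fst z) (snd z))"
    using int by (simp add: case_prod_unfold)
  define g where "g z = u (fst z) + \<tau> * Lm (fst z) (snd z) - u (fst z + tproj (\<tau> *\<^sub>R snd z)) - \<tau> * k" for z
  have "g (X, v) \<le> 0"
  proof (rule zero_on_spt[OF \<mu> _ _ _ _ z])
    show "continuous_on UNIV g"
      unfolding g_def by (intro continuous_intros c1 c2 c3)
    show "integrable \<mu> g"
      unfolding g_def using i1 i2 i3 by simp
    have "0 \<le> g z" for z
      using lax_eq_forward[OF u, of "fst z" "snd z"] by (simp add: g_def)
    then show "AE z in \<mu>. 0 \<le> g z"
      by simp
    have "integral\<^sup>L \<mu> g = \<tau> * ((\<integral>z. Lm (fst z) (snd z) \<partial>\<mu>) - k)"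
      unfolding g_def using i1 i2 i3 holonomicD(2)[OF hol cu] by (simp add: prob_space algebra_simps)
    also have "\<dots> \<le> 0"
      using val assms(1) by (simp add: case_prod_unfold mult_nonneg_nonpos)
    finally show "integral\<^sup>L \<mu> g \<le> 0" .
  qed
  moreover have "g (X, v) \<ge> 0"
    using lax_eq_forward[OF u, of X v] by (simp add: g_def)
  ultimately show *: "u (X + tproj (\<tau> *\<^sub>R v)) + \<tau> * k = u X + \<tau> * Lm X v"
    by (simp add: g_def)
  show "norm v \<le> speed"
    by (rule lax_eq_speed[OF assms(1) u, of "X + tproj (\<tau> *\<^sub>R v)"]) (use * in \<open>simp add: step_def\<close>)
qed

end

subsection \<open>Two-sided differentiability along calibrated chains\<close>

context mfg_lagrangian
begin

text \<open>The first variation of the action along the chain is linear in \<open>h\<close>, with a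
  size and a remainder that depend on the total time only and not on the number of steps.\<close>

lemma chain_variation:
  obtains \<Lambda> \<delta> where "\<And>e. e > 0 \<Longrightarrow> \<delta> e > 0"
    "\<And>m Y v a b \<tau> N. m \<in> borel_prob \<Longrightarrow> (\<And>i. i < N \<Longrightarrow> norm (v i :: real ^ 'd) \<le> R) \<Longrightarrow>
      (\<And>i. i < N \<Longrightarrow> \<bar>a i\<bar> \<le> 1) \<Longrightarrow> \<bar>b\<bar> \<le> 1 \<Longrightarrow> 0 \<le> \<tau> \<Longrightarrow> real N * \<tau> \<le> 2 \<Longrightarrow>
      \<exists>q. norm q \<le> \<Lambda> \<and> (\<forall>e>0. \<forall>h. norm h \<le> \<delta> e \<longrightarrow>
        \<bar>(\<Sum>i<N. \<tau> * (lag_at L F m (Y i + tproj (a i *\<^sub>R h)) (v i + b *\<^sub>R h) - lag_at L F m (Y i) (v i))) - inner h q\<bar>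
          \<le> e * norm h)"
proof -
  show ?thesis
  proof (rule lag_at_expansion[of R], goal_cases)
    case (1 \<Lambda> gx gv \<delta>)
    note g = 1(1,2) and \<delta> = 1(3) and ex = 1(4)
    \<comment> \<open>Total time at most 2 and two coefficients per step, each bounded by
      \<open>\<Lambda>\<close>, give the factor 4; likewise the per-step error \<open>e / 4\<close>
      counts for two perturbations over time 2.\<close>
    show ?case
    proof (rule that[of "\<lambda>e. \<delta> (e / 4)" "4 * \<bar>\<Lambda>\<bar>"])
      fix m :: "'d torus measure" and Y :: "nat \<Rightarrow> 'd torus" and v :: "nat \<Rightarrow> real ^ 'd"
        and \<tau> b :: real and a :: "nat \<Rightarrow> real" and N :: nat
      assume m: "m \<in> borel_prob" and v: "\<And>i. i < N \<Longrightarrow> norm (v i) \<le> R"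
        and a: "\<And>i. i < N \<Longrightarrow> \<bar>a i\<bar> \<le> 1" and b: "\<bar>b\<bar> \<le> 1" and \<tau>: "0 \<le> \<tau>" "real N * \<tau> \<le> 2"
      define q where "q = (\<Sum>i<N. \<tau> *\<^sub>R (a i *\<^sub>R gx m (Y i) (v i) + b *\<^sub>R gv m (Y i) (v i)))"
      have "norm q \<le> (\<Sum>i<N. \<tau> * (2 * \<bar>\<Lambda>\<bar>))"
        unfolding q_def
      proof (rule order_trans[OF norm_sum sum_mono])
        fix i assume "i \<in> {..<N}"
        then have i: "i < N"
          by simp
        have "norm (a i *\<^sub>R gx m (Y i) (v i)) \<le> norm (gx m (Y i) (v i))" "norm (b *\<^sub>R gv m (Y i) (v i)) \<le> norm (gv m (Y i) (v i))"
          using a[OF i] b by (simp_all add: mult_left_le_one_le)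
        then have "norm (a i *\<^sub>R gx m (Y i) (v i) + b *\<^sub>R gv m (Y i) (v i)) \<le> 2 * \<bar>\<Lambda>\<bar>"
          using norm_triangle_ineq[of "a i *\<^sub>R gx m (Y i) (v i)" "b *\<^sub>R gv m (Y i) (v i)"]
            g(1)[OF m v[OF i], of "Y i"] g(2)[OF m v[OF i], of "Y i"] by linarith
        then show "norm (\<tau> *\<^sub>R (a i *\<^sub>R gx m (Y i) (v i) + b *\<^sub>R gv m (Y i) (v i))) \<le> \<tau> * (2 * \<bar>\<Lambda>\<bar>)"
          using \<tau>(1) by (simp add: mult_left_mono)
      qed
      also have "\<dots> = (real N * \<tau>) * (2 * \<bar>\<Lambda>\<bar>)"
        by simp
      also have "\<dots> \<le> 2 * (2 * \<bar>\<Lambda>\<bar>)"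
        using \<tau>(2) by (intro mult_right_mono) auto
      finally have "norm q \<le> 4 * \<bar>\<Lambda>\<bar>"
        by simp
      moreover have "\<bar>(\<Sum>i<N. \<tau> * (lag_at L F m (Y i + tproj (a i *\<^sub>R h)) (v i + b *\<^sub>R h) - lag_at L F m (Y i) (v i))) - inner h q\<bar>
          \<le> e * norm h" if "e > 0" "norm h \<le> \<delta> (e / 4)" for e h
      proof -
        let ?D = "\<lambda>i. lag_at L F m (Y i + tproj (a i *\<^sub>R h)) (v i + b *\<^sub>R h) - lag_at L F m (Y i) (v i)"
        let ?q = "\<lambda>i. inner (a i *\<^sub>R h) (gx m (Y i) (v i)) + inner (b *\<^sub>R h) (gv m (Y i) (v i))"
        have "inner h q = (\<Sum>i<N. \<tau> * ?q i)"
          unfolding q_def inner_sum_right by (intro sum.cong) (auto simp: inner_add_right)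
        then have "(\<Sum>i<N. \<tau> * ?D i) - inner h q = (\<Sum>i<N. \<tau> * (?D i - ?q i))"
          by (simp add: sum_subtractf right_diff_distrib)
        also have "\<bar>\<dots>\<bar> \<le> (\<Sum>i<N. \<tau> * (e / 2 * norm h))"
        proof (rule order_trans[OF sum_abs sum_mono])
          fix i assume "i \<in> {..<N}"
          then have i: "i < N"
            by simp
          have n: "norm (a i *\<^sub>R h) \<le> norm h" "norm (b *\<^sub>R h) \<le> norm h"
            using a[OF i] b by (simp_all add: mult_left_le_one_le)
          have e4: "e / 4 > 0"
            using \<open>e > 0\<close> by simp
          have d: "norm (a i *\<^sub>R h) \<le> \<delta> (e / 4)" "norm (b *\<^sub>R h) \<le> \<delta> (e / 4)"
            using order_trans[OF n(1)] order_trans[OF n(2)] \<open>norm h \<le> \<delta> (e / 4)\<close> by simp_all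
          have "\<bar>?D i - ?q i\<bar> \<le> e / 4 * (norm (a i *\<^sub>R h) + norm (b *\<^sub>R h))"
            using ex[OF e4 m v[OF i] d, of "Y i"] by (simp only: diff_diff_eq)
          also have "\<dots> \<le> e / 4 * (norm h + norm h)"
            using n e4 by (intro mult_left_mono add_mono) auto
          finally have "\<bar>?D i - ?q i\<bar> \<le> e / 2 * norm h"
            by simp
          then show "\<bar>\<tau> * (?D i - ?q i)\<bar> \<le> \<tau> * (e / 2 * norm h)"
            unfolding abs_mult abs_of_nonneg[OF \<tau>(1)] using \<tau>(1) by (rule mult_left_mono)
        qed
        also have "\<dots> = (real N * \<tau>) * (e / 2 * norm h)"
          by simp
        also have "\<dots> \<le> 2 * (e / 2 * norm h)"
          using \<tau>(2) \<open>e > 0\<close> by (intro mult_right_mono) auto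
        finally show ?thesis
          by simp
      qed
      ultimately show "\<exists>q. norm q \<le> 4 * \<bar>\<Lambda>\<bar> \<and> (\<forall>e>0. \<forall>h. norm h \<le> \<delta> (e / 4) \<longrightarrow>
          \<bar>(\<Sum>i<N. \<tau> * (lag_at L F m (Y i + tproj (a i *\<^sub>R h)) (v i + b *\<^sub>R h) - lag_at L F m (Y i) (v i))) - inner h q\<bar>
            \<le> e * norm h)"
        by blast
    qed (use \<delta> in auto)
  qed
qed

text \<open>A chain lasting at least time 1 can move an end point by \<open>h\<close> with velocity
  change at most \<open>norm h\<close>; a length of at most 2 keeps the accumulated error
  bounded.\<close>

lemma unit_time_steps:
  fixes \<tau> :: real
  assumes "0 < \<tau>" "\<tau> < 1"
  obtains N :: nat where "0 < N" "1 \<le> real N * \<tau>" "real N * \<tau> \<le> 2"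
proof -
  define N where "N = nat \<lceil>1 / \<tau>\<rceil>"
  have "0 \<le> 1 / \<tau>"
    using assms by simp
  then have "real N = of_int \<lceil>1 / \<tau>\<rceil>"
    by (simp add: N_def)
  then have "1 / \<tau> \<le> real N" "real N \<le> 1 / \<tau> + 1"
    using le_of_int_ceiling[of "1 / \<tau>"] of_int_ceiling_le_add_one[of "1 / \<tau>"] by simp_all
  then have *: "1 \<le> real N * \<tau>" "real N * \<tau> \<le> 1 + \<tau>"
    using assms by (simp_all add: field_simps)
  then have "N \<noteq> 0"
    by (intro notI) simp
  then show ?thesis
    using that * assms by simp
qed

text \<open>Perturbing a calibrated chain linearly in time moves one end point and fixes the other one;
  the admissible error depends neither on the time step nor on the measure.\<close>

lemma lax_eq_differentials:
  obtains \<Lambda> \<delta> where "\<And>e. e > 0 \<Longrightarrow> \<delta> e > 0"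
    "\<And>m \<tau> k u X. m \<in> borel_prob \<Longrightarrow> 0 < \<tau> \<Longrightarrow> \<tau> < 1 \<Longrightarrow> lax_eq \<tau> (lag_at L F m) 1 (\<tau> * k) u \<Longrightarrow>
      \<exists>q. norm q \<le> \<Lambda> \<and> (\<forall>e>0. \<forall>h. norm h \<le> \<delta> e \<longrightarrow> u (X + tproj h) \<le> u X + inner h q + e * norm h)"
    "\<And>m \<tau> k u Y v. m \<in> borel_prob \<Longrightarrow> 0 < \<tau> \<Longrightarrow> \<tau> < 1 \<Longrightarrow> lax_eq \<tau> (lag_at L F m) 1 (\<tau> * k) u \<Longrightarrow>
      (\<And>i. Y (Suc i) = Y i + tproj (\<tau> *\<^sub>R v i)) \<Longrightarrow>
      (\<And>i. u (Y (Suc i)) + \<tau> * k = u (Y i) + \<tau> * lag_at L F m (Y i) (v i)) \<Longrightarrow>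
      (\<And>i. norm (v i) \<le> lagr.speed CL UL) \<Longrightarrow>
      \<exists>p. norm p \<le> \<Lambda> \<and> (\<forall>e>0. \<forall>h. norm h \<le> \<delta> e \<longrightarrow> u (Y 0) + inner h p - e * norm h \<le> u (Y 0 + tproj h))"
proof -
  show ?thesis
  proof (rule chain_variation[of "lagr.speed CL UL"], goal_cases)
    case (1 \<Lambda> \<delta>)
    note \<delta> = 1(1) and var = 1(2)
    show ?case
    proof (rule that[of \<delta> \<Lambda>])
      show "\<delta> e > 0" if "e > 0" for e
        by (rule \<delta>[OF that])
    next
      fix m \<tau> k u X
      assume m: "m \<in> borel_prob" and \<tau>: "0 < \<tau>" "\<tau> < 1" and u: "lax_eq \<tau> (lag_at L F m) 1 (\<tau> * k) u"
      obtain N where N: "0 < N" "1 \<le> real N * \<tau>" "real N * \<tau> \<le> 2"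
        using unit_time_steps[OF \<tau>] .
      obtain Y v where Y: "Y N = X" "\<And>i. i < N \<Longrightarrow> Y (Suc i) = Y i + tproj (\<tau> *\<^sub>R v i)"
        "\<And>i. i < N \<Longrightarrow> u (Y (Suc i)) + \<tau> * k = u (Y i) + \<tau> * lag_at L F m (Y i) (v i)"
        "\<And>i. i < N \<Longrightarrow> norm (v i) \<le> lagr.speed CL UL"
        using lagr.backward_chain[OF lagr[OF m] \<tau>(1) u, of N X] by blast
      \<comment> \<open>The weight grows from 0 at the far past to 1 at \<open>X\<close>: the start
        is fixed, the end moves, and \<open>u\<close> is bounded from above near
        \<open>X\<close>.\<close>
      define a where "a i = real i / real N" for i
      define b where "b = 1 / (real N * \<tau>)"
      have ab: "\<bar>a i\<bar> \<le> 1" "\<bar>b\<bar> \<le> 1" if "i < N" for i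
        using that N by (auto simp: a_def b_def)
      have b: "\<bar>b\<bar> \<le> 1" "\<tau> * b = 1 / real N"
        using N \<tau> by (auto simp: b_def)
      obtain q where q: "norm q \<le> \<Lambda>" "\<And>e h. e > 0 \<Longrightarrow> norm h \<le> \<delta> e \<Longrightarrow>
          \<bar>(\<Sum>i<N. \<tau> * (lag_at L F m (Y i + tproj (a i *\<^sub>R h)) (v i + b *\<^sub>R h) - lag_at L F m (Y i) (v i))) - inner h q\<bar>
            \<le> e * norm h"
        using var[where v = v and a = a and b = b and Y = Y, OF m Y(4) ab(1) b(1) less_imp_le[OF \<tau>(1)] N(3)] by blast
      have "u (X + tproj h) \<le> u X + inner h q + e * norm h" if "e > 0" "norm h \<le> \<delta> e" for e h
      proof -
        have "a (Suc i) = a i + \<tau> * b" for i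
          by (simp add: a_def b(2) add_divide_distrib)
        note perturbed_chain[where a = a and v = v and Y = Y and h = h and N = N, OF u Y(2,3) this]
        moreover have "a N = 1" "a 0 = 0"
          using N(1) by (auto simp: a_def)
        ultimately show ?thesis
          using q(2)[OF that] Y(1) by (simp add: abs_le_iff)
      qed
      then show "\<exists>q. norm q \<le> \<Lambda> \<and> (\<forall>e>0. \<forall>h. norm h \<le> \<delta> e \<longrightarrow> u (X + tproj h) \<le> u X + inner h q + e * norm h)"
        using q(1) by blast
    next
      fix m \<tau> k u Y and v :: "nat \<Rightarrow> real ^ 'd"
      assume m: "m \<in> borel_prob" and \<tau>: "0 < \<tau>" "\<tau> < 1" and u: "lax_eq \<tau> (lag_at L F m) 1 (\<tau> * k) u"
        and Y: "\<And>i. Y (Suc i) = Y i + tproj (\<tau> *\<^sub>R v i)"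
          "\<And>i. u (Y (Suc i)) + \<tau> * k = u (Y i) + \<tau> * lag_at L F m (Y i) (v i)"
          "\<And>i. norm (v i) \<le> lagr.speed CL UL"
      obtain N where N: "0 < N" "1 \<le> real N * \<tau>" "real N * \<tau> \<le> 2"
        using unit_time_steps[OF \<tau>] .
      \<comment> \<open>The weight falls from 1 at \<open>Y 0\<close> to 0: the future end is fixed
        and the start moves. The perturbed inequality now bounds \<open>u\<close> near
        \<open>Y 0\<close> from below, with slope \<open>- q\<close>.\<close>
      define a where "a i = 1 - real i / real N" for i
      define b where "b = - (1 / (real N * \<tau>))"
      have ab: "\<bar>a i\<bar> \<le> 1" if "i < N" for i
        using that N by (auto simp: a_def)
      have b: "\<bar>b\<bar> \<le> 1" "\<tau> * b = - (1 / real N)"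
        using N \<tau> by (auto simp: b_def)
      obtain q where q: "norm q \<le> \<Lambda>" "\<And>e h. e > 0 \<Longrightarrow> norm h \<le> \<delta> e \<Longrightarrow>
          \<bar>(\<Sum>i<N. \<tau> * (lag_at L F m (Y i + tproj (a i *\<^sub>R h)) (v i + b *\<^sub>R h) - lag_at L F m (Y i) (v i))) - inner h q\<bar>
            \<le> e * norm h"
        using var[where v = v and a = a and b = b and Y = Y, OF m Y(3) ab b(1) less_imp_le[OF \<tau>(1)] N(3)] by blast
      have "u (Y 0) + inner h (- q) - e * norm h \<le> u (Y 0 + tproj h)" if "e > 0" "norm h \<le> \<delta> e" for e h
      proof -
        have "a (Suc i) = a i + \<tau> * b" for i
          by (simp add: a_def b(2) add_divide_distrib)
        note perturbed_chain[where a = a and v = v and Y = Y and h = h and N = N, OF u Y(1,2) this]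
        moreover have "a N = 0" "a 0 = 1"
          using N(1) by (auto simp: a_def)
        ultimately show ?thesis
          using q(2)[OF that] by (simp add: abs_le_iff)
      qed
      then show "\<exists>p. norm p \<le> \<Lambda> \<and> (\<forall>e>0. \<forall>h. norm h \<le> \<delta> e \<longrightarrow> u (Y 0) + inner h p - e * norm h \<le> u (Y 0 + tproj h))"
        using q(1) by (intro exI[of _ "- q"]) simp
    qed
  qed
qed

end

section \<open>The vanishing time step limit\<close>

lemma le_if_le_add_multiples:
  fixes a b c :: real
  assumes "0 \<le> c" "\<And>e. e > 0 \<Longrightarrow> a \<le> b + e * c"
  shows "a \<le> b"
proof (rule field_le_epsilon)
  fix e :: real assume "e > 0"
  then have "a \<le> b + e / (c + 1) * c"
    using assms by (intro assms(2)) auto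
  also have "e / (c + 1) * c \<le> e"
    using \<open>e > 0\<close> assms(1) by (simp add: field_simps)
  finally show "a \<le> b + e"
    by simp
qed

lemma uniform_limit_seq:
  fixes us :: "nat \<Rightarrow> 'a::topological_space \<Rightarrow> real"
  assumes "uniform_limit UNIV us u sequentially" "continuous_on UNIV u" "Z \<longlonglongrightarrow> z"
  shows "(\<lambda>n. us n (Z n)) \<longlonglongrightarrow> u z"
proof -
  have "(\<lambda>n. us n (Z n) - u (Z n)) \<longlonglongrightarrow> 0"
  proof (rule tendstoI)
    fix e :: real assume "e > 0"
    from uniform_limitD[OF assms(1) this] show "\<forall>\<^sub>F n in sequentially. dist (us n (Z n) - u (Z n)) 0 < e"
      by eventually_elim (simp add: dist_real_def)
  qed
  moreover have "(\<lambda>n. u (Z n)) \<longlonglongrightarrow> u z"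
    using continuous_on_tendsto_compose[OF assms(2,3)] by simp
  ultimately have "(\<lambda>n. us n (Z n) - u (Z n) + u (Z n)) \<longlonglongrightarrow> 0 + u z"
    by (rule tendsto_add)
  then show ?thesis
    by simp
qed

text \<open>The constants \<open>k\<close> enter as a convergent sequence with abstract limit
  \<open>\<kappa>\<close>; only afterwards is \<open>- \<kappa>\<close> identified as the critical
  value of the limit Hamiltonian.\<close>

locale mfg_limit = mfg_lagrangian L F CL UL
  for L :: "'d::finite torus \<Rightarrow> real ^ 'd \<Rightarrow> real" and F CL UL +
  fixes H :: "'d torus \<Rightarrow> real ^ 'd \<Rightarrow> real" and \<tau> k :: "nat \<Rightarrow> real" and \<kappa> :: real
    and m :: "nat \<Rightarrow> 'd torus measure" and m\<^sub>0 :: "'d torus measure"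
    and u :: "nat \<Rightarrow> 'd torus \<Rightarrow> real" and u\<^sub>0 :: "'d torus \<Rightarrow> real"
  assumes H: "tonelli H" and L_eq: "L = lagrangian H"
    and \<tau>: "\<And>n. 0 < \<tau> n" "\<And>n. \<tau> n < 1" "\<tau> \<longlonglongrightarrow> 0"
    and m: "\<And>n. m n \<in> borel_prob"
    and lax: "\<And>n. lax_eq (\<tau> n) (lag_at L F (m n)) 1 (\<tau> n * k n) (u n)"
    and m_lim: "limitin weak_star m m\<^sub>0 sequentially"
    and u_lim: "uniform_limit UNIV u u\<^sub>0 sequentially"
    and k_lim: "k \<longlonglongrightarrow> \<kappa>"
begin

abbreviation "R \<equiv> lagr.speed CL UL"

lemma m\<^sub>0: "m\<^sub>0 \<in> borel_prob"
  using m_lim by (simp add: limitin_def topspace_weak_star)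

lemma cont_u\<^sub>0: "continuous_on UNIV u\<^sub>0"
  using uniform_limit_theorem[OF _ u_lim] lax_eqD(1)[OF lax] by simp

lemma u_seq: "Z \<longlonglongrightarrow> z \<Longrightarrow> (\<lambda>n. u n (Z n)) \<longlonglongrightarrow> u\<^sub>0 z"
  by (rule uniform_limit_seq[OF u_lim cont_u\<^sub>0])

lemma R_nonneg: "0 \<le> R"
  by (rule lagr.speed_nonneg[OF lagr[OF m[of 0]] \<tau>(1) lax])

definition steps :: "real \<Rightarrow> nat \<Rightarrow> nat" where
  "steps t n = nat \<lfloor>t / \<tau> n\<rfloor>"

lemma steps:
  assumes "0 \<le> t"
  shows "real (steps t n) * \<tau> n \<le> t" "(\<lambda>n. real (steps t n) * \<tau> n) \<longlonglongrightarrow> t"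
proof -
  have eq: "real (steps t n) = of_int \<lfloor>t / \<tau> n\<rfloor>" for n
    using assms \<tau>(1)[of n] by (simp add: steps_def)
  have le: "real (steps t n) \<le> t / \<tau> n" "t / \<tau> n - 1 \<le> real (steps t n)" for n
    unfolding eq by (linarith+)
  show *: "real (steps t n) * \<tau> n \<le> t" for n
    by (rule iffD1[OF pos_le_divide_eq[OF \<tau>(1)] le(1)])
  have lo: "t - \<tau> n \<le> real (steps t n) * \<tau> n" for n
    using mult_right_mono[OF le(2)[of n] less_imp_le[OF \<tau>(1)[of n]]] \<tau>(1)[of n] by (simp add: left_diff_distrib)
  have "(\<lambda>n. t - \<tau> n) \<longlonglongrightarrow> t - 0"
    by (intro tendsto_intros \<tau>)
  then have lim: "(\<lambda>n. t - \<tau> n) \<longlonglongrightarrow> t"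
    by simp
  show "(\<lambda>n. real (steps t n) * \<tau> n) \<longlonglongrightarrow> t"
    by (rule tendsto_sandwich[OF always_eventually[OF allI[OF lo]] always_eventually[OF allI[OF *]] lim tendsto_const])
qed

lemma shift_tendsto:
  fixes X :: "'d torus"
  assumes "s \<longlonglongrightarrow> s0"
  shows "(\<lambda>n. X - tproj (s n)) \<longlonglongrightarrow> X - tproj s0"
proof -
  have "continuous_on UNIV (\<lambda>s :: real ^ 'd. X + tproj (- s))"
    by (intro continuous_torus_shift continuous_intros)
  from continuous_on_tendsto_compose[OF this assms] show ?thesis
    by (simp add: tproj_minus)
qed

lemma upper_rate:
  assumes "e > 0"
  obtains d where "d > 0" "\<And>t. 0 < t \<Longrightarrow> t < d \<Longrightarrow>
    u\<^sub>0 X - u\<^sub>0 (X - tproj (t *\<^sub>R w)) \<le> t * (lag_at L F m\<^sub>0 X w - \<kappa> + e)"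
proof -
  define g where "g s = lag_at L F m\<^sub>0 (X + tproj (- (s *\<^sub>R w))) w" for s :: real
  have "continuous_on UNIV (\<lambda>s :: real. (X + tproj (- (s *\<^sub>R w)), w))"
    by (intro continuous_on_Pair continuous_torus_shift continuous_intros)
  from continuous_on_compose2[OF lagr.cont[OF lagr[OF m\<^sub>0]] this]
  have "continuous_on UNIV g"
    by (simp add: g_def[abs_def])
  then obtain d where d: "d > 0" "\<And>s. \<bar>s\<bar> < d \<Longrightarrow> \<bar>g s - g 0\<bar> < e / 2"
    using assms half_gt_zero[OF assms] unfolding continuous_on_iff dist_real_def
    by (metis UNIV_I diff_zero)
  have g0: "g 0 = lag_at L F m\<^sub>0 X w"
    by (simp add: g_def)
  have "u\<^sub>0 X - u\<^sub>0 (X - tproj (t *\<^sub>R w)) \<le> t * (g 0 - \<kappa> + e)" if t: "0 < t" "t < d" for t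
  proof -
    \<comment> \<open>Time covered by whole steps; it stays below \<open>t\<close> and tends to
      \<open>t\<close>.\<close>
    define T where "T n = real (steps t n) * \<tau> n" for n
    have T: "T n \<le> t" "0 \<le> T n" "T \<longlonglongrightarrow> t" for n
      using steps[of t] t(1) \<tau>(1) by (auto simp: T_def[abs_def] less_imp_le)
    have "\<forall>\<^sub>F n in sequentially. u n X - u n (X - tproj (T n *\<^sub>R w)) \<le> T n * (g 0 - k n + e)"
      using lag_at_uniform_limit[OF m_lim half_gt_zero[OF assms]]
    proof eventually_elim
      case (elim n)
      \<comment> \<open>Indexed from the past so that after \<open>steps t n\<close> steps the chain
        of constant velocity \<open>w\<close> ends exactly at \<open>X\<close>.\<close>
      define Y where "Y i = X + tproj (- ((T n - real i * \<tau> n) *\<^sub>R w))" for i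
      have "u n (Y (steps t n)) \<le> u n (Y 0) + (\<Sum>i<steps t n. \<tau> n * (lag_at L F (m n) (Y i) w - k n))"
      proof (rule lax_chain_le[OF lax])
        fix i
        have "- ((T n - real (Suc i) * \<tau> n) *\<^sub>R w) = - ((T n - real i * \<tau> n) *\<^sub>R w) + \<tau> n *\<^sub>R w"
          by (simp add: algebra_simps)
        then show "Y (Suc i) = Y i + tproj (\<tau> n *\<^sub>R w)"
          unfolding Y_def by (metis add.assoc tproj_add)
      qed
      also have "(\<Sum>i<steps t n. \<tau> n * (lag_at L F (m n) (Y i) w - k n)) \<le> (\<Sum>i<steps t n. \<tau> n * (g 0 - k n + e))"
      proof (rule sum_mono)
        fix i assume "i \<in> {..<steps t n}"
        then have "real i * \<tau> n \<le> T n"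
          using \<tau>(1)[of n] by (simp add: T_def mult_right_mono)
        then have "\<bar>T n - real i * \<tau> n\<bar> < d"
          using T(1)[of n] t \<tau>(1)[of n] mult_nonneg_nonneg[of "real i" "\<tau> n"] by linarith
        then have "\<bar>lag_at L F m\<^sub>0 (Y i) w - g 0\<bar> < e / 2"
          using d(2) unfolding Y_def g_def by blast
        moreover have "\<bar>lag_at L F (m n) (Y i) w - lag_at L F m\<^sub>0 (Y i) w\<bar> \<le> e / 2"
          using elim by blast
        ultimately have "lag_at L F (m n) (Y i) w - k n \<le> g 0 - k n + e"
          by linarith
        then show "\<tau> n * (lag_at L F (m n) (Y i) w - k n) \<le> \<tau> n * (g 0 - k n + e)"
          using \<tau>(1)[of n] by (intro mult_left_mono) auto
      qed
      also have "(\<Sum>i<steps t n. \<tau> n * (g 0 - k n + e)) = T n * (g 0 - k n + e)"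
        by (simp add: T_def)
      finally have "u n (Y (steps t n)) \<le> u n (Y 0) + T n * (g 0 - k n + e)"
        by simp
      moreover have "Y (steps t n) = X"
        by (simp add: Y_def T_def)
      moreover have "Y 0 = X - tproj (T n *\<^sub>R w)"
        by (simp add: Y_def tproj_minus)
      ultimately show ?case
        by simp
    qed
    moreover have "(\<lambda>n. u n X - u n (X - tproj (T n *\<^sub>R w))) \<longlonglongrightarrow> u\<^sub>0 X - u\<^sub>0 (X - tproj (t *\<^sub>R w))"
      by (intro tendsto_diff u_seq shift_tendsto tendsto_scaleR T tendsto_const)
    moreover have "(\<lambda>n. T n * (g 0 - k n + e)) \<longlonglongrightarrow> t * (g 0 - \<kappa> + e)"
      by (intro tendsto_intros T k_lim)
    ultimately show ?thesis
      by (intro tendsto_le[OF sequentially_bot]) auto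
  qed
  then show ?thesis
    using that d(1) g0 by simp
qed

lemma continuous_ham: "continuous_on UNIV (\<lambda>(X, p). ham_at H F m\<^sub>0 X p)"
proof -
  have "continuous_on UNIV (\<lambda>z :: 'd torus \<times> (real ^ 'd). F (fst z) m\<^sub>0)"
    using continuous_on_compose2[OF coupling_GDERIV(2)[OF F m\<^sub>0] continuous_on_fst[OF continuous_on_id]] by auto
  then show ?thesis
    using tonelli_continuous[OF H] unfolding ham_at_def case_prod_unfold by (intro continuous_intros)
qed

text \<open>Young's inequality replaces the convexity of the Lagrangian: the average velocity of a
  calibrated chain already yields the supersolution inequality.\<close>

lemma lower_rate:
  assumes "e > 0"
  obtains d where "d > 0" "\<And>t. 0 < t \<Longrightarrow> t < d \<Longrightarrow> \<exists>v. norm v \<le> R \<and>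
    t * (inner v p - ham_at H F m\<^sub>0 X p - \<kappa> - e) \<le> u\<^sub>0 X - u\<^sub>0 (X - tproj (t *\<^sub>R v))"
proof -
  define f where "f Y = ham_at H F m\<^sub>0 Y p" for Y
  have "continuous_on UNIV (\<lambda>Y :: 'd torus. (Y, p))"
    by (intro continuous_intros)
  from continuous_on_compose2[OF continuous_ham this] have "continuous_on UNIV f"
    by (simp add: f_def[abs_def])
  then obtain \<eta> where \<eta>: "\<eta> > 0" "\<And>Y. dist Y X < \<eta> \<Longrightarrow> \<bar>f Y - f X\<bar> < e / 2"
    using half_gt_zero[OF assms] unfolding continuous_on_iff dist_real_def by (metis UNIV_I)
  \<comment> \<open>For times below \<open>d\<close> a chain of speed at most \<open>R\<close> stays
    within \<open>\<eta>\<close> of \<open>X\<close>; adding 1 avoids division by zero.\<close>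
  define d where "d = \<eta> / (R + 1)"
  have d: "d > 0" "t * R < \<eta>" if "0 < t" "t < d" for t
  proof -
    show "d > 0"
      using \<eta>(1) R_nonneg by (simp add: d_def)
    have "t * (R + 1) < \<eta>"
      using that(2) R_nonneg by (simp add: d_def pos_less_divide_eq)
    then show "t * R < \<eta>"
      using that(1) by (simp add: distrib_left)
  qed
  have d0: "d > 0"
    using \<eta>(1) R_nonneg by (simp add: d_def)
  have "\<exists>v. norm v \<le> R \<and> t * (inner v p - f X - \<kappa> - e) \<le> u\<^sub>0 X - u\<^sub>0 (X - tproj (t *\<^sub>R v))"
    if t: "0 < t" "t < d" for t
  proof -
    define T where "T n = real (steps t n) * \<tau> n" for n
    have T: "T n \<le> t" "0 \<le> T n" "T \<longlonglongrightarrow> t" for n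
      using steps[of t] t(1) \<tau>(1) by (auto simp: T_def[abs_def] less_imp_le)
    have F_ev: "\<forall>\<^sub>F n in sequentially. \<forall>X. \<bar>F X (m n) - F X m\<^sub>0\<bar> \<le> e / 2"
      by (rule coupling_uniform_limit[OF F m_lim half_gt_zero[OF assms]])
    \<comment> \<open>The displacement \<open>S\<close> is bounded for every \<open>n\<close>, while
      its inequality is conditional on closeness of the coupling. Thus \<open>S\<close> can be
      chosen for all \<open>n\<close> at once and a convergent subsequence extracted; its limit
      divided by \<open>t\<close> is the average velocity \<open>v\<close>.\<close>
    have "\<exists>S. norm S \<le> t * R \<and> ((\<forall>X. \<bar>F X (m n) - F X m\<^sub>0\<bar> \<le> e / 2) \<longrightarrow>
        inner S p - T n * (f X + e + k n) \<le> u n X - u n (X - tproj S))" for n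
    proof -
      obtain Y v where Y: "Y (steps t n) = X" "\<And>i. i < steps t n \<Longrightarrow> Y (Suc i) = Y i + tproj (\<tau> n *\<^sub>R v i)"
        "\<And>i. i < steps t n \<Longrightarrow> u n (Y (Suc i)) + \<tau> n * k n = u n (Y i) + \<tau> n * lag_at L F (m n) (Y i) (v i)"
        "\<And>i. i < steps t n \<Longrightarrow> norm (v i) \<le> R"
        using lagr.backward_chain[OF lagr[OF m] \<tau>(1)[of n] lax, of "steps t n" X] by blast
      define S where "S = (\<Sum>i<steps t n. \<tau> n *\<^sub>R v i)"
      have "norm S \<le> (\<Sum>i<steps t n. \<tau> n * R)"
        unfolding S_def using Y(4) \<tau>(1)[of n]
        by (intro order_trans[OF norm_sum sum_mono]) (simp add: mult_left_mono)
      also have "\<dots> = T n * R"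
        by (simp add: T_def)
      also have TR: "T n * R \<le> t * R"
        using T(1) R_nonneg by (rule mult_right_mono)
      finally have S: "norm S \<le> t * R" .
      have X_eq: "X - tproj S = Y 0"
        using chain_displacement[where N = "steps t n" and Y = Y and v = v and \<tau> = "\<tau> n", OF Y(2)] Y(1) by (simp add: S_def)
      have "inner S p - T n * (f X + e + k n) \<le> u n X - u n (X - tproj S)"
        if Fn: "\<forall>X. \<bar>F X (m n) - F X m\<^sub>0\<bar> \<le> e / 2"
      proof -
        have "inner S p - T n * (f X + e + k n) = (\<Sum>i<steps t n. \<tau> n * (inner (v i) p - (f X + e + k n)))"
          by (simp add: S_def T_def inner_sum_left sum_subtractf right_diff_distrib)
        also have "\<dots> \<le> (\<Sum>i<steps t n. \<tau> n * (lag_at L F (m n) (Y i) (v i) - k n))"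
        proof (rule sum_mono)
          fix i assume "i \<in> {..<steps t n}"
          then have "dist (Y i) X \<le> T n * R"
            using chain_dist[where N = "steps t n" and i = i and Y = Y and v = v and \<tau> = "\<tau> n", OF Y(2,4) less_imp_le[OF \<tau>(1)] R_nonneg] Y(1) by (simp add: T_def)
          then have "dist (Y i) X < \<eta>"
            using TR d(2)[OF t] by linarith
          then have "\<bar>f (Y i) - f X\<bar> < e / 2"
            by (rule \<eta>(2))
          moreover have "inner p (v i) \<le> L (Y i) (v i) + H (Y i) p"
            unfolding L_eq by (rule lagrangian_young[OF H])
          moreover have "\<bar>F (Y i) (m n) - F (Y i) m\<^sub>0\<bar> \<le> e / 2"
            using Fn by blast
          ultimately have "inner (v i) p - (f X + e + k n) \<le> lag_at L F (m n) (Y i) (v i) - k n"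
            unfolding f_def ham_at_def lag_at_def inner_commute[of "v i"] by linarith
          then show "\<tau> n * (inner (v i) p - (f X + e + k n)) \<le> \<tau> n * (lag_at L F (m n) (Y i) (v i) - k n)"
            using \<tau>(1)[of n] by (intro mult_left_mono) auto
        qed
        also have "\<dots> = u n X - u n (X - tproj S)"
          using lax_chain_eq[where N = "steps t n" and Y = Y and v = v and u = "u n" and \<tau> = "\<tau> n", OF Y(3)] Y(1) X_eq by simp
        finally show ?thesis .
      qed
      with S show ?thesis
        by blast
    qed
    then obtain S where S: "\<And>n. norm (S n) \<le> t * R" "\<And>n. (\<forall>X. \<bar>F X (m n) - F X m\<^sub>0\<bar> \<le> e / 2) \<Longrightarrow>
        inner (S n) p - T n * (f X + e + k n) \<le> u n X - u n (X - tproj (S n))"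
      by metis
    have "bounded (range S)"
      using S(1) by (auto simp: bounded_iff)
    then obtain S0 r where r: "strict_mono (r :: nat \<Rightarrow> nat)" "(S \<circ> r) \<longlonglongrightarrow> S0"
      using bounded_imp_convergent_subsequence by blast
    have Sr: "(\<lambda>n. S (r n)) \<longlonglongrightarrow> S0"
      using r(2) by (simp add: o_def)
    have S0: "norm S0 \<le> t * R"
      by (rule LIMSEQ_le_const2[OF tendsto_norm[OF Sr]]) (use S(1) in auto)
    have "\<forall>\<^sub>F n in sequentially. inner (S (r n)) p - T (r n) * (f X + e + k (r n)) \<le> u (r n) X - u (r n) (X - tproj (S (r n)))"
      using eventually_subseq[OF r(1) F_ev] by eventually_elim (rule S(2))
    moreover have "(\<lambda>n. inner (S (r n)) p - T (r n) * (f X + e + k (r n))) \<longlonglongrightarrow> inner S0 p - t * (f X + e + \<kappa>)"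
      using LIMSEQ_subseq_LIMSEQ[OF T(3) r(1)] LIMSEQ_subseq_LIMSEQ[OF k_lim r(1)] Sr
      by (intro tendsto_intros) (auto simp: o_def)
    moreover have "(\<lambda>n. u (r n) X - u (r n) (X - tproj (S (r n)))) \<longlonglongrightarrow> u\<^sub>0 X - u\<^sub>0 (X - tproj S0)"
    proof -
      have ur: "uniform_limit UNIV (\<lambda>n. u (r n)) u\<^sub>0 sequentially"
        by (rule filterlim_compose[OF u_lim filterlim_subseq[OF r(1)]])
      show ?thesis
        by (intro tendsto_diff uniform_limit_seq[OF ur cont_u\<^sub>0] shift_tendsto Sr tendsto_const)
    qed
    ultimately have "inner S0 p - t * (f X + e + \<kappa>) \<le> u\<^sub>0 X - u\<^sub>0 (X - tproj S0)"
      by (intro tendsto_le[OF sequentially_bot]) auto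
    moreover have "norm (S0 /\<^sub>R t) \<le> R" "t *\<^sub>R (S0 /\<^sub>R t) = S0"
      using S0 t(1) by (simp_all add: field_simps)
    moreover have "t * (inner (S0 /\<^sub>R t) p - f X - \<kappa> - e) = inner S0 p - t * (f X + e + \<kappa>)"
      using t(1) by (simp add: field_simps)
    ultimately show ?thesis
      by (intro exI[of _ "S0 /\<^sub>R t"]) simp
  qed
  then show ?thesis
    using that d0 by (simp add: f_def)
qed

lemma rate_gradient:
  assumes "e > 0" "GDERIV \<phi> x :> D"
  obtains d where "d > 0" "\<And>t v. 0 < t \<Longrightarrow> t * norm v < d \<Longrightarrow>
    \<bar>\<phi> x - \<phi> (x - t *\<^sub>R v) - t * inner v D\<bar> \<le> t * (e * norm v)"
proof -
  obtain d where d: "d > 0" "\<And>y. norm (y - x) < d \<Longrightarrow> norm (\<phi> y - \<phi> x - inner (y - x) D) \<le> e * norm (y - x)"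
    using assms unfolding gderiv_def has_derivative_at_alt by blast
  have "\<bar>\<phi> x - \<phi> (x - t *\<^sub>R v) - t * inner v D\<bar> \<le> t * (e * norm v)" if "0 < t" "t * norm v < d" for t v
    using d(2)[of "x - t *\<^sub>R v"] that by (simp add: abs_minus_commute algebra_simps)
  then show ?thesis
    using that d(1) by blast
qed

text \<open>The velocity \<open>w\<close> dual to \<open>D\<close> makes Young's inequality an
  equality, so the upper rate in this one direction already bounds the Hamiltonian.
  Differentiability of \<open>\<phi>\<close> at the single point \<open>x\<close> suffices, so
  \<open>u\<^sub>0\<close> itself can later play the role of \<open>\<phi>\<close>.\<close>

lemma touching_above:
  assumes D: "GDERIV \<phi> x :> D" and "\<forall>\<^sub>F y in nhds x. u\<^sub>0 (tproj y) - \<phi> y \<le> u\<^sub>0 (tproj x) - \<phi> x"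
  shows "ham_at H F m\<^sub>0 (tproj x) D \<le> - \<kappa>"
proof -
  obtain d1 where d1: "d1 > 0" "\<And>y. dist y x < d1 \<Longrightarrow> u\<^sub>0 (tproj y) - \<phi> y \<le> u\<^sub>0 (tproj x) - \<phi> x"
    using assms(2) unfolding eventually_nhds_metric by blast
  let ?X = "tproj x"
  define w where "w = grad (H ?X) D"
  show ?thesis
  proof (rule le_if_le_add_multiples[of "1 + norm w"])
    fix e :: real assume "e > 0"
    obtain d2 where d2: "d2 > 0" "\<And>t. 0 < t \<Longrightarrow> t < d2 \<Longrightarrow>
        u\<^sub>0 ?X - u\<^sub>0 (?X - tproj (t *\<^sub>R w)) \<le> t * (lag_at L F m\<^sub>0 ?X w - \<kappa> + e)"
      using upper_rate[OF \<open>e > 0\<close>, of ?X w] by blast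
    obtain d3 where d3: "d3 > 0" "\<And>t v. 0 < t \<Longrightarrow> t * norm v < d3 \<Longrightarrow>
        \<bar>\<phi> x - \<phi> (x - t *\<^sub>R v) - t * inner v D\<bar> \<le> t * (e * norm v)"
      using rate_gradient[OF \<open>e > 0\<close> D] by blast
    define a where "a = min d1 d3 / (norm w + 1)"
    define t where "t = min d2 a / 2"
    have n: "0 < norm w + 1"
      by (simp add: add_nonneg_pos)
    then have "0 < a"
      using d1(1) d3(1) by (simp add: a_def)
    then have t: "0 < t" "t < d2" "t < a"
      using d2(1) by (auto simp: t_def min_def)
    then have "t * (norm w + 1) < min d1 d3"
      using n by (simp add: a_def pos_less_divide_eq)
    moreover have "t * norm w < t * (norm w + 1)"
      using t(1) by (intro mult_strict_left_mono) auto
    ultimately have tw: "t * norm w < d1" "t * norm w < d3"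
      by auto
    have "\<phi> x - \<phi> (x - t *\<^sub>R w) \<le> u\<^sub>0 ?X - u\<^sub>0 (?X - tproj (t *\<^sub>R w))"
      using d1(2)[of "x - t *\<^sub>R w"] t tw by (simp add: dist_norm tproj_diff)
    also have "\<dots> \<le> t * (lag_at L F m\<^sub>0 ?X w - \<kappa> + e)"
      by (rule d2(2)[OF t(1,2)])
    finally have "t * inner w D \<le> t * (lag_at L F m\<^sub>0 ?X w - \<kappa> + e) + t * (e * norm w)"
      using d3(2)[OF t(1) tw(2)] by linarith
    then have "t * inner w D \<le> t * (lag_at L F m\<^sub>0 ?X w - \<kappa> + e + e * norm w)"
      by (simp add: distrib_left)
    then have "inner w D \<le> lag_at L F m\<^sub>0 ?X w - \<kappa> + e + e * norm w"
      using t(1) by simp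
    moreover have "L ?X w + H ?X D = inner D w"
      unfolding L_eq w_def by (rule lagrangian_attained[OF H])
    ultimately show "ham_at H F m\<^sub>0 ?X D \<le> - \<kappa> + e * (1 + norm w)"
      by (simp add: ham_at_def lag_at_def inner_commute algebra_simps)
  qed (simp add: add_nonneg_nonneg)
qed

lemma viscosity_limit: "viscosity_solution (ham_at H F m\<^sub>0) (- \<kappa>) u\<^sub>0"
  unfolding viscosity_solution_def
proof (intro conjI allI impI cont_u\<^sub>0)
  fix \<phi> and x :: "real ^ 'd"
  assume \<phi>: "C_k 1 \<phi>" and *: "\<forall>\<^sub>F y in nhds x. u\<^sub>0 (tproj y) - \<phi> y \<le> u\<^sub>0 (tproj x) - \<phi> x"
  obtain D where D: "GDERIV \<phi> x :> D" "grad \<phi> x = D"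
    using C_k_gradient[of 0 \<phi>] \<phi> grad_eqI unfolding One_nat_def by metis
  show "ham_at H F m\<^sub>0 (tproj x) (grad \<phi> x) \<le> - \<kappa>"
    unfolding D(2) by (rule touching_above[OF D(1) *])
next
  fix \<phi> and x :: "real ^ 'd"
  assume \<phi>: "C_k 1 \<phi>" and "\<forall>\<^sub>F y in nhds x. u\<^sub>0 (tproj y) - \<phi> y \<ge> u\<^sub>0 (tproj x) - \<phi> x"
  then obtain d1 where d1: "d1 > 0" "\<And>y. dist y x < d1 \<Longrightarrow> u\<^sub>0 (tproj y) - \<phi> y \<ge> u\<^sub>0 (tproj x) - \<phi> x"
    unfolding eventually_nhds_metric by blast
  obtain D where D: "GDERIV \<phi> x :> D" "grad \<phi> x = D"
    using C_k_gradient[of 0 \<phi>] \<phi> grad_eqI unfolding One_nat_def by metis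
  let ?X = "tproj x"
  have "- \<kappa> \<le> ham_at H F m\<^sub>0 ?X (grad \<phi> x)"
  proof (rule le_if_le_add_multiples[of "1 + R"])
    fix e :: real assume "e > 0"
    obtain d2 where d2: "d2 > 0" "\<And>t. 0 < t \<Longrightarrow> t < d2 \<Longrightarrow> \<exists>v. norm v \<le> R \<and>
        t * (inner v D - ham_at H F m\<^sub>0 ?X D - \<kappa> - e) \<le> u\<^sub>0 ?X - u\<^sub>0 (?X - tproj (t *\<^sub>R v))"
      using lower_rate[OF \<open>e > 0\<close>, of D ?X] by blast
    obtain d3 where d3: "d3 > 0" "\<And>t v. 0 < t \<Longrightarrow> t * norm v < d3 \<Longrightarrow>
        \<bar>\<phi> x - \<phi> (x - t *\<^sub>R v) - t * inner v D\<bar> \<le> t * (e * norm v)"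
      using rate_gradient[OF \<open>e > 0\<close> D(1)] by blast
    define a where "a = min d1 d3 / (R + 1)"
    define t where "t = min d2 a / 2"
    have n: "0 < R + 1"
      using R_nonneg by simp
    then have "0 < a"
      using d1(1) d3(1) by (simp add: a_def)
    then have t: "0 < t" "t < d2" "t < a"
      using d2(1) by (auto simp: t_def min_def)
    then have tR: "t * (R + 1) < min d1 d3"
      using n by (simp add: a_def pos_less_divide_eq)
    obtain v where v: "norm v \<le> R"
        "t * (inner v D - ham_at H F m\<^sub>0 ?X D - \<kappa> - e) \<le> u\<^sub>0 ?X - u\<^sub>0 (?X - tproj (t *\<^sub>R v))"
      using d2(2)[OF t(1,2)] by blast
    have "t * norm v < t * (R + 1)"
      using v(1) R_nonneg t(1) by (intro mult_strict_left_mono) auto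
    then have tv: "t * norm v < d1" "t * norm v < d3"
      using tR by auto
    note v(2)
    also have "u\<^sub>0 ?X - u\<^sub>0 (?X - tproj (t *\<^sub>R v)) \<le> \<phi> x - \<phi> (x - t *\<^sub>R v)"
      using d1(2)[of "x - t *\<^sub>R v"] t tv by (simp add: dist_norm tproj_diff)
    finally have "t * (inner v D - ham_at H F m\<^sub>0 ?X D - \<kappa> - e) \<le> t * inner v D + t * (e * norm v)"
      using d3(2)[OF t(1) tv(2)] by linarith
    then have "t * (inner v D - ham_at H F m\<^sub>0 ?X D - \<kappa> - e) \<le> t * (inner v D + e * norm v)"
      by (simp add: distrib_left)
    \<comment> \<open>The velocity \<open>v\<close> depends on \<open>t\<close>, but
      \<open>inner v D\<close> occurs on both sides and cancels, so no limit of \<open>v\<close> as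
      \<open>t\<close> tends to 0 has to be taken.\<close>
    then have "inner v D - ham_at H F m\<^sub>0 ?X D - \<kappa> - e \<le> inner v D + e * norm v"
      using t(1) by simp
    moreover have "e * norm v \<le> e * R"
      using v(1) \<open>e > 0\<close> by simp
    ultimately show "- \<kappa> \<le> ham_at H F m\<^sub>0 ?X (grad \<phi> x) + e * (1 + R)"
      unfolding D(2) by (simp add: algebra_simps)
  qed (use R_nonneg in simp)
  then show "ham_at H F m\<^sub>0 ?X (grad \<phi> x) \<ge> - \<kappa>" .
qed

lemma mane_value_limit: "mane_value (ham_at H F m\<^sub>0) = - \<kappa>"
proof -
  obtain B where B: "\<And>X. \<bar>F X m\<^sub>0\<bar> \<le> B"
    using coupling_bounded[OF F] m\<^sub>0 by metis
  obtain C where C: "\<And>K X p. K > 0 \<Longrightarrow> K * norm p + C K \<le> H X p"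
    using tonelli_superlinear[OF H] by blast
  have "norm p + (C 1 - B) \<le> ham_at H F m\<^sub>0 X p" for X p
    using B[of X] C[of 1 p X] by (simp add: ham_at_def abs_le_iff)
  then show ?thesis
    by (rule mane_value_eqI[OF continuous_ham _ viscosity_limit])
qed

end

section \<open>Gradients on the support of the limit measure and the continuity equation\<close>

lemma tendsto_torus_shift:
  fixes X :: "'d::finite torus"
  assumes "Xs \<longlonglongrightarrow> X" "s \<longlonglongrightarrow> s0"
  shows "(\<lambda>n. Xs n + tproj (s n)) \<longlonglongrightarrow> X + tproj s0"
proof -
  have "continuous_on UNIV (\<lambda>z :: 'd torus \<times> (real ^ 'd). fst z + tproj (snd z))"
    by (intro continuous_torus_shift continuous_intros)
  from continuous_on_tendsto_compose[OF this tendsto_Pair[OF assms]] show ?thesis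
    by simp
qed

locale mfg_measure_limit = mfg_limit L F CL UL H \<tau> k \<kappa> m m\<^sub>0 u u\<^sub>0
  for L :: "'d::finite torus \<Rightarrow> real ^ 'd \<Rightarrow> real" and F CL UL H \<tau> k \<kappa> m m\<^sub>0 u u\<^sub>0 +
  fixes \<mu> :: "nat \<Rightarrow> ('d torus \<times> (real ^ 'd)) measure" and \<mu>\<^sub>0 :: "('d torus \<times> (real ^ 'd)) measure"
  assumes hol: "\<And>n. \<mu> n \<in> holonomic (\<tau> n)"
    and int: "\<And>n. integrable (\<mu> n) (\<lambda>(X, v). lag_at L F (m n) X v)"
    and val: "\<And>n. (\<integral>(X, v). lag_at L F (m n) X v \<partial>\<mu> n) \<le> k n"
    and \<mu>\<^sub>0: "\<mu>\<^sub>0 \<in> borel_prob" "AE z in \<mu>\<^sub>0. z \<in> UNIV \<times> cball 0 (lagr.speed CL UL)"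
    and m\<^sub>0_eq: "m\<^sub>0 = distr \<mu>\<^sub>0 borel fst"
    and \<mu>_lim: "\<And>f :: _ \<Rightarrow> real. continuous_on UNIV f \<Longrightarrow> (\<lambda>n. integral\<^sup>L (\<mu> n) f) \<longlonglongrightarrow> integral\<^sup>L \<mu>\<^sub>0 f"
begin

lemma \<mu>: "\<mu> n \<in> borel_prob"
  by (rule holonomicD(1)[OF hol])

lemma calibrated_spt:
  assumes "(X, v) \<in> spt (\<mu> n)"
  shows "u n (X + tproj (\<tau> n *\<^sub>R v)) + \<tau> n * k n = u n X + \<tau> n * lag_at L F (m n) X v" "norm v \<le> R"
  using lagr.calibrated_on_spt[OF lagr[OF m] \<tau>(1) lax hol int val assms] by (blast+)

lemma compact_K: "compact (UNIV \<times> cball 0 R :: ('d torus \<times> (real ^ 'd)) set)"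
  by (intro compact_Times compact_torus compact_cball)

lemma spt_subset: "spt (\<mu> n) \<subseteq> UNIV \<times> cball 0 R"
  using calibrated_spt(2) by auto

lemma AE_K: "AE z in \<mu> n. z \<in> UNIV \<times> cball 0 R"
  using AE_spt[OF \<mu>[of n]] spt_subset[of n] by (auto elim: eventually_mono)

lemma compact_spt: "compact (spt (\<mu> n))"
  using compact_Int_closed[OF compact_K spt_closed[of "\<mu> n"]] spt_subset[of n] by (simp add: Int_absorb1)

lemma forward_chain:
  assumes "(X, v) \<in> spt (\<mu> n)"
  obtains Y w where "Y 0 = X" "\<And>i. Y (Suc i) = Y i + tproj (\<tau> n *\<^sub>R w i)" "\<And>i. (Y i, w i) \<in> spt (\<mu> n)"
proof -
  have "\<exists>f. \<forall>i. (f i \<in> spt (\<mu> n) \<and> (i = (0::nat) \<longrightarrow> f i = (X, v))) \<and> fst (f (Suc i)) = fst (f i) + tproj (\<tau> n *\<^sub>R snd (f i))"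
  proof (rule dependent_nat_choice)
    fix z and i :: nat assume "z \<in> spt (\<mu> n) \<and> (i = 0 \<longrightarrow> z = (X, v))"
    then obtain w where "(fst z + tproj (\<tau> n *\<^sub>R snd z), w) \<in> spt (\<mu> n)"
      using holonomic_successor[OF hol compact_spt, of "fst z" "snd z"] by auto
    then show "\<exists>y. (y \<in> spt (\<mu> n) \<and> (Suc i = 0 \<longrightarrow> y = (X, v))) \<and> fst y = fst z + tproj (\<tau> n *\<^sub>R snd z)"
      by (intro exI[of _ "(fst z + tproj (\<tau> n *\<^sub>R snd z), w)"]) simp
  qed (use assms in auto)
  then obtain f where f: "\<And>i. f i \<in> spt (\<mu> n)" "f 0 = (X, v)"
      "\<And>i. fst (f (Suc i)) = fst (f i) + tproj (\<tau> n *\<^sub>R snd (f i))"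
    by blast
  show ?thesis
    by (rule that[of "\<lambda>i. fst (f i)" "\<lambda>i. snd (f i)"]) (use f in auto)
qed

text \<open>Support points of the approximations near \<open>(X, v)\<close> carry affine bounds from
  above and below with common error sizes; their limits squeeze \<open>u\<^sub>0\<close> at
  \<open>X\<close>. One calibrated step, compared with the upper bound, gives
  \<open>L + F - \<kappa> \<le> inner v p0\<close>, and \<open>touching_above\<close> gives
  \<open>H - F \<le> - \<kappa>\<close>; together they force equality in Young's inequality.\<close>

lemma spt_gradient:
  assumes z: "(X, v) \<in> spt \<mu>\<^sub>0"
  shows "\<exists>p. torus_gderiv u\<^sub>0 X p \<and> v = grad (H X) p"
proof -
  obtain zs where zs: "\<And>n. zs n \<in> spt (\<mu> n)" "zs \<longlonglongrightarrow> (X, v)"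
    using spt_approximation[OF \<mu> \<mu>\<^sub>0(1) compact_K AE_K \<mu>\<^sub>0(2) \<mu>_lim z] by blast
  define Xs vs where "Xs n = fst (zs n)" and "vs n = snd (zs n)" for n
  have Xv: "(Xs n, vs n) \<in> spt (\<mu> n)" "Xs \<longlonglongrightarrow> X" "vs \<longlonglongrightarrow> v" for n
    using zs tendsto_fst[OF zs(2)] tendsto_snd[OF zs(2)] by (auto simp: Xs_def[abs_def] vs_def[abs_def])
  show ?thesis
  proof (rule lax_eq_differentials, goal_cases)
    case (1 \<Lambda> \<delta>)
    note \<delta> = 1(1) and upper = 1(2) and lower = 1(3)
    have "\<exists>q. norm q \<le> \<Lambda> \<and> (\<forall>e>0. \<forall>h. norm h \<le> \<delta> e \<longrightarrow> u n (Xs n + tproj h) \<le> u n (Xs n) + inner h q + e * norm h)" for n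
      by (rule upper[OF m \<tau>(1,2) lax])
    then obtain q where q: "\<And>n. norm (q n) \<le> \<Lambda>" "\<And>n e h. e > 0 \<Longrightarrow> norm h \<le> \<delta> e \<Longrightarrow>
        u n (Xs n + tproj h) \<le> u n (Xs n) + inner h (q n) + e * norm h"
      by metis
    have "\<exists>p. norm p \<le> \<Lambda> \<and> (\<forall>e>0. \<forall>h. norm h \<le> \<delta> e \<longrightarrow> u n (Xs n) + inner h p - e * norm h \<le> u n (Xs n + tproj h))" for n
    proof -
      obtain Y w where Y: "Y 0 = Xs n" "\<And>i. Y (Suc i) = Y i + tproj (\<tau> n *\<^sub>R w i)" "\<And>i. (Y i, w i) \<in> spt (\<mu> n)"
        using forward_chain[OF Xv(1)] by blast
      have "u n (Y (Suc i)) + \<tau> n * k n = u n (Y i) + \<tau> n * lag_at L F (m n) (Y i) (w i)" for i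
        using calibrated_spt(1)[OF Y(3)[of i]] Y(2)[of i] by simp
      then show ?thesis
        using lower[OF m \<tau>(1,2) lax, of Y n w] Y calibrated_spt(2)[OF Y(3)] by simp
    qed
    then obtain p where p: "\<And>n. norm (p n) \<le> \<Lambda>" "\<And>n e h. e > 0 \<Longrightarrow> norm h \<le> \<delta> e \<Longrightarrow>
        u n (Xs n) + inner h (p n) - e * norm h \<le> u n (Xs n + tproj h)"
      by metis
    have "norm (q n, p n) \<le> \<Lambda> + \<Lambda>" for n
      using norm_Pair_le[of "q n" "p n"] q(1)[of n] p(1)[of n] by linarith
    then have "bounded (range (\<lambda>n. (q n, p n)))"
      by (auto simp: bounded_iff)
    then obtain qp r where r: "strict_mono (r :: nat \<Rightarrow> nat)" "((\<lambda>n. (q n, p n)) \<circ> r) \<longlonglongrightarrow> qp"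
      using bounded_imp_convergent_subsequence by blast
    define q0 p0 where "q0 = fst qp" and "p0 = snd qp"
    have qr: "(\<lambda>n. q (r n)) \<longlonglongrightarrow> q0" and pr: "(\<lambda>n. p (r n)) \<longlonglongrightarrow> p0"
      using tendsto_fst[OF r(2)] tendsto_snd[OF r(2)] by (simp_all add: q0_def p0_def o_def)
    have Xr: "(\<lambda>n. Xs (r n)) \<longlonglongrightarrow> X" and vr: "(\<lambda>n. vs (r n)) \<longlonglongrightarrow> v"
      using LIMSEQ_subseq_LIMSEQ[OF Xv(2) r(1)] LIMSEQ_subseq_LIMSEQ[OF Xv(3) r(1)] by (simp_all add: o_def)
    have ur: "uniform_limit UNIV (\<lambda>n. u (r n)) u\<^sub>0 sequentially"
      by (rule filterlim_compose[OF u_lim filterlim_subseq[OF r(1)]])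
    note u_shift = uniform_limit_seq[OF ur cont_u\<^sub>0 tendsto_torus_shift[OF Xr tendsto_const]]
      and u_at = uniform_limit_seq[OF ur cont_u\<^sub>0 Xr]
    have up: "u\<^sub>0 (X + tproj h) \<le> u\<^sub>0 X + inner h q0 + e * norm h" if "e > 0" "norm h \<le> \<delta> e" for e h
    proof (rule LIMSEQ_le[OF u_shift])
      show "(\<lambda>n. u (r n) (Xs (r n)) + inner h (q (r n)) + e * norm h) \<longlonglongrightarrow> u\<^sub>0 X + inner h q0 + e * norm h"
        by (intro tendsto_intros u_at qr)
    qed (use q(2)[OF that] in auto)
    have lo: "u\<^sub>0 X + inner h p0 - e * norm h \<le> u\<^sub>0 (X + tproj h)" if "e > 0" "norm h \<le> \<delta> e" for e h
    proof (rule LIMSEQ_le[OF _ u_shift])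
      show "(\<lambda>n. u (r n) (Xs (r n)) + inner h (p (r n)) - e * norm h) \<longlonglongrightarrow> u\<^sub>0 X + inner h p0 - e * norm h"
        by (intro tendsto_intros u_at pr)
    qed (use p(2)[OF that] in auto)
    have pq: "p0 = q0"
    proof (rule ccontr)
      assume "p0 \<noteq> q0"
      define D where "D = norm (p0 - q0)"
      have D: "D > 0"
        using \<open>p0 \<noteq> q0\<close> by (simp add: D_def)
      \<comment> \<open>The two affine bounds together allow an error
        \<open>2 * (e * norm h)\<close>; with this \<open>e\<close> it is only half of
        \<open>inner h (p0 - q0)\<close> for \<open>h\<close> along \<open>p0 - q0\<close>.\<close>
      define e where "e = D / 4"
      have e: "e > 0"
        using D by (simp add: e_def)
      define s where "s = \<delta> e / D"
      have s: "s > 0"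
        using \<delta>[OF e] D by (simp add: s_def)
      define h where "h = s *\<^sub>R (p0 - q0)"
      have h: "norm h = s * D" "norm h \<le> \<delta> e"
        using s D by (simp_all add: h_def D_def[symmetric]) (simp add: s_def)
      have "inner h (p0 - q0) = s * (D * D)"
        by (simp add: h_def D_def power2_norm_eq_inner[symmetric] power2_eq_square)
      moreover have "inner h (p0 - q0) \<le> 2 * (e * norm h)"
        using up[OF e h(2)] lo[OF e h(2)] by (simp add: inner_diff_right)
      moreover have "2 * (e * norm h) = s * (D * D) / 2"
        by (simp add: h(1) e_def)
      ultimately show False
        using s D by simp
    qed
    have grad: "torus_gderiv u\<^sub>0 X p0"
      unfolding torus_gderiv_iff
    proof (intro allI impI)
      fix e :: real assume "e > 0"
      have "\<bar>u\<^sub>0 (X + tproj h) - u\<^sub>0 X - inner h p0\<bar> \<le> e * norm h" if "norm h < \<delta> e" for h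
        using up[OF \<open>e > 0\<close>, of h] lo[OF \<open>e > 0\<close>, of h] that by (simp add: pq abs_le_iff)
      then show "\<exists>d>0. \<forall>h. norm h < d \<longrightarrow> \<bar>u\<^sub>0 (X + tproj h) - u\<^sub>0 X - inner h p0\<bar> \<le> e * norm h"
        using \<delta>[OF \<open>e > 0\<close>] by blast
    qed
    have mr: "limitin weak_star (m \<circ> r) m\<^sub>0 sequentially"
      by (rule limitin_subsequence[OF r(1) m_lim])
    have Llim: "(\<lambda>n. lag_at L F (m (r n)) (Xs (r n)) (vs (r n)) - k (r n)) \<longlonglongrightarrow> lag_at L F m\<^sub>0 X v - \<kappa>"
    proof -
      have "(\<lambda>n. L (Xs (r n)) (vs (r n))) \<longlonglongrightarrow> L X v"
        using continuous_on_tendsto_compose[OF tonelli_continuous[OF L] tendsto_Pair[OF Xr vr]] by simp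
      moreover have "(\<lambda>n. F (Xs (r n)) (m (r n))) \<longlonglongrightarrow> F X m\<^sub>0"
        using coupling_seq_limit(1)[OF F Xr mr] by simp
      moreover have "(\<lambda>n. k (r n)) \<longlonglongrightarrow> \<kappa>"
        using LIMSEQ_subseq_LIMSEQ[OF k_lim r(1)] by (simp add: o_def)
      ultimately show ?thesis
        unfolding lag_at_def by (intro tendsto_intros)
    qed
    \<comment> \<open>A single step is itself a small displacement: once \<open>\<tau> n * R\<close>
      is below \<open>\<delta> e\<close>, the upper expansion applies to
      \<open>\<tau> n *\<^sub>R vs n\<close>, and the factor \<open>\<tau> n\<close> divides
      out.\<close>
    have "lag_at L F m\<^sub>0 X v - \<kappa> \<le> inner v p0"
    proof (rule le_if_le_add_multiples[OF R_nonneg])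
      fix e :: real assume "e > 0"
      have "(\<lambda>n. \<tau> n * R) \<longlonglongrightarrow> 0 * R"
        by (intro tendsto_intros \<tau>)
      then have "\<forall>\<^sub>F n in sequentially. \<tau> n * R < \<delta> e"
        using order_tendstoD(2)[of "\<lambda>n. \<tau> n * R" 0 sequentially "\<delta> e"] \<delta>[OF \<open>e > 0\<close>] by simp
      then have "\<forall>\<^sub>F n in sequentially. lag_at L F (m n) (Xs n) (vs n) - k n \<le> inner (vs n) (q n) + e * R"
      proof eventually_elim
        case (elim n)
        have vR: "norm (vs n) \<le> R"
          by (rule calibrated_spt(2)[OF Xv(1)])
        have norm_eq: "norm (\<tau> n *\<^sub>R vs n) = \<tau> n * norm (vs n)"
          using \<tau>(1)[of n] by simp
        have "\<tau> n * norm (vs n) \<le> \<tau> n * R"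
          using vR less_imp_le[OF \<tau>(1)] by (rule mult_left_mono)
        then have "norm (\<tau> n *\<^sub>R vs n) \<le> \<delta> e"
          unfolding norm_eq using elim by linarith
        from q(2)[OF \<open>e > 0\<close> this, of n]
        have "u n (Xs n + tproj (\<tau> n *\<^sub>R vs n)) \<le> u n (Xs n) + \<tau> n * inner (vs n) (q n) + e * (\<tau> n * norm (vs n))"
          unfolding norm_eq by simp
        moreover have "\<tau> n * (lag_at L F (m n) (Xs n) (vs n) - k n) =
            u n (Xs n + tproj (\<tau> n *\<^sub>R vs n)) - u n (Xs n)"
          unfolding right_diff_distrib using calibrated_spt(1)[OF Xv(1), of n] by linarith
        moreover have "\<tau> n * (inner (vs n) (q n) + e * norm (vs n)) =
            \<tau> n * inner (vs n) (q n) + e * (\<tau> n * norm (vs n))"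
          by (simp add: distrib_left)
        ultimately have "\<tau> n * (lag_at L F (m n) (Xs n) (vs n) - k n) \<le> \<tau> n * (inner (vs n) (q n) + e * norm (vs n))"
          by linarith
        then have "lag_at L F (m n) (Xs n) (vs n) - k n \<le> inner (vs n) (q n) + e * norm (vs n)"
          using \<tau>(1)[of n] by simp
        also have "e * norm (vs n) \<le> e * R"
          using vR \<open>e > 0\<close> by simp
        finally show ?case
          by simp
      qed
      from eventually_subseq[OF r(1) this]
      have "\<forall>\<^sub>F n in sequentially. lag_at L F (m (r n)) (Xs (r n)) (vs (r n)) - k (r n)
          \<le> inner (vs (r n)) (q (r n)) + e * R" .
      moreover have "(\<lambda>n. inner (vs (r n)) (q (r n)) + e * R) \<longlonglongrightarrow> inner v p0 + e * R"
        unfolding pq by (intro tendsto_intros vr qr)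
      ultimately show "lag_at L F m\<^sub>0 X v - \<kappa> \<le> inner v p0 + e * R"
        using Llim by (intro tendsto_le[OF sequentially_bot]) auto
    qed
    moreover have "ham_at H F m\<^sub>0 X p0 \<le> - \<kappa>"
    proof -
      obtain x where x: "tproj x = X"
        using tproj_surj by blast
      have "GDERIV (\<lambda>y. u\<^sub>0 (tproj y)) x :> p0"
        using grad x by (simp add: torus_gderiv_def)
      from touching_above[OF this] show ?thesis
        by (simp add: x)
    qed
    ultimately have "lagrangian H X v + H X p0 \<le> inner p0 v"
      by (simp add: L_eq lag_at_def ham_at_def inner_commute)
    then have "v = grad (H X) p0"
      by (rule lagrangian_equality[OF H])
    with grad show ?case
      by blast
  qed
qed

text \<open>Holonomy makes the increment of \<open>f\<close> over one step integrate to 0. A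
  first-order expansion with error at most \<open>\<tau> n * (e * R)\<close> leaves, after division
  by \<open>\<tau> n\<close>, the integral of \<open>inner (torus_grad f X) v\<close>.\<close>

lemma limit_closed_measure:
  assumes f: "C_k 1 (\<lambda>x. f (tproj x))"
  shows "has_bochner_integral \<mu>\<^sub>0 (\<lambda>z. inner (torus_grad f (fst z)) (snd z)) 0"
proof -
  let ?g = "\<lambda>z :: 'd torus \<times> (real ^ 'd). inner (torus_grad f (fst z)) (snd z)"
  have f1: "C_k (Suc 0) (\<lambda>x. f (tproj x))"
    using f by simp
  note cD = torus_grad_C_k(2)[OF f1]
  have cf: "continuous_on UNIV f"
    by (rule continuous_torus_lift) (rule C_k_continuous[OF f])
  have cg: "continuous_on UNIV ?g"
    by (intro continuous_intros continuous_on_compose2[OF cD]) auto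
  have "\<bar>integral\<^sup>L \<mu>\<^sub>0 ?g\<bar> \<le> 0"
  proof (rule le_if_le_add_multiples[OF R_nonneg])
    fix e :: real assume "e > 0"
    obtain d where d: "d > 0" "\<And>X h. norm h \<le> d \<Longrightarrow> \<bar>f (X + tproj h) - f X - inner h (torus_grad f X)\<bar> \<le> e * norm h"
      using torus_C_k_expansion[OF f1 \<open>e > 0\<close>] by blast
    have "(\<lambda>n. \<tau> n * R) \<longlonglongrightarrow> 0 * R"
      by (intro tendsto_intros \<tau>)
    then have "\<forall>\<^sub>F n in sequentially. \<tau> n * R < d"
      using order_tendstoD(2)[of "\<lambda>n. \<tau> n * R" 0 sequentially d] d(1) by simp
    then have "\<forall>\<^sub>F n in sequentially. \<bar>integral\<^sup>L (\<mu> n) ?g\<bar> \<le> e * R"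
    proof eventually_elim
      case (elim n)
      interpret prob_space "\<mu> n"
        by (rule borel_probD(1)[OF \<mu>])
      note i = integrable_on_compact[OF \<mu> compact_K AE_K]
      have ig: "integrable (\<mu> n) ?g"
        by (rule i[OF cg])
      have i1: "integrable (\<mu> n) (\<lambda>z. f (fst z + tproj (\<tau> n *\<^sub>R snd z)))"
        by (rule i) (intro continuous_on_compose2[OF cf] continuous_torus_shift continuous_intros, auto)
      have i2: "integrable (\<mu> n) (\<lambda>z. f (fst z))"
        by (rule i) (intro continuous_on_compose2[OF cf] continuous_intros, auto)
      have "\<tau> n * integral\<^sup>L (\<mu> n) ?g =
          - (\<integral>z. f (fst z + tproj (\<tau> n *\<^sub>R snd z)) - f (fst z) - \<tau> n * ?g z \<partial>\<mu> n)"
        using ig i1 i2 holonomicD(2)[OF hol cf] by simp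
      also have "\<bar>\<dots>\<bar> \<le> (\<integral>z. \<bar>f (fst z + tproj (\<tau> n *\<^sub>R snd z)) - f (fst z) - \<tau> n * ?g z\<bar> \<partial>\<mu> n)"
        using integral_norm_bound[of "\<mu> n" "\<lambda>z. f (fst z + tproj (\<tau> n *\<^sub>R snd z)) - f (fst z) - \<tau> n * ?g z"] by simp
      also have "\<dots> \<le> (\<integral>z. \<tau> n * (e * R) \<partial>\<mu> n)"
      proof (rule integral_mono_AE)
        show "AE z in \<mu> n. \<bar>f (fst z + tproj (\<tau> n *\<^sub>R snd z)) - f (fst z) - \<tau> n * ?g z\<bar> \<le> \<tau> n * (e * R)"
          using AE_K[of n]
        proof eventually_elim
          case (elim z)
          then have zR: "norm (snd z) \<le> R"
            by (simp add: mem_Times_iff)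
          then have "norm (\<tau> n *\<^sub>R snd z) \<le> \<tau> n * R"
            using \<tau>(1)[of n] by simp
          then have "norm (\<tau> n *\<^sub>R snd z) \<le> d"
            using \<open>\<tau> n * R < d\<close> by linarith
          from d(2)[OF this, of "fst z"]
          have "\<bar>f (fst z + tproj (\<tau> n *\<^sub>R snd z)) - f (fst z) - \<tau> n * ?g z\<bar> \<le> \<tau> n * (e * norm (snd z))"
            using \<tau>(1)[of n] by (simp add: inner_commute mult.left_commute)
          also have "\<dots> \<le> \<tau> n * (e * R)"
            using zR \<tau>(1)[of n] \<open>e > 0\<close> by (intro mult_left_mono) auto
          finally show ?case .
        qed
      qed (use ig i1 i2 in auto)
      also have "\<dots> = \<tau> n * (e * R)"
        by (simp add: prob_space)
      finally show ?case
        using \<tau>(1)[of n] by (simp add: abs_mult)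
    qed
    moreover have "(\<lambda>n. \<bar>integral\<^sup>L (\<mu> n) ?g\<bar>) \<longlonglongrightarrow> \<bar>integral\<^sup>L \<mu>\<^sub>0 ?g\<bar>"
      by (intro tendsto_rabs \<mu>_lim cg)
    ultimately show "\<bar>integral\<^sup>L \<mu>\<^sub>0 ?g\<bar> \<le> 0 + e * R"
      by (intro tendsto_upperbound[of _ _ sequentially]) auto
  qed
  then show ?thesis
    using integrable_on_compact[OF \<mu>\<^sub>0(1) compact_K \<mu>\<^sub>0(2) cg] by (simp add: has_bochner_integral_iff)
qed

lemma MFG_solution_limit: "MFG_solution H F u\<^sub>0 m\<^sub>0"
proof -
  note fst_meas = distr_fst_borel_prob(1)[OF \<mu>\<^sub>0(1)]
  have g: "AE z in \<mu>\<^sub>0. torus_gderiv u\<^sub>0 (fst z) (torus_grad u\<^sub>0 (fst z)) \<and> snd z = grad (H (fst z)) (torus_grad u\<^sub>0 (fst z))"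
    using AE_spt[OF \<mu>\<^sub>0(1)]
  proof eventually_elim
    case (elim z)
    then obtain p where p: "torus_gderiv u\<^sub>0 (fst z) p" "snd z = grad (H (fst z)) p"
      using spt_gradient[of "fst z" "snd z"] by auto
    then show ?case
      using torus_grad_eqI[OF p(1)] by simp
  qed
  have AE: "AE X in m\<^sub>0. \<exists>D. torus_gderiv u\<^sub>0 X D"
    unfolding m\<^sub>0_eq
  proof (subst AE_distr_iff[OF fst_meas])
    show "{X \<in> space borel. \<exists>D. torus_gderiv u\<^sub>0 X D} \<in> sets borel"
      using torus_gderiv_borel[OF cont_u\<^sub>0] by simp
    show "AE z in \<mu>\<^sub>0. \<exists>D. torus_gderiv u\<^sub>0 (fst z) D"
      using g by eventually_elim blast
  qed
  have "has_bochner_integral m\<^sub>0 (\<lambda>X. inner (torus_grad f X) (grad (H X) (torus_grad u\<^sub>0 X))) 0"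
    if f: "\<forall>k. C_k k (\<lambda>x. f (tproj x))" for f
  proof -
    have f1: "C_k 1 (\<lambda>x. f (tproj x))"
      using f by blast
    then have f2: "C_k (Suc 0) (\<lambda>x. f (tproj x))"
      by simp
    \<comment> \<open>The integrand has to be Borel on the torus, not just determined almost
      everywhere, in order to move the integral from phase space to
      \<open>m\<^sub>0\<close>.\<close>
    have "(\<lambda>X. (X, torus_grad u\<^sub>0 X)) \<in> borel_measurable borel"
      by (intro borel_measurable_Pair torus_grad_measurable[OF cont_u\<^sub>0]) simp
    from measurable_compose[OF this borel_measurable_continuous_onI[OF tonelli_grad(2)[OF H]]]
    have "(\<lambda>X. grad (H X) (torus_grad u\<^sub>0 X)) \<in> borel_measurable borel"
      by simp
    then have meas: "(\<lambda>X. inner (torus_grad f X) (grad (H X) (torus_grad u\<^sub>0 X))) \<in> borel_measurable borel"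
      by (rule borel_measurable_inner[OF borel_measurable_continuous_onI[OF torus_grad_C_k(2)[OF f2]]])
    have hb: "has_bochner_integral \<mu>\<^sub>0 (\<lambda>z. inner (torus_grad f (fst z)) (snd z)) 0"
      by (rule limit_closed_measure[OF f1])
    have "has_bochner_integral \<mu>\<^sub>0 (\<lambda>z. inner (torus_grad f (fst z)) (grad (H (fst z)) (torus_grad u\<^sub>0 (fst z)))) 0"
    proof (rule has_bochner_integral_cong_AE[THEN iffD1, OF _ _ _ hb])
      show "(\<lambda>z. inner (torus_grad f (fst z)) (snd z)) \<in> borel_measurable \<mu>\<^sub>0"
        using hb by (auto simp: has_bochner_integral_iff)
      show "(\<lambda>z. inner (torus_grad f (fst z)) (grad (H (fst z)) (torus_grad u\<^sub>0 (fst z)))) \<in> borel_measurable \<mu>\<^sub>0"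
        by (rule measurable_compose[OF fst_meas meas])
      show "AE z in \<mu>\<^sub>0. inner (torus_grad f (fst z)) (snd z) =
          inner (torus_grad f (fst z)) (grad (H (fst z)) (torus_grad u\<^sub>0 (fst z)))"
        using g by eventually_elim simp
    qed
    then show ?thesis
      unfolding m\<^sub>0_eq by (rule has_bochner_integral_distr[OF meas fst_meas])
  qed
  then show ?thesis
    unfolding MFG_solution_def mane_value_limit using m\<^sub>0 viscosity_limit AE by blast
qed

end

text \<open>Part (2) starts from any family of limits satisfying (1), so its input is extracted from
  the limit relations. The sup bound on \<open>u0\<close> comes from \<open>discounted_close\<close>
  with the oscillation bound that is uniform in the time step.\<close>

lemma (in mfg_lagrangian) vanishing_discount_limitD:
  fixes u0 :: "'d torus \<Rightarrow> real"
  assumes \<tau>: "\<tau> \<in> {0<..<1}"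
    and mm: "\<And>lam. lam \<in> {0<..1} \<Longrightarrow> mm lam \<in> borel_prob \<and>
      (\<exists>\<mu>. minimizing_discounted \<tau> lam (lag_at L F (mm lam)) \<mu> \<and> mm lam = distr \<mu> borel fst)"
    and lim: "vanishing_discount_limit L F \<tau> mm lams m0 u0"
  shows "m0 \<in> borel_prob" "lax_eq \<tau> (lag_at L F m0) 1 (\<tau> * effective_const \<tau> (lag_at L F m0)) u0"
    "\<bar>u0 X\<bar> \<le> (UL 1 - CL 1) * (torus_diam TYPE('d) + 1)"
    "\<exists>\<mu>. \<mu> \<in> holonomic \<tau> \<and> integrable \<mu> (\<lambda>(X, v). lag_at L F m0 X v) \<and>
      (\<integral>(X, v). lag_at L F m0 X v \<partial>\<mu>) \<le> effective_const \<tau> (lag_at L F m0) \<and> m0 = distr \<mu> borel fst"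
proof -
  have \<tau>0: "\<tau> > 0" "\<tau> \<le> 1"
    using \<tau> by auto
  have lams: "lams i \<in> {0<..1}" "lams \<longlonglongrightarrow> 0"
    and mlim: "limitin weak_star (\<lambda>i. mm (lams i)) m0 sequentially"
    and ulim: "uniform_limit UNIV (\<lambda>i X. discounted_solution \<tau> (lams i) (lag_at L F (mm (lams i))) X
        - effective_const \<tau> (lag_at L F (mm (lams i))) / lams i) u0 sequentially"
    and hol: "MFG_minimizing_holonomic \<tau> L F m0"
    and sol: "lax_oleinik_solution \<tau> (lag_at L F m0) (effective_const \<tau> (lag_at L F m0)) u0" for i
    using lim by (auto simp: vanishing_discount_limit_def)
  have ms: "mm (lams i) \<in> borel_prob" for i
    using mm[OF lams(1)] by blast
  show m0: "m0 \<in> borel_prob"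
    using hol by (simp add: MFG_minimizing_holonomic_def)
  show "lax_eq \<tau> (lag_at L F m0) 1 (\<tau> * effective_const \<tau> (lag_at L F m0)) u0"
    using sol lagr.lax_oleinik_iff[OF lagr[OF m0] \<tau>0(1)] by blast
  let ?B = "(UL 1 - CL 1) * (torus_diam TYPE('d) + 1)"
  have "\<bar>discounted_solution \<tau> (lams i) (lag_at L F (mm (lams i))) X
      - effective_const \<tau> (lag_at L F (mm (lams i))) / lams i\<bar> \<le> ?B" for i X
  proof -
    interpret lm: lagr "lag_at L F (mm (lams i))" CL UL
      by (rule lagr[OF ms])
    have l: "0 < lams i" "\<tau> * lams i \<le> 1"
      using lams(1)[of i] \<tau> by (auto intro: mult_le_one)
    obtain w where w: "lax_eq \<tau> (lag_at L F (mm (lams i))) 1 (\<tau> * effective_const \<tau> (lag_at L F (mm (lams i)))) w"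
      using lm.effective_const_solution[OF \<tau>0(1)] by blast
    have "lax_eq \<tau> (lag_at L F (mm (lams i))) (1 - \<tau> * lams i) 0
        (discounted_solution \<tau> (lams i) (lag_at L F (mm (lams i))))"
      using lm.discounted_solution_iff[OF \<tau>0(1) l] by blast
    from lm.discounted_close[OF \<tau>0(1) l this w lm.lax_eq_uniform_osc[OF \<tau>0 w]] show ?thesis .
  qed
  moreover have "(\<lambda>i. \<bar>discounted_solution \<tau> (lams i) (lag_at L F (mm (lams i))) X
      - effective_const \<tau> (lag_at L F (mm (lams i))) / lams i\<bar>) \<longlonglongrightarrow> \<bar>u0 X\<bar>"
    using tendsto_uniform_limitI[OF ulim] by (intro tendsto_rabs) auto
  ultimately show "\<bar>u0 X\<bar> \<le> ?B"
    by (intro LIMSEQ_le_const2[of _ "\<bar>u0 X\<bar>"]) auto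
  obtain \<mu>s where \<mu>s: "\<And>i. minimizing_discounted \<tau> (lams i) (lag_at L F (mm (lams i))) (\<mu>s i)"
    using mm[OF lams(1)] by metis
  have bp: "\<mu>s i \<in> borel_prob" for i
    using \<mu>s[of i] by (simp add: minimizing_discounted_def holonomic_def)
  define K :: "('d torus \<times> (real ^ 'd)) set" where
    "K = UNIV \<times> cball 0 (lagr.osc_bound TYPE('d) CL UL \<tau> + UL 0 - CL 1)"
  have K: "compact K" "AE z in \<mu>s i. z \<in> K" for i
    using discounted_support[OF \<tau> lams(1) ms \<mu>s, of i]
    by (auto simp: K_def intro!: compact_Times compact_torus)
  obtain \<mu> where \<mu>: "minimizing_holonomic \<tau> (lag_at L F m0) \<mu>" "m0 = distr \<mu> borel fst"
    using hol by (auto simp: MFG_minimizing_holonomic_def)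
  \<comment> \<open>\<open>minimizing_holonomic\<close> compares actions without giving their value.
    A weak limit of the discounted minimizers attains the effective constant, and
    \<open>\<mu>\<close> does at least as well.\<close>
  have "(\<integral>(X, v). lag_at L F m0 X v \<partial>\<mu>) \<le> effective_const \<tau> (lag_at L F m0)"
  proof (rule weak_compactness_on_compact[where \<mu>s = \<mu>s, OF bp K], goal_cases)
    case (1 r \<nu>)
    have mr: "limitin weak_star (\<lambda>i. mm (lams (r i))) m0 sequentially"
      using limitin_subsequence[OF 1(1) mlim] by (simp add: o_def)
    have lr: "(\<lambda>i. lams (r i)) \<longlonglongrightarrow> 0"
      using LIMSEQ_subseq_LIMSEQ[OF lams(2) 1(1)] by (simp add: o_def)
    note \<nu> = discounted_measure_limit[OF \<tau> lams(1) lr ms mr \<mu>s K(1) K(2) 1(2,3,4)]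
    have "\<nu> \<in> holonomic \<tau>" "integrable \<nu> (\<lambda>(X, v). lag_at L F m0 X v)"
      using \<nu>(1) by (auto simp: minimizing_holonomic_def)
    then have "(\<integral>(X, v). lag_at L F m0 X v \<partial>\<mu>) \<le> (\<integral>(X, v). lag_at L F m0 X v \<partial>\<nu>)"
      using \<mu>(1) unfolding minimizing_holonomic_def by blast
    then show ?case
      using \<nu>(2) by simp
  qed
  then show "\<exists>\<mu>. \<mu> \<in> holonomic \<tau> \<and> integrable \<mu> (\<lambda>(X, v). lag_at L F m0 X v) \<and>
      (\<integral>(X, v). lag_at L F m0 X v \<partial>\<mu>) \<le> effective_const \<tau> (lag_at L F m0) \<and> m0 = distr \<mu> borel fst"
    using \<mu> by (auto simp: minimizing_holonomic_def)
qed

text \<open>Three extractions: functions by the uniform Lipschitz bound, constants by boundedness,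
  and measures on phase space by the common speed bound. Convergence of the projections alone would
  lose the velocities that enter the continuity equation.\<close>

lemma (in mfg_lagrangian) vanishing_step_limit:
  fixes m :: "nat \<Rightarrow> 'd torus measure" and u :: "nat \<Rightarrow> 'd torus \<Rightarrow> real"
  assumes H: "tonelli H" and L_eq: "L = lagrangian H"
    and \<tau>: "\<And>n. 0 < \<tau> n" "\<And>n. \<tau> n < 1" "\<tau> \<longlonglongrightarrow> 0"
    and m: "\<And>n. m n \<in> borel_prob"
    and lax: "\<And>n. lax_eq (\<tau> n) (lag_at L F (m n)) 1 (\<tau> n * k n) (u n)"
    and bound: "\<And>n X. \<bar>u n X\<bar> \<le> B"
    and \<mu>: "\<And>n. \<mu> n \<in> holonomic (\<tau> n)" "\<And>n. integrable (\<mu> n) (\<lambda>(X, v). lag_at L F (m n) X v)"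
      "\<And>n. (\<integral>(X, v). lag_at L F (m n) X v \<partial>\<mu> n) \<le> k n" "\<And>n. m n = distr (\<mu> n) borel fst"
  obtains r m\<^sub>0 u\<^sub>0 where "strict_mono (r :: nat \<Rightarrow> nat)" "limitin weak_star (m \<circ> r) m\<^sub>0 sequentially"
    "uniform_limit UNIV (u \<circ> r) u\<^sub>0 sequentially" "MFG_solution H F u\<^sub>0 m\<^sub>0"
proof -
  let ?R = "lagr.speed CL UL" and ?K = "UNIV \<times> cball 0 (lagr.speed CL UL) :: ('d torus \<times> (real ^ 'd)) set"
  have bp: "\<mu> n \<in> borel_prob" for n
    by (rule holonomicD(1)[OF \<mu>(1)])
  have K: "compact ?K"
    by (intro compact_Times compact_torus compact_cball)
  have AE_K: "AE z in \<mu> n. z \<in> ?K" for n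
    using AE_spt[OF bp[of n]]
  proof eventually_elim
    case (elim z)
    then show ?case
      using lagr.calibrated_on_spt(2)[OF lagr[OF m] \<tau>(1) lax \<mu>(1-3), of "fst z" "snd z" n]
      by (simp add: mem_Times_iff)
  qed
  define C where "C = \<bar>UL (?R + 1)\<bar> + 1"
  have ul: "\<bar>u n X - u n Y\<bar> \<le> C * dist X Y" for n X Y
  proof -
    have "\<bar>u n X - u n Y\<bar> \<le> UL (?R + 1) * dist X Y"
      by (rule lagr.lax_eq_uniform_lipschitz[OF lagr[OF m] \<tau>(1) lax])
    also have "\<dots> \<le> C * dist X Y"
      by (intro mult_right_mono) (auto simp: C_def)
    finally show ?thesis .
  qed
  have eqc: "\<exists>d>0. \<forall>n X Y. dist X Y < d \<longrightarrow> \<bar>u n X - u n Y\<bar> < e" if "e > 0" for e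
    using that ul by (intro exI[of _ "e / C"]) (auto simp: C_def field_simps intro: le_less_trans)
  obtain r1 u\<^sub>0 where r1: "strict_mono (r1 :: nat \<Rightarrow> nat)" "uniform_limit UNIV (\<lambda>n. u (r1 n)) u\<^sub>0 sequentially"
    using Arzela_Ascoli_torus[OF bound eqc] by metis
  have "\<bar>k n\<bar> \<le> max \<bar>CL 1\<bar> \<bar>UL 0\<bar>" for n
    using lagr.constant_bounds[OF lagr[OF m] \<tau>(1) lax, of n] by simp
  then have "bounded (range (\<lambda>n. k (r1 n)))"
    by (auto simp: bounded_iff)
  then obtain r2 \<kappa> where r2: "strict_mono (r2 :: nat \<Rightarrow> nat)" "((\<lambda>n. k (r1 n)) \<circ> r2) \<longlonglongrightarrow> \<kappa>"
    using bounded_imp_convergent_subsequence by blast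
  show ?thesis
  proof (rule weak_compactness_on_compact[where \<mu>s = "\<lambda>n. \<mu> (r1 (r2 n))", OF bp K AE_K], goal_cases)
    case (1 r3 \<mu>\<^sub>0)
    define r where "r n = r1 (r2 (r3 n))" for n
    have r: "strict_mono r"
      using strict_mono_o[OF r1(1) strict_mono_o[OF r2(1) 1(1)]] by (simp add: r_def[abs_def] o_def)
    define m\<^sub>0 where "m\<^sub>0 = distr \<mu>\<^sub>0 borel fst"
    have mlim: "limitin weak_star (\<lambda>n. m (r n)) m\<^sub>0 sequentially"
    proof (subst limitin_weak_star[OF m], intro conjI allI impI)
      show "m\<^sub>0 \<in> borel_prob"
        unfolding m\<^sub>0_def by (rule distr_fst_borel_prob(2)[OF 1(2)])
      fix f :: "'d torus \<Rightarrow> real" assume f: "continuous_on UNIV f"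
      have "(\<lambda>n. \<integral>z. f (fst z) \<partial>\<mu> (r n)) \<longlonglongrightarrow> (\<integral>z. f (fst z) \<partial>\<mu>\<^sub>0)"
        unfolding r_def by (rule 1(4)) (intro continuous_on_compose2[OF f] continuous_intros, auto)
      then show "(\<lambda>n. integral\<^sup>L (m (r n)) f) \<longlonglongrightarrow> integral\<^sup>L m\<^sub>0 f"
        using integral_distr_fst[OF bp f] integral_distr_fst[OF 1(2) f] by (simp add: \<mu>(4) m\<^sub>0_def)
    qed
    have ulim: "uniform_limit UNIV (\<lambda>n. u (r n)) u\<^sub>0 sequentially"
      using filterlim_compose[OF r1(2) filterlim_subseq[OF strict_mono_o[OF r2(1) 1(1)]]]
      by (simp add: r_def o_def)
    have klim: "(\<lambda>n. k (r n)) \<longlonglongrightarrow> \<kappa>"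
      using LIMSEQ_subseq_LIMSEQ[OF r2(2) 1(1)] by (simp add: r_def o_def)
    have \<tau>lim: "(\<lambda>n. \<tau> (r n)) \<longlonglongrightarrow> 0"
      using LIMSEQ_subseq_LIMSEQ[OF \<tau>(3) r] by (simp add: o_def)
    interpret mfg_measure_limit L F CL UL H "\<lambda>n. \<tau> (r n)" "\<lambda>n. k (r n)" \<kappa> "\<lambda>n. m (r n)" m\<^sub>0
      "\<lambda>n. u (r n)" u\<^sub>0 "\<lambda>n. \<mu> (r n)" \<mu>\<^sub>0
      by unfold_locales
        (use H L_eq \<tau> m lax mlim ulim klim \<tau>lim \<mu> 1 m\<^sub>0_def in \<open>auto simp: r_def\<close>)
    show ?case
      by (rule that[OF r _ _ MFG_solution_limit]) (use mlim ulim in \<open>simp_all add: o_def\<close>)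
  qed
qed

theorem theorem2:
  fixes H L :: "'d::finite torus \<Rightarrow> real ^ 'd \<Rightarrow> real"
    and F :: "'d torus \<Rightarrow> 'd torus measure \<Rightarrow> real"
    and mm :: "real \<Rightarrow> real \<Rightarrow> 'd torus measure"
    and \<tau>\<^sub>0 :: real
  assumes H: "tonelli H"
    and L_eq: "L = lagrangian H"
    and L: "tonelli L"
    and F: "coupling F"
    and mm: "\<And>\<tau> lam. \<tau> \<in> {0<..<1} \<Longrightarrow> lam \<in> {0<..1} \<Longrightarrow>
      mm \<tau> lam \<in> borel_prob \<and>
      (\<exists>\<mu>. minimizing_discounted \<tau> lam (lag_at L F (mm \<tau> lam)) \<mu> \<and> mm \<tau> lam = distr \<mu> borel fst)"
    and tau0: "\<tau>\<^sub>0 \<in> {0<..1}"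
    and tau0_compact: "\<exists>K. compact K \<and>
      (\<forall>\<tau>\<in>{0<..<\<tau>\<^sub>0}. \<forall>m\<in>borel_prob. \<forall>\<mu>. minimizing_holonomic \<tau> (lag_at L F m) \<mu> \<longrightarrow> spt \<mu> \<subseteq> K)"
    and tau0_exists: "\<And>\<tau>. \<tau> \<in> {0<..<\<tau>\<^sub>0} \<Longrightarrow> \<exists>m. MFG_minimizing_holonomic \<tau> L F m"
  shows "(\<forall>\<tau>\<in>{0<..<\<tau>\<^sub>0}. \<exists>lams m0 u0. vanishing_discount_limit L F \<tau> (mm \<tau>) lams m0 u0) \<and>
    (\<forall>m0 u0.
      (\<forall>\<tau>\<in>{0<..<\<tau>\<^sub>0}. \<exists>lams. vanishing_discount_limit L F \<tau> (mm \<tau>) lams (m0 \<tau>) (u0 \<tau>)) \<longrightarrow>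
      (\<exists>\<tau>s m u. (\<forall>j. \<tau>s j \<in> {0<..<\<tau>\<^sub>0}) \<and> \<tau>s \<longlonglongrightarrow> 0 \<and>
        limitin weak_star (\<lambda>j. m0 (\<tau>s j)) m sequentially \<and>
        uniform_limit UNIV (\<lambda>j. u0 (\<tau>s j)) u sequentially \<and>
        MFG_solution H F u m))"
proof -
  obtain CL UL where "\<And>m. m \<in> borel_prob \<Longrightarrow> lagr (lag_at L F m) CL UL"
    using lag_at_lagr[OF L F] by blast
  then interpret mfg_lagrangian L F CL UL
    by (rule mfg_lagrangian.intro[OF L F])
  have small: "\<tau> \<in> {0<..<1}" if "\<tau> \<in> {0<..<\<tau>\<^sub>0}" for \<tau>
    using that tau0 by auto
  show ?thesis
  proof (intro conjI ballI allI impI)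
    fix \<tau> assume "\<tau> \<in> {0<..<\<tau>\<^sub>0}"
    then show "\<exists>lams m0 u0. vanishing_discount_limit L F \<tau> (mm \<tau>) lams m0 u0"
      using vanishing_discount_exists[OF small mm[OF small]] by blast
  next
    fix m0 :: "real \<Rightarrow> 'd torus measure" and u0 :: "real \<Rightarrow> 'd torus \<Rightarrow> real"
    assume lim: "\<forall>\<tau>\<in>{0<..<\<tau>\<^sub>0}. \<exists>lams. vanishing_discount_limit L F \<tau> (mm \<tau>) lams (m0 \<tau>) (u0 \<tau>)"
    \<comment> \<open>Dividing by \<open>n + 2\<close> rather than \<open>n + 1\<close> keeps
      \<open>t n\<close> strictly below \<open>\<tau>\<^sub>0\<close> already for
      \<open>n = 0\<close>.\<close>
    define t where "t n = \<tau>\<^sub>0 * inverse (real (Suc (Suc n)))" for n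
    have t: "t n \<in> {0<..<\<tau>\<^sub>0}" for n
    proof -
      have "0 < inverse (real (Suc (Suc n)))" "inverse (real (Suc (Suc n))) < 1"
        by (simp_all add: inverse_eq_divide)
      then show ?thesis
        using tau0 unfolding t_def by simp
    qed
    have "(\<lambda>n. \<tau>\<^sub>0 * inverse (real (Suc (Suc n)))) \<longlonglongrightarrow> \<tau>\<^sub>0 * 0"
      by (intro tendsto_intros LIMSEQ_Suc[OF LIMSEQ_inverse_real_of_nat])
    then have t0: "t \<longlonglongrightarrow> 0"
      by (simp add: t_def[abs_def])
    have "\<exists>lams. vanishing_discount_limit L F (t n) (mm (t n)) lams (m0 (t n)) (u0 (t n))" for n
      using lim t by blast
    then obtain lams where lams: "\<And>n. vanishing_discount_limit L F (t n) (mm (t n)) (lams n) (m0 (t n)) (u0 (t n))"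
      by metis
    have m0: "m0 (t n) \<in> borel_prob" for n
      by (rule vanishing_discount_limitD(1)[OF small[OF t] mm[OF small[OF t]] lams])
    have u0: "lax_eq (t n) (lag_at L F (m0 (t n))) 1 (t n * effective_const (t n) (lag_at L F (m0 (t n)))) (u0 (t n))" for n
      by (rule vanishing_discount_limitD(2)[OF small[OF t] mm[OF small[OF t]] lams])
    have bound: "\<bar>u0 (t n) X\<bar> \<le> (UL 1 - CL 1) * (torus_diam TYPE('d) + 1)" for n X
      by (rule vanishing_discount_limitD(3)[OF small[OF t] mm[OF small[OF t]] lams])
    have "\<exists>\<mu>. \<mu> \<in> holonomic (t n) \<and> integrable \<mu> (\<lambda>(X, v). lag_at L F (m0 (t n)) X v) \<and>
        (\<integral>(X, v). lag_at L F (m0 (t n)) X v \<partial>\<mu>) \<le> effective_const (t n) (lag_at L F (m0 (t n))) \<and>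
        m0 (t n) = distr \<mu> borel fst" for n
      by (rule vanishing_discount_limitD(4)[OF small[OF t] mm[OF small[OF t]] lams])
    then obtain \<mu> where \<mu>: "\<And>n. \<mu> n \<in> holonomic (t n)" "\<And>n. integrable (\<mu> n) (\<lambda>(X, v). lag_at L F (m0 (t n)) X v)"
        "\<And>n. (\<integral>(X, v). lag_at L F (m0 (t n)) X v \<partial>\<mu> n) \<le> effective_const (t n) (lag_at L F (m0 (t n)))"
        "\<And>n. m0 (t n) = distr (\<mu> n) borel fst"
      by metis
    have t1: "0 < t n" "t n < 1" for n
      using small[OF t[of n]] by auto
    obtain r m u where r: "strict_mono (r :: nat \<Rightarrow> nat)" "limitin weak_star ((\<lambda>n. m0 (t n)) \<circ> r) m sequentially"
        "uniform_limit UNIV ((\<lambda>n. u0 (t n)) \<circ> r) u sequentially" "MFG_solution H F u m"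
      by (rule vanishing_step_limit[OF H L_eq t1 t0 m0 u0 bound \<mu>]) (rule that)
    have "(\<lambda>n. t (r n)) \<longlonglongrightarrow> 0"
      using LIMSEQ_subseq_LIMSEQ[OF t0 r(1)] by (simp add: o_def)
    then show "\<exists>\<tau>s m u. (\<forall>j. \<tau>s j \<in> {0<..<\<tau>\<^sub>0}) \<and> \<tau>s \<longlonglongrightarrow> 0 \<and>
        limitin weak_star (\<lambda>j. m0 (\<tau>s j)) m sequentially \<and>
        uniform_limit UNIV (\<lambda>j. u0 (\<tau>s j)) u sequentially \<and> MFG_solution H F u m"
      using r t by (intro exI[of _ "\<lambda>n. t (r n)"] exI[of _ m] exI[of _ u]) (simp add: o_def)
  qed
qed

end
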